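(* Let $p,q,r,s\geq 0$ be computable reals with $p+q\leq 1$, $r+s\leq 1$ and $p+q+r+s<1+pr+qs$. If $R\in\mathcal{K}(2^\omega)$ is $\mu^*_{\langle p+r-pr,\,q+s-qs\rangle}$-Martin-L\"of random, then there exist $P,Q\in\mathcal{K}(2^\omega)$ such that (i) $P$ is $\mu^*_{\langle p,q\rangle}$-random relative to $Q$ (i.e. $x_P$ is $\mu_{\langle p,q\rangle}$-Martin-L\"of random relative to the oracle $x_Q$), (ii) $Q$ is $\mu^*_{\langle r,s\rangle}$-random relative to $P$ (i.e. $x_Q$ is $\mu_{\langle r,s\rangle}$-Martin-L\"of random relative to $x_P$), and (iii) $R=P\cap Q$.
   Context: $\mathcal{K}(2^\omega)$ denotes the set of non-empty closed subsets of Cantor space $2^\omega$. Coding: for $x\in 3^\omega$ define a tree $T_x\subseteq 2^{<\omega}$ inductively: $\epsilon\in T_x$; if $\sigma$ is the $(i+1)$-st node placed in $T_x$ (nodes processed in length-lexicographic order), then $\sigma0\in T_x,\sigma1\notin T_x$ if $x(i)=0$; $\sigma0\notin T_x,\sigma1\in T_x$ if $x(i)=1$; both $\sigma0,\sigma1\in T_x$ if $x(i)=2$. Every binary tree without dead ends is $T_x$ for a unique $x$, so each $C\in\mathcal{K}(2^\omega)$ has a unique code $x_C\in 3^\omega$ with $[T_{x_C}]=C$. For $p,q\geq 0$ with $p+q\leq 1$, $\mu_{\langle p,q\rangle}$ is the Bernoulli measure on $3^\omega$ with $\mu_{\langle p,q\rangle}(\sigma0)=p\,\mu_{\langle p,q\rangle}(\sigma)$,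 $\mu_{\langle p,q\rangle}(\sigma1)=q\,\mu_{\langle p,q\rangle}(\sigma)$, $\mu_{\langle p,q\rangle}(\sigma2)=(1-p-q)\mu_{\langle p,q\rangle}(\sigma)$ for all $\sigma\in 3^{<\omega}$; $\mu^*_{\langle p,q\rangle}$ is the induced measure on $\mathcal{K}(2^\omega)$. A closed set $C\in\mathcal{K}(2^\omega)$ is $\mu^*_{\langle p,q\rangle}$-Martin-L\"of random (relative to an oracle $z$) if its code $x_C$ is $\mu_{\langle p,q\rangle}$-Martin-L\"of random (relative to $z$). Martin-L\"of randomness is taken with respect to computable measures, so the parameters are computable reals. *)

theory Defs
  imports
    "HOL-Probability.Probability"
    "HOL-Library.Nat_Bijection"
    "HOL-Library.Countable"
begin

section \<open>Relative computability\<close>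

text \<open>
  The least element of \<open>{n. f (a, n) = 0}\<close>, provided the search from \<open>0\<close> upwards reaches it
  through defined values only.
\<close>

definition minimize :: "(nat \<rightharpoonup> nat) \<Rightarrow> (nat \<rightharpoonup> nat)" where
  "minimize f = (\<lambda>a.
     if \<exists>n. f (prod_encode (a, n)) = Some 0 \<and> (\<forall>m<n. f (prod_encode (a, m)) \<noteq> None)
     then Some (LEAST n. f (prod_encode (a, n)) = Some 0)
     else None)"

text \<open>
  Kleene's partial recursive functions relative to a set \<open>Z\<close> of total oracle functions. Functions
  of several arguments are represented as unary functions of Cantor-paired arguments, so that the
  projections and the formation of tuples become \<open>left\<close>, \<open>right\<close> and \<open>pair\<close>. The unrelativized
  notion is \<open>Z = {}\<close>.
\<close>

inductive partial_recursive :: "(nat \<Rightarrow> nat) set \<Rightarrow> (nat \<rightharpoonup> nat) \<Rightarrow> bool"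
  for Z :: "(nat \<Rightarrow> nat) set" where
  zero: "partial_recursive Z (\<lambda>_. Some 0)"
| succ: "partial_recursive Z (\<lambda>n. Some (Suc n))"
| left: "partial_recursive Z (\<lambda>n. Some (fst (prod_decode n)))"
| right: "partial_recursive Z (\<lambda>n. Some (snd (prod_decode n)))"
| oracle_call: "z \<in> Z \<Longrightarrow> partial_recursive Z (\<lambda>n. Some (z n))"
| pair: "partial_recursive Z f \<Longrightarrow> partial_recursive Z g \<Longrightarrow>
    partial_recursive Z
      (\<lambda>n. Option.bind (f n) (\<lambda>a. Option.bind (g n) (\<lambda>b. Some (prod_encode (a, b)))))"
| comp: "partial_recursive Z f \<Longrightarrow> partial_recursive Z g \<Longrightarrow>
    partial_recursive Z (\<lambda>n. Option.bind (g n) f)"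
| prim_rec: "partial_recursive Z f \<Longrightarrow> partial_recursive Z g \<Longrightarrow>
    partial_recursive Z
      (\<lambda>n. case prod_decode n of (a, m) \<Rightarrow>
         rec_nat (f a)
           (\<lambda>k v. Option.bind v (\<lambda>w. g (prod_encode (a, prod_encode (k, w))))) m)"
| mu: "partial_recursive Z f \<Longrightarrow> partial_recursive Z (minimize f)"

definition computable :: "(nat \<Rightarrow> nat) set \<Rightarrow> (nat \<Rightarrow> nat) \<Rightarrow> bool" where
  "computable Z f \<longleftrightarrow> partial_recursive Z (\<lambda>n. Some (f n))"

definition comp_enumerable :: "(nat \<Rightarrow> nat) set \<Rightarrow> nat set \<Rightarrow> bool" where
  "comp_enumerable Z A \<longleftrightarrow> (\<exists>f. partial_recursive Z f \<and> A = dom f)"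

definition computable_real :: "real \<Rightarrow> bool" where
  "computable_real a \<longleftrightarrow>
     (\<exists>f. computable {} f \<and> (\<forall>n. \<bar>a - of_rat (nat_to_rat_surj (f n))\<bar> \<le> 1 / 2 ^ n))"


section \<open>Bernoulli measures and Martin-Loef randomness on ternary sequences\<close>

datatype trit = T0 | T1 | T2

primrec trit_nat :: "trit \<Rightarrow> nat" where
  "trit_nat T0 = 0"
| "trit_nat T1 = 1"
| "trit_nat T2 = 2"

primrec trit_weight :: "real \<Rightarrow> real \<Rightarrow> trit \<Rightarrow> real" where
  "trit_weight p q T0 = p"
| "trit_weight p q T1 = q"
| "trit_weight p q T2 = 1 - p - q"

definition bernoulli :: "real \<Rightarrow> real \<Rightarrow> (nat \<Rightarrow> trit) measure" where
  "bernoulli p q = (\<Pi>\<^sub>M i\<in>UNIV. measure_pmf (embed_pmf (trit_weight p q)))"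

definition cylinder :: "'a list \<Rightarrow> (nat \<Rightarrow> 'a) set" where
  "cylinder \<sigma> = {x. map x [0..<length \<sigma>] = \<sigma>}"

definition str_code :: "trit list \<Rightarrow> nat" where
  "str_code \<sigma> = list_encode (map trit_nat \<sigma>)"

definition seq_oracle :: "(nat \<Rightarrow> trit) \<Rightarrow> (nat \<Rightarrow> nat)" where
  "seq_oracle x = (\<lambda>i. trit_nat (x i))"

text \<open>
  The \<open>n\<close>-th open set of a test is generated by the set \<open>W n\<close> of strings; the sets \<open>W n\<close> are
  enumerable relative to the oracle uniformly in \<open>n\<close>.
\<close>

definition ml_test ::
  "(nat \<Rightarrow> trit) measure \<Rightarrow> (nat \<Rightarrow> nat) set \<Rightarrow> (nat \<Rightarrow> trit list set) \<Rightarrow> bool" where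
  "ml_test M Z W \<longleftrightarrow>
     comp_enumerable Z {prod_encode (n, str_code \<sigma>) | n \<sigma>. \<sigma> \<in> W n} \<and>
     (\<forall>n. measure M (\<Union>\<sigma>\<in>W n. cylinder \<sigma>) \<le> 1 / 2 ^ n)"

definition ml_random ::
  "(nat \<Rightarrow> trit) measure \<Rightarrow> (nat \<Rightarrow> nat) set \<Rightarrow> (nat \<Rightarrow> trit) \<Rightarrow> bool" where
  "ml_random M Z x \<longleftrightarrow> (\<forall>W. ml_test M Z W \<longrightarrow> x \<notin> (\<Inter>n. \<Union>\<sigma>\<in>W n. cylinder \<sigma>))"


section \<open>Coding of closed sets\<close>

definition closed_sets :: "(nat \<Rightarrow> bool) set set" where
  "closed_sets = {C. closed C \<and> C \<noteq> {}}"

primrec children :: "trit \<Rightarrow> bool list \<Rightarrow> bool list list" where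
  "children T0 \<sigma> = [\<sigma> @ [False]]"
| "children T1 \<sigma> = [\<sigma> @ [True]]"
| "children T2 \<sigma> = [\<sigma> @ [False], \<sigma> @ [True]]"

text \<open>
  \<open>placed x i\<close> lists the nodes placed after the first \<open>i\<close> nodes have been processed. Each node is
  processed by appending its children at the end of the list, so this is a breadth-first traversal
  and the nodes occur in length-lexicographic order; entry \<open>i\<close> is the \<open>(i+1)\<close>-st node.
\<close>

primrec placed :: "(nat \<Rightarrow> trit) \<Rightarrow> nat \<Rightarrow> bool list list" where
  "placed x 0 = [[]]"
| "placed x (Suc i) = placed x i @ children (x i) (placed x i ! i)"

definition code_tree :: "(nat \<Rightarrow> trit) \<Rightarrow> bool list set" where
  "code_tree x = (\<Union>i. set (placed x i))"

definition branches :: "bool list set \<Rightarrow> (nat \<Rightarrow> bool) set" where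
  "branches T = {X. \<forall>n. map X [0..<n] \<in> T}"

text \<open>Well-definedness is theorem \<open>bij_betw_branches_code_tree\<close> below.\<close>

definition set_code :: "(nat \<Rightarrow> bool) set \<Rightarrow> (nat \<Rightarrow> trit)" where
  "set_code C = (THE x. branches (code_tree x) = C)"

definition closed_random ::
  "real \<Rightarrow> real \<Rightarrow> (nat \<Rightarrow> nat) set \<Rightarrow> (nat \<Rightarrow> bool) set \<Rightarrow> bool" where
  "closed_random p q Z C \<longleftrightarrow> ml_random (bernoulli p q) Z (set_code C)"


section \<open>The Bernoulli measure of a cylinder\<close>

lemma UNIV_trit: "UNIV = {T0, T1, T2}"
  using trit.exhaust by blast

lemma pmf_trit:
  assumes "0 \<le> p" "0 \<le> q" "p + q \<le> 1"
  shows "pmf (embed_pmf (trit_weight p q)) d = trit_weight p q d"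
proof (rule pmf_embed_pmf)
  show nn: "0 \<le> trit_weight p q x" for x
    using assms by (cases x) auto
  have "finite (UNIV :: trit set)" by (simp add: UNIV_trit)
  then have "(\<integral>\<^sup>+x. ennreal (trit_weight p q x) \<partial>count_space UNIV)
      = (\<Sum>x\<in>UNIV. ennreal (trit_weight p q x))"
    by (rule nn_integral_count_space_finite)
  also have "\<dots> = ennreal (\<Sum>x\<in>UNIV. trit_weight p q x)"
    by (simp add: nn sum_ennreal)
  also have "\<dots> = 1" by (simp add: UNIV_trit)
  finally show "(\<integral>\<^sup>+x. ennreal (trit_weight p q x) \<partial>count_space UNIV) = 1" .
qed

lemma cylinder_iff: "x \<in> cylinder \<sigma> \<longleftrightarrow> (\<forall>i<length \<sigma>. x i = \<sigma> ! i)"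
  unfolding cylinder_def mem_Collect_eq list_eq_iff_nth_eq by simp

lemma emeasure_bernoulli_cylinder:
  "emeasure (bernoulli p q) (cylinder \<sigma>) =
     (\<Prod>i<length \<sigma>. ennreal (pmf (embed_pmf (trit_weight p q)) (\<sigma> ! i)))"
proof -
  interpret product_prob_space "\<lambda>i::nat. measure_pmf (embed_pmf (trit_weight p q))" UNIV
    by unfold_locales
  have "cylinder \<sigma> = {x \<in> space (bernoulli p q). \<forall>i\<in>{..<length \<sigma>}. x i \<in> {\<sigma> ! i}}"
    by (auto simp: cylinder_iff bernoulli_def space_PiM)
  then show ?thesis
    using emeasure_PiM_Collect[of "{..<length \<sigma>}" "\<lambda>i. {\<sigma> ! i}"]
    by (simp add: bernoulli_def emeasure_pmf_single)
qed

lemma measure_bernoulli_cylinder_Nil: "measure (bernoulli p q) (cylinder []) = 1"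
  using emeasure_bernoulli_cylinder[of p q "[]"] by (simp add: measure_def)

lemma measure_bernoulli_cylinder_snoc:
  assumes "0 \<le> p" "0 \<le> q" "p + q \<le> 1"
  shows "measure (bernoulli p q) (cylinder (\<sigma> @ [d])) =
    trit_weight p q d * measure (bernoulli p q) (cylinder \<sigma>)"
proof -
  have "(\<Prod>i<length \<sigma>. ennreal (pmf (embed_pmf (trit_weight p q)) ((\<sigma> @ [d]) ! i))) =
        (\<Prod>i<length \<sigma>. ennreal (pmf (embed_pmf (trit_weight p q)) (\<sigma> ! i)))"
    by (intro prod.cong) (auto simp: nth_append)
  then have "emeasure (bernoulli p q) (cylinder (\<sigma> @ [d])) =
      emeasure (bernoulli p q) (cylinder \<sigma>) * ennreal (pmf (embed_pmf (trit_weight p q)) d)"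
    by (simp add: emeasure_bernoulli_cylinder)
  moreover have "0 \<le> trit_weight p q d" using pmf_nonneg pmf_trit[OF assms] by metis
  ultimately show ?thesis
    by (simp add: measure_def enn2real_mult pmf_trit[OF assms])
qed


section \<open>Every non-empty closed set has exactly one code\<close>

lemma length_placed: "i < length (placed x i)"
proof (induction i)
  case (Suc i)
  have "0 < length (children (x i) (placed x i ! i))" by (cases "x i") auto
  then show ?case using Suc unfolding placed.simps length_append by linarith
qed simp

lemma placed_prefix: "i \<le> j \<Longrightarrow> \<exists>ys. placed x j = placed x i @ ys"
  by (induction j rule: dec_induct) auto

lemma placed_nth:
  "k < length (placed x i) \<Longrightarrow> k < length (placed x j) \<Longrightarrow> placed x i ! k = placed x j ! k"
proof (induction i j rule: linorder_wlog)
  case (le i j)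
  then show ?case using placed_prefix[of i j x] by (auto simp: nth_append)
qed simp

lemma mem_placed_iff:
  "\<tau> \<in> set (placed x i) \<longleftrightarrow>
     \<tau> = [] \<or> (\<exists>j<i. \<tau> \<in> set (children (x j) (placed x j ! j)))"
  by (induction i) (auto simp: less_Suc_eq)

lemma mem_code_tree_iff:
  "\<tau> \<in> code_tree x \<longleftrightarrow> \<tau> = [] \<or> (\<exists>j. \<tau> \<in> set (children (x j) (placed x j ! j)))"
  unfolding code_tree_def UN_iff mem_placed_iff using lessI by blast

lemma mem_children: "\<tau> \<in> set (children d \<sigma>) \<Longrightarrow> \<exists>b. \<tau> = \<sigma> @ [b]"
  by (cases d) auto

lemma distinct_placed: "distinct (placed x i)"
proof (induction i)
  case (Suc i)
  have "\<tau> \<notin> set (placed x i)" if "\<tau> \<in> set (children (x i) (placed x i ! i))" for \<tau>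
  proof
    assume a: "\<tau> \<in> set (placed x i)"
    obtain b where b: "\<tau> = placed x i ! i @ [b]" using mem_children[OF \<open>\<tau> \<in> set (children _ _)\<close>] ..
    with a obtain j where j: "j < i" "\<tau> \<in> set (children (x j) (placed x j ! j))"
      by (auto simp: mem_placed_iff)
    then have "placed x j ! j = placed x i ! i" using b mem_children by fastforce
    moreover have "placed x j ! j = placed x i ! j"
      using j length_placed[of j x] length_placed[of i x] by (intro placed_nth) auto
    ultimately show False
      using Suc j length_placed[of i x] by (simp add: nth_eq_iff_index_eq)
  qed
  moreover have "distinct (children (x i) (placed x i ! i))" by (cases "x i") auto
  ultimately show ?case using Suc by auto
qed simp

lemma placed_diag_inj: "placed x i ! i = placed x j ! j \<Longrightarrow> i = j"
proof (induction i j rule: linorder_wlog)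
  case (le i j)
  have "placed x i ! i = placed x j ! i"
    using le length_placed[of i x] length_placed[of j x] by (intro placed_nth) auto
  then show ?case
    using le length_placed[of j x] distinct_placed[of x j] by (simp add: nth_eq_iff_index_eq)
qed simp

lemma placed_diag_mem: "placed x i ! i \<in> code_tree x"
  using nth_mem[OF length_placed[of i x]] unfolding code_tree_def by blast

lemma placed_diag_surj: "\<sigma> \<in> code_tree x \<Longrightarrow> \<exists>i. \<sigma> = placed x i ! i"
proof -
  assume "\<sigma> \<in> code_tree x"
  then obtain n k where "k < length (placed x n)" "\<sigma> = placed x n ! k"
    by (auto simp: code_tree_def in_set_conv_nth)
  then have "\<sigma> = placed x k ! k" using placed_nth length_placed by metis
  then show ?thesis ..
qed

lemma child_mem_iff:
  "placed x i ! i @ [b] \<in> code_tree x \<longleftrightarrow>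
     placed x i ! i @ [b] \<in> set (children (x i) (placed x i ! i))"
proof
  assume "placed x i ! i @ [b] \<in> code_tree x"
  then obtain j where j: "placed x i ! i @ [b] \<in> set (children (x j) (placed x j ! j))"
    by (auto simp: mem_code_tree_iff)
  then have "placed x i ! i = placed x j ! j" using mem_children by fastforce
  then have "i = j" by (rule placed_diag_inj)
  with j show "placed x i ! i @ [b] \<in> set (children (x i) (placed x i ! i))" by simp
qed (auto simp: mem_code_tree_iff)

lemma child_mem_iff':
  "placed x i ! i @ [False] \<in> code_tree x \<longleftrightarrow> x i \<noteq> T1"
  "placed x i ! i @ [True] \<in> code_tree x \<longleftrightarrow> x i \<noteq> T0"
  by (cases "x i"; simp add: child_mem_iff)+

lemma code_tree_inj:
  assumes "code_tree x = code_tree y"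
  shows "x = y"
proof
  have "placed x i = placed y i \<and> x i = y i" if "placed x i = placed y i" for i
  proof -
    have "x i \<noteq> T1 \<longleftrightarrow> y i \<noteq> T1" "x i \<noteq> T0 \<longleftrightarrow> y i \<noteq> T0"
      using child_mem_iff'[of x i] child_mem_iff'[of y i] that assms by auto
    then show ?thesis using that by (cases "x i"; cases "y i"; simp)
  qed
  then have "placed x i = placed y i \<and> x i = y i" for i
    by (induction i) auto
  then show "x i = y i" for i by simp
qed

lemma code_tree_butlast: "\<sigma> @ [b] \<in> code_tree x \<Longrightarrow> \<sigma> \<in> code_tree x"
proof -
  assume "\<sigma> @ [b] \<in> code_tree x"
  then obtain j where "\<sigma> @ [b] \<in> set (children (x j) (placed x j ! j))"
    by (auto simp: mem_code_tree_iff)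
  then have "\<sigma> = placed x j ! j" using mem_children by fastforce
  then show ?thesis using placed_diag_mem by simp
qed

lemma code_tree_prefix: "\<sigma> @ \<tau> \<in> code_tree x \<Longrightarrow> \<sigma> \<in> code_tree x"
  by (induction \<tau> rule: rev_induct) (auto simp flip: append_assoc dest: code_tree_butlast)

lemma code_tree_extend: "\<sigma> \<in> code_tree x \<Longrightarrow> \<exists>b. \<sigma> @ [b] \<in> code_tree x"
  using placed_diag_surj child_mem_iff' trit.distinct by metis

definition extend_node :: "(nat \<Rightarrow> trit) \<Rightarrow> bool list \<Rightarrow> nat \<Rightarrow> bool list" where
  "extend_node x \<sigma> n = ((\<lambda>\<tau>. \<tau> @ [SOME b. \<tau> @ [b] \<in> code_tree x]) ^^ n) \<sigma>"

lemma code_tree_branch: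
  assumes "\<sigma> \<in> code_tree x"
  shows "\<exists>X\<in>branches (code_tree x). map X [0..<length \<sigma>] = \<sigma>"
proof -
  let ?e = "extend_node x \<sigma>"
  have mem: "?e n \<in> code_tree x" for n
  proof (induction n)
    case (Suc n)
    show ?case using someI_ex[OF code_tree_extend[OF Suc]] by (simp add: extend_node_def)
  qed (simp add: extend_node_def assms)
  have len: "length (?e n) = length \<sigma> + n" for n
    by (induction n) (auto simp: extend_node_def)
  have pre: "\<exists>ys. ?e n = ?e m @ ys" if "m \<le> n" for m n
    using that by (induction n rule: dec_induct) (auto simp: extend_node_def)
  define X where "X k = ?e (Suc k) ! k" for k
  have Xe: "X k = ?e n ! k" if "k < length \<sigma> + n" for k n
  proof (cases "n \<le> Suc k")
    case True
    then show ?thesis using pre[OF True] that len[of n] by (auto simp: X_def nth_append)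
  next
    case False
    then have "Suc k \<le> n" by simp
    from pre[OF this] show ?thesis using len[of "Suc k"] by (auto simp: X_def nth_append)
  qed
  have "map X [0..<n] \<in> code_tree x" for n
  proof -
    have "map X [0..<n] = take n (?e n)"
      by (rule nth_equalityI) (simp_all add: len Xe[of _ n])
    then show ?thesis using code_tree_prefix[of "take n (?e n)" "drop n (?e n)"] mem by simp
  qed
  moreover have "map X [0..<length \<sigma>] = \<sigma>"
    by (rule nth_equalityI) (simp_all add: Xe[of _ 0], simp add: extend_node_def)
  ultimately show ?thesis by (auto simp: branches_def)
qed

lemma code_tree_eq: "code_tree x = {map X [0..<n] | X n. X \<in> branches (code_tree x)}"
proof
  show "code_tree x \<subseteq> {map X [0..<n] | X n. X \<in> branches (code_tree x)}"
    using code_tree_branch by (metis (mono_tags, lifting) mem_Collect_eq subsetI)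
qed (auto simp: branches_def)

lemma closed_branches: "closed (branches T)"
proof -
  have "closed {X :: nat \<Rightarrow> bool. X i = b}" for i b
    by (intro closed_Collect_eq continuous_intros continuous_on_product_coordinates)
  then have cyl: "closed (cylinder \<sigma> :: (nat \<Rightarrow> bool) set)" for \<sigma>
    by (subst set_eqI[of "cylinder \<sigma>" "\<Inter>i\<in>{..<length \<sigma>}. {X. X i = \<sigma> ! i}"])
      (auto simp: cylinder_iff)
  have "closed {X. map X [0..<n] \<in> T}" for n
  proof -
    have "{X. map X [0..<n] \<in> T} = (\<Union>\<sigma>\<in>{\<sigma>\<in>T. length \<sigma> = n}. cylinder \<sigma>)"
      by (auto simp: cylinder_def)
    moreover have "finite {\<sigma>\<in>T. length \<sigma> = n}"
      by (rule finite_subset[OF _ finite_lists_length_eq[of UNIV n]]) auto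
    ultimately show ?thesis using cyl by auto
  qed
  moreover have "branches T = (\<Inter>n. {X. map X [0..<n] \<in> T})"
    by (auto simp: branches_def)
  ultimately show ?thesis by auto
qed

lemma branches_of_closed:
  fixes C :: "(nat \<Rightarrow> bool) set"
  assumes "closed C"
  shows "branches {map X [0..<n] | X n. X \<in> C} = C"
proof
  show "branches {map X [0..<n] | X n. X \<in> C} \<subseteq> C"
  proof (rule subsetI, rule ccontr)
    fix X assume X: "X \<in> branches {map X [0..<n] | X n. X \<in> C}" and "X \<notin> C"
    have "openin (product_topology (\<lambda>i. euclidean) UNIV) (- C)"
      using assms by (simp add: open_fun_def closed_def)
    then obtain B where B: "X \<in> Pi\<^sub>E UNIV B" "finite {i. B i \<noteq> UNIV}" "Pi\<^sub>E UNIV B \<subseteq> - C"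
      using product_topology_open_contains_basis[of "\<lambda>i. euclidean" UNIV "- C" X] \<open>X \<notin> C\<close>
      by auto
    obtain n where n: "\<And>i. B i \<noteq> UNIV \<Longrightarrow> i < n"
      using finite_nat_set_iff_bounded[of "{i. B i \<noteq> UNIV}"] B(2) by auto
    obtain Y k where Y: "Y \<in> C" "map X [0..<n] = map Y [0..<k]"
      using X unfolding branches_def by blast
    then have "k = n" by (metis length_map length_upt diff_zero)
    have "Y i \<in> B i" for i
    proof (cases "B i = UNIV")
      case False
      then have "X i = Y i" using n Y(2) \<open>k = n\<close> by auto
      moreover have "X i \<in> B i" using B(1) by (simp add: PiE_iff)
      ultimately show ?thesis by (simp only:)
    qed simp
    then show False using B(3) Y(1) by auto
  qed
qed (auto simp: branches_def)

lemma code_exists: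
  assumes "closed C" "C \<noteq> {}"
  shows "\<exists>x. branches (code_tree x) = C"
proof -
  define T where "T = {map X [0..<n] | X n. X \<in> C}"
  have TNil: "[] \<in> T"
    using assms(2) by (auto simp: T_def intro!: exI[of _ 0])
  have Tbut: "\<sigma> \<in> T" if "\<sigma> @ [b] \<in> T" for \<sigma> b
  proof -
    from that obtain X n where Xn: "X \<in> C" "\<sigma> @ [b] = map X [0..<n]" by (auto simp: T_def)
    then have "\<sigma> = map X [0..<length \<sigma>]"
      by (cases n) (auto simp: map_eq_append_conv)
    then show ?thesis using Xn(1) by (auto simp: T_def)
  qed
  have Text: "\<sigma> @ [False] \<in> T \<or> \<sigma> @ [True] \<in> T" if "\<sigma> \<in> T" for \<sigma>
  proof -
    from that obtain X n where Xn: "X \<in> C" "\<sigma> = map X [0..<n]" by (auto simp: T_def)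
    then have "\<sigma> @ [X n] = map X [0..<Suc n]" by simp
    then have "\<sigma> @ [X n] \<in> T" using Xn(1) unfolding T_def by blast
    then show ?thesis by (cases "X n") auto
  qed
  define d where "d \<sigma> = (if \<sigma> @ [True] \<notin> T then T0 else if \<sigma> @ [False] \<notin> T then T1 else T2)" for \<sigma>
  have d: "\<tau> \<in> set (children (d \<sigma>) \<sigma>) \<longleftrightarrow> \<tau> \<in> T \<and> (\<exists>b. \<tau> = \<sigma> @ [b])" if "\<sigma> \<in> T" for \<sigma> \<tau>
    using Text[OF that] by (auto simp: d_def) (metis (full_types))+
  define L where "L = rec_nat [[]] (\<lambda>i ps. ps @ children (d (ps ! i)) (ps ! i))"
  define x where "x i = d (L i ! i)" for i
  have L: "placed x i = L i" for i
    by (induction i) (simp_all add: L_def x_def)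
  have x: "x i = d (placed x i ! i)" for i by (simp add: L x_def)
  have sub: "set (placed x i) \<subseteq> T" for i
  proof (induction i)
    case (Suc i)
    then have "placed x i ! i \<in> T" using length_placed[of i x] by auto
    then show ?case using Suc d x[of i] by auto
  qed (simp add: TNil)
  have "code_tree x = T"
  proof
    show "code_tree x \<subseteq> T" using sub by (auto simp: code_tree_def)
    have "\<sigma> \<in> T \<Longrightarrow> \<sigma> \<in> code_tree x" for \<sigma>
    proof (induction \<sigma> rule: rev_induct)
      case (snoc b \<sigma>)
      then have "\<sigma> \<in> T" "\<sigma> \<in> code_tree x" using Tbut by auto
      then obtain i where "\<sigma> = placed x i ! i" using placed_diag_surj by blast
      then show ?case using d[OF \<open>\<sigma> \<in> T\<close>] snoc.prems x[of i] by (auto simp: child_mem_iff)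
    qed (simp add: mem_code_tree_iff)
    then show "T \<subseteq> code_tree x" by auto
  qed
  then have "branches (code_tree x) = C"
    using branches_of_closed[OF assms(1)] by (simp add: T_def)
  then show ?thesis by (intro exI[of _ x])
qed

theorem bij_betw_branches_code_tree:
  "bij_betw (\<lambda>x. branches (code_tree x)) UNIV closed_sets"
  unfolding bij_betw_def
proof
  show "inj (\<lambda>x. branches (code_tree x))"
  proof (rule injI)
    fix x y assume "branches (code_tree x) = branches (code_tree y)"
    then have "code_tree x = code_tree y"
      by (subst (1 2) code_tree_eq) simp
    then show "x = y" by (rule code_tree_inj)
  qed
  have "branches (code_tree x) \<noteq> {}" for x
    using code_tree_branch[of "[]" x] by (auto simp: mem_code_tree_iff)
  then have "range (\<lambda>x. branches (code_tree x)) \<subseteq> closed_sets"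
    using closed_branches by (auto simp: closed_sets_def)
  moreover have "C \<in> range (\<lambda>x. branches (code_tree x))" if "C \<in> closed_sets" for C
  proof -
    from that obtain x where "branches (code_tree x) = C"
      using code_exists unfolding closed_sets_def by blast
    then show ?thesis by blast
  qed
  ultimately show "range (\<lambda>x. branches (code_tree x)) = closed_sets" by blast
qed

lemma branches_set_code:
  assumes "C \<in> closed_sets"
  shows "branches (code_tree (set_code C)) = C"
proof -
  have "inj (\<lambda>x. branches (code_tree x))"
    using bij_betw_branches_code_tree by (rule bij_betw_imp_inj_on)
  moreover obtain x where "branches (code_tree x) = C"
    using code_exists assms unfolding closed_sets_def by blast
  ultimately have "\<exists>!x. branches (code_tree x) = C"
    by (intro ex1I[of _ x]) (auto dest: injD)
  then show ?thesis unfolding set_code_def by (rule theI')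
qed

end

theory Submission
  imports Defs
begin

text \<open>
  If \<open>P\<close> and \<open>Q\<close> are chosen at random, the common nodes of their trees form a branching process
  with mean offspring \<open>2 - p - q - r - s + p r + q s > 1\<close>, which survives with probability
  \<open>1 - e > 0\<close>; given survival, the nodes with infinite progeny form the tree of a
  \<open>\<langle>p + r - p r, q + s - q s\<rangle>\<close>-random closed set \<open>P \<inter> Q\<close>. We invert this: given the code of
  \<open>R\<close>, the labels of \<open>P\<close> and \<open>Q\<close> are chosen node by node from their conditional distribution given
  \<open>R\<close>. Averaged over \<open>R\<close>, the law of the pair has density at most \<open>1 / (1 - e)\<close> with respect to the
  product measure. Hence if, for a fixed \<open>R\<close>, a relativized test caught the pair with positive
  conditional probability, then those \<open>R'\<close> for which its \<open>n\<close>-th components have conditional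
  probability above a fixed bound would form a test catching \<open>R\<close>. So for random \<open>R\<close> almost every
  choice of labels escapes all of the countably many tests; and almost surely \<open>P \<inter> Q = R\<close>, as the
  common subtrees off the tree of \<open>R\<close> are subcritical.
\<close>

section \<open>Closure properties of the computable functions\<close>

text \<open>The oracle of each test is the other member of the random pair, so a test that catches
  one pair may violate its measure bound for the oracles of other pairs. Of a simulated test only
  those stages are counted whose measure bound is certified, which gives events with a bound valid
  for every oracle. Labels are attached to all nodes of the full binary tree. The first
  \<open>N\<close> labels are then independent under the product measure, and their conditional law
  given \<open>R\<close> has one factor per node, depending on \<open>R\<close> and on earlier
  labels only through the mode of the node. The constant \<open>e\<close> is the smaller fixed point
  of t = none + (1 - none - a2) t + a2 t^2, where the right side is the generating function of the
  number of common children. The other fixed point is 1, and the hypothesis on the parameters says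
  \<open>none < a2\<close>, that is, \<open>e < 1\<close>. The factor \<open>1 / (1 - e)\<close> is
  the price of conditioning on survival of the root; a bounded density suffices because a constant
  factor is absorbed by shifting the index of a test.\<close>

abbreviation enc :: "nat \<Rightarrow> nat \<Rightarrow> nat" where
  "enc a b \<equiv> prod_encode (a, b)"

abbreviation pfst :: "nat \<Rightarrow> nat" where
  "pfst n \<equiv> fst (prod_decode n)"

abbreviation psnd :: "nat \<Rightarrow> nat" where
  "psnd n \<equiv> snd (prod_decode n)"

abbreviation cf :: "(nat \<Rightarrow> nat) \<Rightarrow> bool" where
  "cf \<equiv> computable {}"

text \<open>
  In the rules below the argument of a unary function plays the role of an environment that codes
  the values of all free variables; a rule for a binder extends the environment by pairing.
\<close>

definition decidable :: "(nat \<Rightarrow> bool) \<Rightarrow> bool" where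
  "decidable P \<longleftrightarrow> cf (\<lambda>e. of_bool (P e))"

named_theorems cf_intros

lemma cf_Suc0: "cf Suc"
  unfolding computable_def by (rule partial_recursive.succ)

lemma cf_comp: "cf f \<Longrightarrow> cf g \<Longrightarrow> cf (\<lambda>e. f (g e))"
  unfolding computable_def using partial_recursive.comp[of "{}" "\<lambda>n. Some (f n)" "\<lambda>n. Some (g n)"]
  by simp

lemma cf_enc [cf_intros]: "cf f \<Longrightarrow> cf g \<Longrightarrow> cf (\<lambda>e. enc (f e) (g e))"
  unfolding computable_def using partial_recursive.pair[of "{}" "\<lambda>n. Some (f n)" "\<lambda>n. Some (g n)"]
  by simp

lemma cf_pfst0: "cf (\<lambda>n. pfst n)"
  unfolding computable_def by (rule partial_recursive.left)

lemma cf_psnd0: "cf (\<lambda>n. psnd n)"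
  unfolding computable_def by (rule partial_recursive.right)

lemma cf_Suc [cf_intros]: "cf f \<Longrightarrow> cf (\<lambda>e. Suc (f e))"
  using cf_comp[OF cf_Suc0] by simp

lemma cf_pfst [cf_intros]: "cf f \<Longrightarrow> cf (\<lambda>e. pfst (f e))"
  using cf_comp[OF cf_pfst0] by simp

lemma cf_psnd [cf_intros]: "cf f \<Longrightarrow> cf (\<lambda>e. psnd (f e))"
  using cf_comp[OF cf_psnd0] by simp

lemma cf_const [cf_intros]: "cf (\<lambda>e. k)"
proof (induction k)
  case 0
  show ?case unfolding computable_def by (rule partial_recursive.zero)
qed (rule cf_Suc)

text \<open>The identity is no base function; it is the pairing of the two projections.\<close>

lemma cf_id [cf_intros]: "cf (\<lambda>e. e)"
  using cf_enc[OF cf_pfst0 cf_psnd0] by simp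

lemma cf_rec0:
  assumes "cf f" "cf g"
  shows "cf (\<lambda>n. rec_nat (f (pfst n)) (\<lambda>k w. g (enc (pfst n) (enc k w))) (psnd n))"
proof -
  have *: "rec_nat (Some a) (\<lambda>k v. Option.bind v (\<lambda>w. Some (G k w))) m =
      Some (rec_nat a G m)" for a m and G :: "nat \<Rightarrow> nat \<Rightarrow> nat"
    by (induction m) auto
  show ?thesis
    using partial_recursive.prim_rec[of "{}" "\<lambda>n. Some (f n)" "\<lambda>n. Some (g n)"] assms
    unfolding computable_def * by (simp add: case_prod_beta)
qed

lemma cf_rec [cf_intros]:
  assumes "cf f" "cf m" "cf (\<lambda>n. g (pfst n) (pfst (psnd n)) (psnd (psnd n)))"
  shows "cf (\<lambda>e. rec_nat (f e) (\<lambda>k w. g e k w) (m e))"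
  using cf_comp[OF cf_rec0[OF assms(1,3)] cf_enc[OF cf_id assms(2)]] by simp

lemma cf_app1:
  assumes "cf (\<lambda>n. h (pfst n) (psnd n))" "cf f" "cf g"
  shows "cf (\<lambda>e. h (f e) (g e))"
  using cf_comp[OF assms(1) cf_enc[OF assms(2,3)]] by simp

lemma cf_add [cf_intros]: "cf f \<Longrightarrow> cf g \<Longrightarrow> cf (\<lambda>e. f e + g e)"
proof -
  assume a: "cf f" "cf g"
  have "rec_nat a (\<lambda>k w. Suc w) m = a + m" for a m :: nat by (induction m) auto
  moreover have "cf (\<lambda>e. rec_nat (f e) (\<lambda>k w. Suc w) (g e))" by (intro a cf_intros)
  ultimately show ?thesis by simp
qed

lemma cf_pred: "cf f \<Longrightarrow> cf (\<lambda>e. f e - 1)"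
proof -
  assume a: "cf f"
  have "rec_nat 0 (\<lambda>k w. k) m = m - 1" for m :: nat by (induction m) auto
  moreover have "cf (\<lambda>e. rec_nat 0 (\<lambda>k w. k) (f e))" by (intro a cf_intros)
  ultimately show ?thesis by simp
qed

lemma cf_diff [cf_intros]: "cf f \<Longrightarrow> cf g \<Longrightarrow> cf (\<lambda>e. f e - g e)"
proof -
  assume a: "cf f" "cf g"
  have "rec_nat a (\<lambda>k w. w - 1) m = a - m" for a m :: nat by (induction m) auto
  moreover have "cf (\<lambda>e. rec_nat (f e) (\<lambda>k w. w - 1) (g e))" by (intro a cf_intros cf_pred)
  ultimately show ?thesis by simp
qed

lemma cf_mult [cf_intros]: "cf f \<Longrightarrow> cf g \<Longrightarrow> cf (\<lambda>e. f e * g e)"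
proof -
  assume a: "cf f" "cf g"
  have "rec_nat 0 (\<lambda>k w. w + a) m = a * m" for a m :: nat by (induction m) auto
  moreover have "cf (\<lambda>e. rec_nat 0 (\<lambda>k w. w + f e) (g e))"
    by (intro a cf_intros cf_comp[OF a(1)])
  ultimately show ?thesis by simp
qed

lemma cf_power [cf_intros]: "cf f \<Longrightarrow> cf g \<Longrightarrow> cf (\<lambda>e. f e ^ g e)"
proof -
  assume a: "cf f" "cf g"
  have "rec_nat 1 (\<lambda>k w. w * a) m = a ^ m" for a m :: nat by (induction m) auto
  moreover have "cf (\<lambda>e. rec_nat 1 (\<lambda>k w. w * f e) (g e))"
    by (intro a cf_intros cf_comp[OF a(1)])
  ultimately show ?thesis by simp
qed

lemma cf_sum [cf_intros]:
  assumes "cf g" "cf (\<lambda>n. f (pfst n) (psnd n))"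
  shows "cf (\<lambda>e. \<Sum>i<g e. f e i)"
proof -
  have "rec_nat 0 (\<lambda>k w. w + h k) m = (\<Sum>i<m. h i)" for m :: nat and h :: "nat \<Rightarrow> nat"
    by (induction m) auto
  moreover have "cf (\<lambda>e. rec_nat 0 (\<lambda>k w. w + f e k) (g e))"
    by (intro assms cf_intros cf_app1[OF assms(2)])
  ultimately show ?thesis by simp
qed

lemma cf_prod [cf_intros]:
  assumes "cf g" "cf (\<lambda>n. f (pfst n) (psnd n))"
  shows "cf (\<lambda>e. \<Prod>i<g e. f e i)"
proof -
  have "rec_nat 1 (\<lambda>k w. w * h k) m = (\<Prod>i<m. h i)" for m :: nat and h :: "nat \<Rightarrow> nat"
    by (induction m) auto
  moreover have "cf (\<lambda>e. rec_nat 1 (\<lambda>k w. w * f e k) (g e))"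
    by (intro assms cf_intros cf_app1[OF assms(2)])
  ultimately show ?thesis by simp
qed

lemma cf_of_bool [cf_intros]: "decidable P \<Longrightarrow> cf (\<lambda>e. of_bool (P e))"
  unfolding decidable_def .

lemma decidable_const [cf_intros]: "decidable (\<lambda>e. b)"
  unfolding decidable_def by (rule cf_const)

lemma decidable_le [cf_intros]: "cf f \<Longrightarrow> cf g \<Longrightarrow> decidable (\<lambda>e. f e \<le> g e)"
proof -
  assume a: "cf f" "cf g"
  have "of_bool (x \<le> y) = 1 - (x - y)" for x y :: nat by auto
  then show ?thesis unfolding decidable_def by simp (intro a cf_intros)
qed

lemma decidable_not [cf_intros]: "decidable P \<Longrightarrow> decidable (\<lambda>e. \<not> P e)"
proof -
  assume "decidable P"
  then have "cf (\<lambda>e. 1 - of_bool (P e))" by (intro cf_intros)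
  moreover have "of_bool (\<not> b) = 1 - (of_bool b :: nat)" for b by simp
  ultimately show ?thesis unfolding decidable_def by simp
qed

lemma decidable_conj [cf_intros]: "decidable P \<Longrightarrow> decidable Q \<Longrightarrow> decidable (\<lambda>e. P e \<and> Q e)"
proof -
  assume "decidable P" "decidable Q"
  then have "cf (\<lambda>e. of_bool (P e) * of_bool (Q e))" by (intro cf_intros)
  then show ?thesis unfolding decidable_def of_bool_conj .
qed

lemma decidable_disj [cf_intros]: "decidable P \<Longrightarrow> decidable Q \<Longrightarrow> decidable (\<lambda>e. P e \<or> Q e)"
proof -
  assume "decidable P" "decidable Q"
  then have "decidable (\<lambda>e. \<not> (\<not> P e \<and> \<not> Q e))" by (intro cf_intros)
  then show ?thesis by simp
qed

lemma decidable_imp [cf_intros]: "decidable P \<Longrightarrow> decidable Q \<Longrightarrow> decidable (\<lambda>e. P e \<longrightarrow> Q e)"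
proof -
  assume "decidable P" "decidable Q"
  then have "decidable (\<lambda>e. \<not> P e \<or> Q e)" by (intro cf_intros)
  then show ?thesis by (simp only: imp_conv_disj)
qed

lemma decidable_less [cf_intros]: "cf f \<Longrightarrow> cf g \<Longrightarrow> decidable (\<lambda>e. f e < g e)"
proof -
  assume "cf f" "cf g"
  then have "decidable (\<lambda>e. Suc (f e) \<le> g e)" by (intro cf_intros)
  then show ?thesis by (simp add: Suc_le_eq)
qed

lemma decidable_eq [cf_intros]: "cf f \<Longrightarrow> cf g \<Longrightarrow> decidable (\<lambda>e. f e = g e)"
proof -
  assume "cf f" "cf g"
  then have "decidable (\<lambda>e. f e \<le> g e \<and> g e \<le> f e)" by (intro cf_intros)
  then show ?thesis by (simp add: eq_iff)
qed

lemma decidable_all [cf_intros]: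
  assumes "cf g" "decidable (\<lambda>n. P (pfst n) (psnd n))"
  shows "decidable (\<lambda>e. \<forall>i<g e. P e i)"
proof -
  have "cf (\<lambda>e. \<Prod>i<g e. of_bool (P e i))"
    by (intro assms cf_intros)
  moreover have "(\<Prod>i<m. of_bool (Q i)) = (of_bool (\<forall>i<m. Q i) :: nat)" for m :: nat and Q
    by (induction m) (auto simp: less_Suc_eq)
  ultimately show ?thesis unfolding decidable_def by simp
qed

lemma decidable_ex [cf_intros]:
  assumes "cf g" "decidable (\<lambda>n. P (pfst n) (psnd n))"
  shows "decidable (\<lambda>e. \<exists>i<g e. P e i)"
proof -
  have "decidable (\<lambda>e. \<not> (\<forall>i<g e. \<not> P e i))"
    by (intro assms cf_intros)
  then show ?thesis by simp
qed

lemma cf_if [cf_intros]: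
  assumes "decidable P" "cf f" "cf g"
  shows "cf (\<lambda>e. if P e then f e else g e)"
proof -
  have "cf (\<lambda>e. of_bool (P e) * f e + (1 - of_bool (P e)) * g e)"
    by (intro assms cf_intros)
  also have "(\<lambda>e. of_bool (P e) * f e + (1 - of_bool (P e)) * g e) =
      (\<lambda>e. if P e then f e else g e)"
    by auto
  finally show ?thesis .
qed

text \<open>The quotient counts the \<open>i < x\<close> with \<open>Suc i * y \<le> x\<close>;
  division by zero has value 0 and is treated apart.\<close>

lemma cf_div [cf_intros]: "cf f \<Longrightarrow> cf g \<Longrightarrow> cf (\<lambda>e. f e div g e)"
proof -
  assume a: "cf f" "cf g"
  have "x div y = (if y = 0 then 0 else \<Sum>i<x. of_bool (Suc i * y \<le> x))" for x y :: nat
  proof (cases "y = 0")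
    case False
    have "(\<Sum>i<x. of_bool (Suc i * y \<le> x)) = card {i. i < x \<and> Suc i * y \<le> x}"
      by (subst sum_of_bool_eq) (auto intro!: arg_cong[where f = card])
    also have "{i. i < x \<and> Suc i * y \<le> x} = {..<x div y}"
    proof -
      have y: "0 < y" using False by simp
      have "i < x \<and> Suc i * y \<le> x \<longleftrightarrow> i < x div y" for i
        unfolding less_eq_div_iff_mult_less_eq[of y "Suc i" x, OF y, symmetric]
        using div_le_dividend[of x y] by linarith
      then show ?thesis by auto
    qed
    finally show ?thesis using False by simp
  qed simp
  moreover have "cf (\<lambda>e. if g e = 0 then 0 else \<Sum>i<f e. of_bool (Suc i * g e \<le> f e))"
    by (intro a cf_intros cf_comp[OF a(1)] cf_comp[OF a(2)])
  ultimately show ?thesis by simp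
qed

lemma cf_mod [cf_intros]: "cf f \<Longrightarrow> cf g \<Longrightarrow> cf (\<lambda>e. f e mod g e)"
  unfolding modulo_nat_def by (intro cf_intros)

lemma cf_card [cf_intros]:
  assumes "cf g" "decidable (\<lambda>n. P (pfst n) (psnd n))"
  shows "cf (\<lambda>e. card {i. i < g e \<and> P e i})"
proof -
  have "cf (\<lambda>e. \<Sum>i<g e. of_bool (P e i))" by (intro assms cf_intros)
  moreover have "(\<Sum>i<m. of_bool (Q i)) = card {i. i < m \<and> Q i}" for m :: nat and Q
    by (subst sum_of_bool_eq) (auto intro!: arg_cong[where f = card])
  ultimately show ?thesis by simp
qed

text \<open>A fixed finite number of cases is joined one at a time by induction on \<open>M\<close>,
  so no uniformity of \<open>f i\<close> in \<open>i\<close> is involved.\<close>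

lemma cf_choose:
  fixes f :: "nat \<Rightarrow> nat \<Rightarrow> nat"
  assumes "\<And>i. i < M \<Longrightarrow> cf (f i)" "cf s" "cf g"
  shows "cf (\<lambda>e. if s e < M then f (s e) (g e) else 0)"
  using assms(1)
proof (induction M)
  case (Suc M)
  have "cf (\<lambda>e. if s e < M then f (s e) (g e) else 0)"
    by (rule Suc.IH) (simp add: Suc.prems)
  then have "cf (\<lambda>e. if s e = M then f M (g e) else if s e < M then f (s e) (g e) else 0)"
    by (rule cf_if[OF decidable_eq[OF assms(2) cf_const] cf_comp[OF Suc.prems[OF lessI] assms(3)]])
  then show ?case by (rule back_subst[of cf]) (auto simp: less_Suc_eq)
qed (simp add: cf_const)

text \<open>Unbounded search for a witness: the searched function is total, so its minimization is
  defined exactly where a witness exists.\<close>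

lemma comp_enumerable_Ex:
  assumes "decidable (\<lambda>n. P (pfst n) (psnd n))"
  shows "comp_enumerable {} {m. \<exists>s. P m s}"
proof -
  define f where "f n = (of_bool (\<not> P (pfst n) (psnd n)) :: nat)" for n
  have "cf f" unfolding f_def by (intro cf_intros assms)
  then have "partial_recursive {} (minimize (\<lambda>n. Some (f n)))"
    unfolding computable_def by (rule partial_recursive.mu)
  moreover have "dom (minimize (\<lambda>n. Some (f n))) = {m. \<exists>s. P m s}"
  proof (intro set_eqI)
    fix m
    have "m \<in> dom (minimize (\<lambda>n. Some (f n))) \<longleftrightarrow> (\<exists>s. f (enc m s) = 0)"
      by (simp add: minimize_def domIff)
    then show "m \<in> dom (minimize (\<lambda>n. Some (f n))) \<longleftrightarrow> m \<in> {m. \<exists>s. P m s}"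
      by (simp add: f_def)
  qed
  ultimately show ?thesis unfolding comp_enumerable_def by metis
qed


section \<open>Ternary codes of finite prefixes\<close>

definition nat_trit :: "nat \<Rightarrow> trit" where
  "nat_trit n = (if n = 0 then T0 else if n = 1 then T1 else T2)"

definition dig :: "nat \<Rightarrow> nat \<Rightarrow> nat" where
  "dig u i = u div 3 ^ i mod 3"

definition fld :: "nat \<Rightarrow> nat \<Rightarrow> trit" where
  "fld u i = nat_trit (dig u i)"

text \<open>The least significant digit comes first, so that shortening a prefix is a remainder
  modulo a power of 3, and the prefixes of length \<open>N\<close> are exactly the numbers below
  \<open>3 ^ N\<close>.\<close>

definition pre :: "nat \<Rightarrow> (nat \<Rightarrow> trit) \<Rightarrow> nat" where
  "pre N x = (\<Sum>i<N. trit_nat (x i) * 3 ^ i)"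

lemma trit_nat_less [simp]: "trit_nat t < 3"
  by (cases t) auto

lemma nat_trit_trit_nat [simp]: "nat_trit (trit_nat t) = t"
  by (cases t) (auto simp: nat_trit_def)

lemma trit_nat_nat_trit: "n < 3 \<Longrightarrow> trit_nat (nat_trit n) = n"
  by (auto simp: nat_trit_def)

lemma dig_less [simp]: "dig u i < 3"
  by (simp add: dig_def)

lemma trit_nat_fld [simp]: "trit_nat (fld u i) = dig u i"
  by (simp add: fld_def trit_nat_nat_trit)

lemma trit_nat_eq_iff [simp]: "trit_nat s = trit_nat t \<longleftrightarrow> s = t"
  by (cases s; cases t) auto

lemma pre_0 [simp]: "pre 0 x = 0"
  by (simp add: pre_def)

lemma pre_Suc: "pre (Suc N) x = pre N x + trit_nat (x N) * 3 ^ N"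
  by (simp add: pre_def)

lemma pre_less: "pre N x < 3 ^ N"
proof (induction N)
  case (Suc N)
  have "trit_nat (x N) \<le> 2" by (cases "x N") auto
  then have "trit_nat (x N) * 3 ^ N \<le> 2 * 3 ^ N" by (rule mult_le_mono1)
  then show ?case using Suc unfolding pre_Suc power_Suc by linarith
qed simp

lemma pre_mod: "k \<le> N \<Longrightarrow> pre N x mod 3 ^ k = pre k x"
proof (induction N rule: dec_induct)
  case base
  then show ?case by (simp add: pre_less)
next
  case (step N)
  have "3 ^ k dvd trit_nat (x N) * 3 ^ N"
    using step.hyps by (intro dvd_mult le_imp_power_dvd) simp
  then show ?case using step.IH
    by (metis (no_types, lifting) dvd_eq_mod_eq_0 mod_add_right_eq add.right_neutral pre_Suc)
qed

lemma dig_pre: "i < N \<Longrightarrow> dig (pre N x) i = trit_nat (x i)"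
proof -
  assume "i < N"
  have "pre N x div 3 ^ i mod 3 = pre N x mod (3 ^ i * 3) div 3 ^ i"
    by (simp add: mod_mult2_eq)
  also have "pre N x mod (3 ^ i * 3) = pre (Suc i) x"
    using pre_mod[of "Suc i" N x] \<open>i < N\<close> by (simp add: mult.commute)
  also have "\<dots> div 3 ^ i = trit_nat (x i)"
    using pre_less[of i x] by (simp add: pre_Suc)
  finally show ?thesis by (simp add: dig_def)
qed

lemma fld_pre: "i < N \<Longrightarrow> fld (pre N x) i = x i"
  by (simp add: fld_def dig_pre)

lemma pre_cong: "(\<And>i. i < N \<Longrightarrow> x i = y i) \<Longrightarrow> pre N x = pre N y"
  by (simp add: pre_def)

lemma pre_eq_iff: "pre N x = pre N y \<longleftrightarrow> (\<forall>i<N. x i = y i)"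
  using pre_cong[of N x y] fld_pre[of _ N x] fld_pre[of _ N y] by metis

lemma pre_fld_mod: "pre N (fld u) = u mod 3 ^ N"
proof (induction N)
  case (Suc N)
  have "u mod 3 ^ Suc N = u mod 3 ^ N + 3 ^ N * (u div 3 ^ N mod 3)"
    using mod_mult2_eq[of u "3 ^ N" 3] by (simp add: mult.commute)
  then show ?case using Suc by (simp add: pre_Suc dig_def)
qed simp

lemma pre_fld: "u < 3 ^ N \<Longrightarrow> pre N (fld u) = u"
  by (simp add: pre_fld_mod)

lemma pre_eq_iff': "u < 3 ^ N \<Longrightarrow> pre N x = u \<longleftrightarrow> (\<forall>i<N. x i = fld u i)"
  by (metis pre_eq_iff pre_fld)

definition strg :: "nat \<Rightarrow> nat \<Rightarrow> trit list" where
  "strg N u = map (fld u) [0..<N]"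

text \<open>Translates ternary codes into the list codes used by tests. \<open>list_encode\<close>
  builds a list from its end, so the digits are read from the last to the first.\<close>

definition conv :: "nat \<Rightarrow> nat \<Rightarrow> nat" where
  "conv N u = rec_nat 0 (\<lambda>j w. Suc (enc (dig u (N - Suc j)) w)) N"

lemma strg_pre: "strg N (pre N x) = map x [0..<N]"
  by (simp add: strg_def fld_pre)

lemma mem_cylinder_strg: "u < 3 ^ N \<Longrightarrow> x \<in> cylinder (strg N u) \<longleftrightarrow> pre N x = u"
  by (auto simp: cylinder_iff strg_def pre_eq_iff')

lemma conv_eq: "conv N u = str_code (strg N u)"
proof -
  have "rec_nat 0 (\<lambda>j w. Suc (enc (dig u (N - Suc j)) w)) M =
      str_code (map (fld u) [N - M..<N])" if "M \<le> N" for M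
    using that
  proof (induction M)
    case (Suc M)
    then have "[N - Suc M..<N] = (N - Suc M) # [N - M..<N]"
      by (simp add: upt_conv_Cons Suc_diff_Suc)
    then show ?case using Suc by (simp add: str_code_def)
  qed (simp add: str_code_def)
  from this[of N] show ?thesis by (simp add: conv_def strg_def)
qed

lemma str_code_inj: "str_code \<sigma> = str_code \<tau> \<Longrightarrow> \<sigma> = \<tau>"
proof -
  have "inj trit_nat" by (rule injI) simp
  then show "str_code \<sigma> = str_code \<tau> \<Longrightarrow> \<sigma> = \<tau>"
    by (auto simp: str_code_def dest!: injD[OF inj_list_encode] simp: inj_map_eq_map)
qed

lemma cf_dig [cf_intros]: "cf f \<Longrightarrow> cf g \<Longrightarrow> cf (\<lambda>e. dig (f e) (g e))"
  unfolding dig_def by (intro cf_intros)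

lemma cf_conv [cf_intros]: "cf f \<Longrightarrow> cf g \<Longrightarrow> cf (\<lambda>e. conv (f e) (g e))"
proof -
  have "cf (\<lambda>n. conv (pfst n) (psnd n))"
    unfolding conv_def by (intro cf_intros)
  then show "cf f \<Longrightarrow> cf g \<Longrightarrow> cf (\<lambda>e. conv (f e) (g e))" by (rule cf_app1)
qed


section \<open>Simulating an oracle computation on finite prefixes of the oracle\<close>

text \<open>
  \<open>run E y k n\<close> is the outcome after \<open>k\<close> steps: \<open>0\<close> stands for no result so far, \<open>Suc v\<close>
  for the result \<open>v\<close>.
\<close>

definition run :: "(nat \<Rightarrow> nat) \<Rightarrow> (nat \<Rightarrow> trit) \<Rightarrow> nat \<Rightarrow> nat \<Rightarrow> nat" where
  "run E y k n = E (enc (enc (pre k y) k) n)"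

text \<open>No monotonicity in \<open>k\<close> is demanded: every result must be correct, and a
  defined value must be found at all large stages. The eventual form lets finitely many
  subcomputations be combined at one stage.\<close>

definition simulates :: "(nat \<Rightarrow> trit) \<Rightarrow> (nat \<Rightarrow> nat) \<Rightarrow> (nat \<rightharpoonup> nat) \<Rightarrow> bool" where
  "simulates y E f \<longleftrightarrow>
     (\<forall>k n. run E y k n \<noteq> 0 \<longrightarrow> f n = Some (run E y k n - 1)) \<and>
     (\<forall>n. f n \<noteq> None \<longrightarrow> (\<forall>\<^sub>F k in sequentially. run E y k n \<noteq> 0))"

lemma simulatesI:
  assumes "\<And>k n. run E y k n \<noteq> 0 \<Longrightarrow> f n = Some (run E y k n - 1)"
    and "\<And>n v. f n = Some v \<Longrightarrow> \<forall>\<^sub>F k in sequentially. run E y k n \<noteq> 0"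
  shows "simulates y E f"
  using assms unfolding simulates_def by auto

lemma simulatesD:
  assumes "simulates y E f"
  shows "run E y k n \<noteq> 0 \<Longrightarrow> f n = Some (run E y k n - 1)"
    and "f n = Some v \<Longrightarrow> \<forall>\<^sub>F k in sequentially. run E y k n = Suc v"
proof -
  show *: "run E y k n \<noteq> 0 \<Longrightarrow> f n = Some (run E y k n - 1)" for k
    using assms unfolding simulates_def by auto
  assume v: "f n = Some v"
  then have "\<forall>\<^sub>F k in sequentially. run E y k n \<noteq> 0"
    using assms unfolding simulates_def by auto
  then show "\<forall>\<^sub>F k in sequentially. run E y k n = Suc v"
    by (rule eventually_mono) (use * v in force)
qed

text \<open>Induction on the recursion depth \<open>m\<close>, with one common stage
  \<open>k\<close> for all calls; success at \<open>Suc m\<close> combines the eventual success at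
  \<open>m\<close> with that of one further call of \<open>g\<close>.\<close>

lemma simulates_rec:
  fixes a :: nat
  assumes f: "simulates y Ef f" and g: "simulates y Eg g"
  defines "E \<equiv> (\<lambda>k. rec_nat (run Ef y k a)
      (\<lambda>j w. if w = 0 then 0 else run Eg y k (enc a (enc j (w - 1)))))"
    and "F \<equiv> rec_nat (f a) (\<lambda>k v. Option.bind v (\<lambda>w. g (enc a (enc k w))))"
  shows "(\<forall>k. E k m \<noteq> 0 \<longrightarrow> F m = Some (E k m - 1)) \<and>
         (F m \<noteq> None \<longrightarrow> (\<forall>\<^sub>F k in sequentially. E k m \<noteq> 0))"
proof (induction m)
  case 0
  then show ?case using f unfolding simulates_def E_def F_def by simp
next
  case (Suc m)
  have "F (Suc m) = Some (E k (Suc m) - 1)" if "E k (Suc m) \<noteq> 0" for k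
  proof -
    have "E k m \<noteq> 0" using that by (auto simp: E_def split: if_splits)
    moreover from this that have "run Eg y k (enc a (enc m (E k m - 1))) \<noteq> 0"
      by (auto simp: E_def)
    ultimately show ?thesis
      using simulatesD(1)[OF g] Suc by (auto simp: E_def F_def)
  qed
  moreover have "\<forall>\<^sub>F k in sequentially. E k (Suc m) \<noteq> 0" if "F (Suc m) \<noteq> None"
  proof -
    from that obtain w v where w: "F m = Some w" "g (enc a (enc m w)) = Some v"
      by (auto simp: F_def bind_eq_Some_conv)
    then have "\<forall>\<^sub>F k in sequentially. E k m \<noteq> 0" using Suc by auto
    moreover note simulatesD(2)[OF g w(2)]
    ultimately show ?thesis
    proof eventually_elim
      case (elim k)
      then have "E k m = Suc w" using Suc w(1) by force
      with elim show ?case by (simp add: E_def)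
    qed
  qed
  ultimately show ?case by blast
qed

text \<open>Outcome 1 stands for the value 0 and a larger outcome for a nonzero value. The condition
  thus singles out the least zero preceded by defined nonzero values, and at most one summand is
  nonzero.\<close>

lemma simulates_mu:
  assumes f: "simulates y Ef f"
    and E: "\<And>k a. run E y k a = (\<Sum>j<k. if run Ef y k (enc a j) = 1 \<and>
        (\<forall>i<j. 1 < run Ef y k (enc a i)) then Suc j else 0)"
  shows "simulates y E (minimize f)"
proof (rule simulatesI)
  fix k a assume "run E y k a \<noteq> 0"
  then obtain j where j: "j < k" "run Ef y k (enc a j) = 1" "\<forall>i<j. 1 < run Ef y k (enc a i)"
    unfolding E by (elim sum.not_neutral_contains_not_neutral) (auto split: if_splits)
  have fj: "f (enc a j) = Some 0" using simulatesD(1)[OF f, of k "enc a j"] j by simp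
  have fi: "\<exists>v. f (enc a i) = Some (Suc v)" if "i < j" for i
    using simulatesD(1)[OF f, of k "enc a i"] j(3) that by (intro exI[of _ "run Ef y k (enc a i) - 2"]) force
  have "(LEAST n. f (enc a n) = Some 0) = j"
    using fj by (intro Least_equality) (auto simp: not_less[symmetric] dest: fi)
  moreover have "\<exists>n. f (enc a n) = Some 0 \<and> (\<forall>m<n. f (enc a m) \<noteq> None)"
    using fj fi by (intro exI[of _ j]) fastforce
  moreover have "run E y k a = Suc j"
  proof -
    have "run E y k a = (\<Sum>j'<k. if j' = j then Suc j else 0)"
      unfolding E
    proof (intro sum.cong refl)
      fix j'
      have "j' = j" if "run Ef y k (enc a j') = 1" "\<forall>i<j'. 1 < run Ef y k (enc a i)"
        using j that by (metis less_irrefl linorder_neqE_nat)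
      then have "run Ef y k (enc a j') = 1 \<and> (\<forall>i<j'. 1 < run Ef y k (enc a i)) \<longleftrightarrow> j' = j"
        using j(2,3) by blast
      then show "(if run Ef y k (enc a j') = 1 \<and> (\<forall>i<j'. 1 < run Ef y k (enc a i)) then Suc j' else 0)
          = (if j' = j then Suc j else 0)"
        by (simp only: refl if_True if_False split: if_split) blast
    qed
    then show ?thesis using j(1) by simp
  qed
  ultimately show "minimize f a = Some (run E y k a - 1)" by (simp add: minimize_def)
next
  fix a v assume "minimize f a = Some v"
  then obtain n where n: "f (enc a n) = Some 0" "\<forall>m<n. f (enc a m) \<noteq> None"
    by (auto simp: minimize_def split: if_splits)
  define j where "j = (LEAST n. f (enc a n) = Some 0)"
  have fj: "f (enc a j) = Some 0" unfolding j_def using n(1) by (rule LeastI)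
  have "j \<le> n" unfolding j_def using n(1) by (rule Least_le)
  then have fi: "\<exists>v. f (enc a i) = Some (Suc v)" if "i < j" for i
    using n(2) not_less_Least[of i "\<lambda>n. f (enc a n) = Some 0"] that unfolding j_def[symmetric]
    by (metis less_le_trans not_None_eq not0_implies_Suc)
  have "\<forall>\<^sub>F k in sequentially. \<forall>i\<in>{..<j}. 1 < run Ef y k (enc a i)"
  proof (intro eventually_ball_finite ballI)
    fix i assume "i \<in> {..<j}"
    with fi obtain v where "f (enc a i) = Some (Suc v)" by auto
    from simulatesD(2)[OF f this] show "\<forall>\<^sub>F k in sequentially. 1 < run Ef y k (enc a i)"
      by eventually_elim simp
  qed simp
  moreover note simulatesD(2)[OF f fj] eventually_gt_at_top[of j]
  ultimately show "\<forall>\<^sub>F k in sequentially. run E y k a \<noteq> 0"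
  proof eventually_elim
    case (elim k)
    then show ?case unfolding E by (subst sum_eq_0_iff) (auto intro!: bexI[of _ j])
  qed
qed

lemma ex_simulation:
  assumes "partial_recursive {seq_oracle y} f"
  shows "\<exists>E. cf E \<and> simulates y E f"
  using assms
proof (induction rule: partial_recursive.induct)
  case zero
  have c: "cf (\<lambda>n. 1)" by (intro cf_intros)
  show ?case by (rule exI, rule conjI, rule c) (auto intro!: simulatesI simp: run_def)
next
  case succ
  have c: "cf (\<lambda>n. Suc (Suc (psnd n)))" by (intro cf_intros)
  show ?case by (rule exI, rule conjI, rule c) (auto intro!: simulatesI simp: run_def)
next
  case left
  have c: "cf (\<lambda>n. Suc (pfst (psnd n)))" by (intro cf_intros)
  show ?case by (rule exI, rule conjI, rule c) (auto intro!: simulatesI simp: run_def)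
next
  case right
  have c: "cf (\<lambda>n. Suc (psnd (psnd n)))" by (intro cf_intros)
  show ?case by (rule exI, rule conjI, rule c) (auto intro!: simulatesI simp: run_def)
next
  case (oracle_call z)
  then have z: "z = seq_oracle y" by simp
  \<comment> \<open>A query beyond the available prefix has no result yet; it is answered once
    \<open>k\<close> exceeds the queried position.\<close>
  define E where "E n = (if psnd n < psnd (pfst n) then Suc (dig (pfst (pfst n)) (psnd n)) else 0)" for n
  have run: "run E y k n = (if n < k then Suc (trit_nat (y n)) else 0)" for k n
    by (simp add: E_def run_def dig_pre)
  have "cf E" unfolding E_def by (intro cf_intros)
  moreover have "simulates y E (\<lambda>n. Some (z n))"
  proof (rule simulatesI)
    fix n
    show "\<forall>\<^sub>F k in sequentially. run E y k n \<noteq> 0"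
      using eventually_gt_at_top[of n] by eventually_elim (simp add: run)
  qed (auto simp: z seq_oracle_def run split: if_splits)
  ultimately show ?case by blast
next
  case (pair f g)
  then obtain Ef Eg where f: "cf Ef" "simulates y Ef f" and g: "cf Eg" "simulates y Eg g"
    by blast
  define E where "E n = (if Ef n = 0 \<or> Eg n = 0 then 0 else Suc (enc (Ef n - 1) (Eg n - 1)))" for n
  have run: "run E y k n = (if run Ef y k n = 0 \<or> run Eg y k n = 0 then 0
      else Suc (enc (run Ef y k n - 1) (run Eg y k n - 1)))" for k n
    by (simp add: E_def run_def)
  have "cf E" unfolding E_def by (intro cf_intros f(1) g(1))
  moreover have "simulates y E (\<lambda>n. Option.bind (f n) (\<lambda>a. Option.bind (g n) (\<lambda>b. Some (enc a b))))"
  proof (rule simulatesI)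
    fix n v
    assume "Option.bind (f n) (\<lambda>a. Option.bind (g n) (\<lambda>b. Some (enc a b))) = Some v"
    then obtain a b where "f n = Some a" "g n = Some b" by (auto simp: bind_eq_Some_conv)
    from simulatesD(2)[OF f(2) this(1)] simulatesD(2)[OF g(2) this(2)]
    show "\<forall>\<^sub>F k in sequentially. run E y k n \<noteq> 0"
      by eventually_elim (simp add: run)
  qed (use simulatesD(1)[OF f(2)] simulatesD(1)[OF g(2)] in \<open>auto simp: run split: if_splits\<close>)
  ultimately show ?case by blast
next
  case (comp f g)
  then obtain Ef Eg where f: "cf Ef" "simulates y Ef f" and g: "cf Eg" "simulates y Eg g"
    by blast
  define E where "E n = (if Eg n = 0 then 0 else Ef (enc (pfst n) (Eg n - 1)))" for n
  have run: "run E y k n = (if run Eg y k n = 0 then 0 else run Ef y k (run Eg y k n - 1))" for k n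
    by (simp add: E_def run_def)
  have "cf E" unfolding E_def by (intro cf_intros cf_comp[OF f(1)] g(1))
  moreover have "simulates y E (\<lambda>n. Option.bind (g n) f)"
  proof (rule simulatesI)
    fix n v
    assume "Option.bind (g n) f = Some v"
    then obtain a where "g n = Some a" "f a = Some v" by (auto simp: bind_eq_Some_conv)
    from simulatesD(2)[OF g(2) this(1)] simulatesD(2)[OF f(2) this(2)]
    show "\<forall>\<^sub>F k in sequentially. run E y k n \<noteq> 0"
      by eventually_elim (simp add: run)
  qed (use simulatesD(1)[OF f(2)] simulatesD(1)[OF g(2)] in \<open>auto simp: run split: if_splits\<close>)
  ultimately show ?case by blast
next
  case (prim_rec f g)
  then obtain Ef Eg where f: "cf Ef" "simulates y Ef f" and g: "cf Eg" "simulates y Eg g"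
    by blast
  define E where "E n = rec_nat (Ef (enc (pfst n) (pfst (psnd n))))
      (\<lambda>j w. if w = 0 then 0 else Eg (enc (pfst n) (enc (pfst (psnd n)) (enc j (w - 1)))))
      (psnd (psnd n))" for n
  have run: "run E y k n = rec_nat (run Ef y k (pfst n))
      (\<lambda>j w. if w = 0 then 0 else run Eg y k (enc (pfst n) (enc j (w - 1)))) (psnd n)" for k n
    by (simp add: E_def run_def cong: if_cong)
  have "cf E" unfolding E_def by (intro cf_intros cf_comp[OF f(1)] cf_comp[OF g(1)])
  moreover have "simulates y E (\<lambda>n. case prod_decode n of (a, m) \<Rightarrow>
         rec_nat (f a) (\<lambda>k v. Option.bind v (\<lambda>w. g (enc a (enc k w)))) m)"
    unfolding simulates_def run case_prod_beta using simulates_rec[OF f(2) g(2)] by blast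
  ultimately show ?case by blast
next
  case (mu f)
  then obtain Ef where f: "cf Ef" "simulates y Ef f" by blast
  define E where "E n = (\<Sum>j<psnd (pfst n). if Ef (enc (pfst n) (enc (psnd n) j)) = 1 \<and>
      (\<forall>i<j. 1 < Ef (enc (pfst n) (enc (psnd n) i))) then Suc j else 0)" for n
  have "cf E" unfolding E_def by (intro cf_intros cf_comp[OF f(1)])
  moreover have "simulates y E (minimize f)"
    by (rule simulates_mu[OF f(2)]) (simp add: E_def run_def)
  ultimately show ?case by blast
qed


section \<open>Countability of the computable functions\<close>

text \<open>There is no oracle instruction: relativized tests are represented by their computable
  simulators \<open>E\<close>, and countability of these leaves only countably many null sets to
  avoid.\<close>

datatype prog = PZero | PSucc | PLeft | PRight | PPair prog prog | PComp prog prog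
  | PRec prog prog | PMu prog

instance prog :: countable
  by countable_datatype

primrec sem :: "prog \<Rightarrow> nat \<rightharpoonup> nat" where
  "sem PZero = (\<lambda>_. Some 0)"
| "sem PSucc = (\<lambda>n. Some (Suc n))"
| "sem PLeft = (\<lambda>n. Some (pfst n))"
| "sem PRight = (\<lambda>n. Some (psnd n))"
| "sem (PPair a b) = (\<lambda>n. Option.bind (sem a n) (\<lambda>u. Option.bind (sem b n) (\<lambda>v. Some (enc u v))))"
| "sem (PComp a b) = (\<lambda>n. Option.bind (sem b n) (sem a))"
| "sem (PRec a b) = (\<lambda>n. case prod_decode n of (u, m) \<Rightarrow>
     rec_nat (sem a u) (\<lambda>k v. Option.bind v (\<lambda>w. sem b (enc u (enc k w)))) m)"
| "sem (PMu a) = minimize (sem a)"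

lemma countable_computable: "countable {f. cf f}"
proof -
  have "f \<in> range sem" if "partial_recursive {} f" for f
    using that
  proof (induction rule: partial_recursive.induct)
    case zero then show ?case by (rule image_eqI[of _ _ PZero]) auto
  next
    case succ then show ?case by (rule image_eqI[of _ _ PSucc]) auto
  next
    case left then show ?case by (rule image_eqI[of _ _ PLeft]) auto
  next
    case right then show ?case by (rule image_eqI[of _ _ PRight]) auto
  next
    case (pair f g)
    then obtain a b where "f = sem a" "g = sem b" by auto
    then show ?case by (intro image_eqI[of _ _ "PPair a b"]) auto
  next
    case (comp f g)
    then obtain a b where "f = sem a" "g = sem b" by auto
    then show ?case by (intro image_eqI[of _ _ "PComp a b"]) auto
  next
    case (prim_rec f g)
    then obtain a b where "f = sem a" "g = sem b" by auto
    then show ?case by (intro image_eqI[of _ _ "PRec a b"]) auto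
  next
    case (mu f)
    then obtain a where "f = sem a" by auto
    then show ?case by (intro image_eqI[of _ _ "PMu a"]) auto
  qed simp
  then have "(\<lambda>f n. Some (f n)) ` {f :: nat \<Rightarrow> nat. cf f} \<subseteq> range sem"
    unfolding computable_def by auto
  moreover have "countable (range sem)" by simp
  ultimately have "countable ((\<lambda>f n. Some (f n)) ` {f :: nat \<Rightarrow> nat. cf f})"
    by (rule countable_subset)
  moreover have "inj_on (\<lambda>f n. Some (f n)) {f :: nat \<Rightarrow> nat. cf f}"
    by (auto simp: inj_on_def fun_eq_iff)
  ultimately show ?thesis by (rule countable_image_inj_on)
qed


section \<open>Computable non-negative reals\<close>

text \<open>Arbitrary constants in the error bound keep the closure properties short.\<close>

definition cr :: "real \<Rightarrow> bool" where
  "cr w \<longleftrightarrow> 0 \<le> w \<and> (\<exists>f C. cf f \<and> (\<forall>k. \<bar>w - real (f k) / 2 ^ k\<bar> \<le> C / 2 ^ k))"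

lemma crI: "0 \<le> w \<Longrightarrow> cf f \<Longrightarrow> (\<And>k. \<bar>w - real (f k) / 2 ^ k\<bar> \<le> C / 2 ^ k) \<Longrightarrow> cr w"
  unfolding cr_def by (intro conjI exI[of _ f] exI[of _ C] allI)

lemma cr_nonneg: "cr w \<Longrightarrow> 0 \<le> w"
  unfolding cr_def by blast

lemma crD:
  assumes "cr w"
  shows "\<exists>f C. cf f \<and> (\<forall>k. \<bar>w - real (f k) / 2 ^ k\<bar> \<le> C / 2 ^ k) \<and> 0 \<le> C"
proof -
  from assms obtain f C where f: "cf f" "\<And>k. \<bar>w - real (f k) / 2 ^ k\<bar> \<le> C / 2 ^ k"
    unfolding cr_def by blast
  moreover have "0 \<le> C" using f(2)[of 0] by simp
  ultimately show ?thesis by blast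
qed

lemma real_div_error: "0 < b \<Longrightarrow> \<bar>real a / real b - real (a div b)\<bar> \<le> 1"
  using floor_divide_of_nat_eq[of a b, where ?'a = real] of_int_floor_le[of "real a / real b"]
    real_of_int_floor_add_one_ge[of "real a / real b"]
  by (simp add: abs_le_iff)

lemma cr_of_nat: "cr (real n)"
proof (rule crI)
  show "cf (\<lambda>k. n * 2 ^ k)" by (intro cf_intros)
  show "\<bar>real n - real (n * 2 ^ k) / 2 ^ k\<bar> \<le> 0 / 2 ^ k" for k by simp
qed simp

lemma cr_0: "cr 0" and cr_1: "cr 1"
  using cr_of_nat[of 0] cr_of_nat[of 1] by auto

lemma cr_add:
  assumes "cr v" "cr w"
  shows "cr (v + w)"
proof -
  obtain f C where f: "cf f" "\<And>k. \<bar>v - real (f k) / 2 ^ k\<bar> \<le> C / 2 ^ k" "0 \<le> C"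
    using crD[OF assms(1)] by blast
  obtain g D where g: "cf g" "\<And>k. \<bar>w - real (g k) / 2 ^ k\<bar> \<le> D / 2 ^ k" "0 \<le> D"
    using crD[OF assms(2)] by blast
  show ?thesis
  proof (rule crI)
    show "cf (\<lambda>k. f k + g k)" by (intro cf_intros f g)
    show "\<bar>v + w - real (f k + g k) / 2 ^ k\<bar> \<le> (C + D) / 2 ^ k" for k
      using f(2)[of k] g(2)[of k] by (simp add: add_divide_distrib)
  qed (use assms cr_nonneg in auto)
qed

lemma cr_diff:
  assumes "cr v" "cr w" "w \<le> v"
  shows "cr (v - w)"
proof -
  obtain f C where f: "cf f" "\<And>k. \<bar>v - real (f k) / 2 ^ k\<bar> \<le> C / 2 ^ k" "0 \<le> C"
    using crD[OF assms(1)] by blast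
  obtain g D where g: "cf g" "\<And>k. \<bar>w - real (g k) / 2 ^ k\<bar> \<le> D / 2 ^ k" "0 \<le> D"
    using crD[OF assms(2)] by blast
  show ?thesis
  proof (rule crI)
    show "cf (\<lambda>k. f k - g k)" by (intro cf_intros f g)
    show "\<bar>v - w - real (f k - g k) / 2 ^ k\<bar> \<le> (C + D) / 2 ^ k" for k
    proof (cases "g k \<le> f k")
      case True
      then show ?thesis
        using f(2)[of k] g(2)[of k] by (simp add: of_nat_diff diff_divide_distrib add_divide_distrib)
    next
      case False
      then have "real (f k) / 2 ^ k \<le> real (g k) / 2 ^ k" by (intro divide_right_mono) auto
      then show ?thesis
        using False f(2)[of k] g(2)[of k] assms(3) by (simp add: add_divide_distrib)
    qed
  qed (use assms in auto)
qed

lemma cr_mult: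
  assumes "cr v" "cr w"
  shows "cr (v * w)"
proof -
  obtain f C where f: "cf f" "\<And>k. \<bar>v - real (f k) / 2 ^ k\<bar> \<le> C / 2 ^ k" "0 \<le> C"
    using crD[OF assms(1)] by blast
  obtain g D where g: "cf g" "\<And>k. \<bar>w - real (g k) / 2 ^ k\<bar> \<le> D / 2 ^ k" "0 \<le> D"
    using crD[OF assms(2)] by blast
  have nn: "0 \<le> v" "0 \<le> w" using assms cr_nonneg by auto
  show ?thesis
  proof (rule crI)
    \<comment> \<open>The product of the numerators has denominator \<open>4 ^ k\<close>; the
      division restores \<open>2 ^ k\<close> at the cost of an error of at most
      \<open>1 / 2 ^ k\<close>.\<close>
    show "cf (\<lambda>k. f k * g k div 2 ^ k)" by (intro cf_intros f g)
    fix k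
    define a b where "a = real (f k) / 2 ^ k" and "b = real (g k) / 2 ^ k"
    have "D / 2 ^ k \<le> D" using g(3) by (simp add: field_simps mult_le_cancel_left1)
    then have "\<bar>b\<bar> \<le> w + D" using g(2)[of k] nn unfolding b_def by linarith
    have "\<bar>v * w - a * b\<bar> = \<bar>v * (w - b) + (v - a) * b\<bar>" by (simp add: algebra_simps)
    also have "\<dots> \<le> v * \<bar>w - b\<bar> + \<bar>v - a\<bar> * \<bar>b\<bar>"
      using abs_triangle_ineq[of "v * (w - b)" "(v - a) * b"] nn by (simp add: abs_mult)
    also have "\<dots> \<le> v * (D / 2 ^ k) + C / 2 ^ k * (w + D)"
      using f(2)[of k] g(2)[of k] nn f(3) \<open>\<bar>b\<bar> \<le> w + D\<close> unfolding a_def b_def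
      by (intro add_mono mult_left_mono mult_mono) auto
    finally have 1: "\<bar>v * w - a * b\<bar> \<le> (v * D + C * (w + D)) / 2 ^ k" by (simp add: field_simps)
    have "\<bar>real (f k * g k) / 2 ^ k - real (f k * g k div 2 ^ k)\<bar> \<le> 1"
      using real_div_error[of "2 ^ k" "f k * g k"] by simp
    then have "\<bar>real (f k * g k) / 2 ^ k - real (f k * g k div 2 ^ k)\<bar> / 2 ^ k \<le> 1 / 2 ^ k"
      by (rule divide_right_mono) simp
    moreover have "\<bar>real (f k * g k) / 2 ^ k - real (f k * g k div 2 ^ k)\<bar> / 2 ^ k =
        \<bar>a * b - real (f k * g k div 2 ^ k) / 2 ^ k\<bar>"
    proof -
      have "a * b - real (f k * g k div 2 ^ k) / 2 ^ k =
          (real (f k * g k) / 2 ^ k - real (f k * g k div 2 ^ k)) / 2 ^ k"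
        by (simp add: a_def b_def diff_divide_distrib)
      then show ?thesis by (simp add: abs_divide)
    qed
    ultimately have "\<bar>a * b - real (f k * g k div 2 ^ k) / 2 ^ k\<bar> \<le> 1 / 2 ^ k" by linarith
    with 1 show "\<bar>v * w - real (f k * g k div 2 ^ k) / 2 ^ k\<bar> \<le> (v * D + C * (w + D) + 1) / 2 ^ k"
      unfolding add_divide_distrib[of _ 1] by linarith
  qed (use nn in auto)
qed

text \<open>For \<open>w = 0\<close> the value is 0 by the convention on division. Otherwise
  \<open>4 ^ k div f k\<close> approximates \<open>2 ^ k / w\<close> as soon as
  \<open>f k / 2 ^ k\<close> is at least \<open>w / 2\<close>, which holds from \<open>k0\<close>
  on.\<close>

lemma cr_inverse:
  assumes "cr w"
  shows "cr (1 / w)"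
proof (cases "w = 0")
  case True
  then show ?thesis by (simp add: cr_0)
next
  case False
  then have w: "0 < w" using cr_nonneg[OF assms] by simp
  obtain f C where f: "cf f" "\<And>k. \<bar>w - real (f k) / 2 ^ k\<bar> \<le> C / 2 ^ k" "0 \<le> C"
    using crD[OF assms] by blast
  obtain k0 where k0: "2 * C / w < 2 ^ k0" using real_arch_pow[of 2] by auto
  define h where "h k = 4 ^ k div f k" for k
  \<comment> \<open>The first two terms cover the stages from \<open>k0\<close> on, the last one the
    finitely many earlier stages.\<close>
  define D where "D = 2 * C / w\<^sup>2 + 1 + (1 / w + 2 ^ k0) * 2 ^ k0"
  show ?thesis
  proof (rule crI)
    show "cf h" unfolding h_def by (intro cf_intros f)
    fix k
    show "\<bar>1 / w - real (h k) / 2 ^ k\<bar> \<le> D / 2 ^ k"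
    proof (cases "k0 \<le> k")
      case True
      define a where "a = real (f k) / 2 ^ k"
      have "(2::real) ^ k0 \<le> 2 ^ k" using True by simp
      then have "2 * C / w < 2 ^ k" using k0 by linarith
      then have "C / 2 ^ k \<le> w / 2" using w by (simp add: field_simps)
      then have a: "w / 2 \<le> a" "\<bar>w - a\<bar> \<le> C / 2 ^ k" using f(2)[of k] unfolding a_def by linarith+
      then have "0 < a" using w by linarith
      then have fk: "0 < f k" by (simp add: a_def zero_less_divide_iff)
      have "\<bar>1 / w - 1 / a\<bar> = \<bar>w - a\<bar> / (w * a)"
        using w \<open>0 < a\<close> by (simp add: abs_divide abs_mult abs_minus_commute diff_frac_eq)
      also have "\<dots> \<le> (C / 2 ^ k) / (w * (w / 2))"
        using a w f(3) by (intro frac_le mult_left_mono) auto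
      finally have 1: "\<bar>1 / w - 1 / a\<bar> \<le> (2 * C / w\<^sup>2) / 2 ^ k"
        by (simp add: power2_eq_square field_simps)
      have "\<bar>real (4 ^ k) / real (f k) - real (h k)\<bar> / 2 ^ k \<le> 1 / 2 ^ k"
        unfolding h_def by (intro divide_right_mono real_div_error fk) simp
      moreover have "(real (4 ^ k) / real (f k) - real (h k)) / 2 ^ k = 1 / a - real (h k) / 2 ^ k"
      proof -
        have "(4::real) ^ k = 2 ^ k * 2 ^ k" by (simp flip: power_mult_distrib)
        then show ?thesis using fk by (simp add: a_def field_simps)
      qed
      ultimately have "\<bar>1 / a - real (h k) / 2 ^ k\<bar> \<le> 1 / 2 ^ k"
        by (metis abs_divide abs_numeral power_abs)
      with 1 have "\<bar>1 / w - real (h k) / 2 ^ k\<bar> \<le> (2 * C / w\<^sup>2 + 1) / 2 ^ k"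
        unfolding add_divide_distrib by linarith
      also have "\<dots> \<le> D / 2 ^ k"
        unfolding D_def using w by (intro divide_right_mono) auto
      finally show ?thesis .
    next
      case False
      have k: "(2::real) ^ k \<le> 2 ^ k0" using False by simp
      have "real (h k) \<le> 4 ^ k"
        unfolding h_def by (metis div_le_dividend of_nat_le_iff of_nat_numeral of_nat_power)
      also have "(4::real) ^ k = 2 ^ k * 2 ^ k" by (simp flip: power_mult_distrib)
      finally have "real (h k) / 2 ^ k \<le> 2 ^ k" by (simp add: field_simps)
      moreover have nn: "0 \<le> 1 / w" "0 \<le> real (h k) / 2 ^ k" using w by auto
      ultimately have "\<bar>1 / w - real (h k) / 2 ^ k\<bar> \<le> 1 / w + 2 ^ k0"
        using k nn by linarith
      also have "\<dots> \<le> (1 / w + 2 ^ k0) * (2 ^ k0 / 2 ^ k)"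
        using w k by (simp add: field_simps mult_left_mono add_mono)
      also have "\<dots> \<le> D / 2 ^ k"
        unfolding D_def times_divide_eq_right using w f(3) by (intro divide_right_mono) auto
      finally show ?thesis .
    qed
  qed (use w in auto)
qed

lemma cr_divide: "cr v \<Longrightarrow> cr w \<Longrightarrow> cr (v / w)"
  using cr_mult[OF _ cr_inverse] by simp

lemma abs_int_decode: "\<bar>int_decode i\<bar> = int ((i + 1) div 2)"
  and int_decode_nonneg: "0 \<le> int_decode i \<longleftrightarrow> even i"
  by (auto simp: int_decode_def sum_decode_def elim!: evenE oddE)

lemma of_rat_nat_to_rat_surj:
  "real_of_rat (nat_to_rat_surj n) = of_int (int_decode (pfst n)) / of_int (int_decode (psnd n))"
  by (cases "int_decode (psnd n) = 0")
    (simp_all add: nat_to_rat_surj_def case_prod_beta of_rat_rat rat_number_collapse)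

lemma even_eq_iff_mod: "even a = even b \<longleftrightarrow> a mod 2 = b mod (2 :: nat)"
  by presburger

lemma cr_computable_real:
  assumes "computable_real a" "0 \<le> a"
  shows "cr a"
proof -
  obtain f where f: "cf f" "\<And>n. \<bar>a - of_rat (nat_to_rat_surj (f n))\<bar> \<le> 1 / 2 ^ n"
    using assms(1) unfolding computable_real_def by blast
  \<comment> \<open>\<open>int_decode\<close> is non-negative exactly on even codes and has absolute
    value \<open>(i + 1) div 2\<close>; equal parity of numerator and denominator thus makes the
    fraction non-negative. Negative approximations are replaced by 0, which is no worse since
    \<open>0 \<le> a\<close>.\<close>
  define g where "g k = (if pfst (f k) mod 2 = psnd (f k) mod 2
    then (pfst (f k) + 1) div 2 * 2 ^ k div ((psnd (f k) + 1) div 2) else 0)" for k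
  show ?thesis
  proof (rule crI)
    show "cf g" unfolding g_def by (intro cf_intros f)
    fix k
    define i j where "i = int_decode (pfst (f k))" and "j = int_decode (psnd (f k))"
    define x where "x = max 0 (of_int i / of_int j :: real)"
    have "\<bar>a - x\<bar> \<le> 1 / 2 ^ k"
      using f(2)[of k] assms(2) unfolding of_rat_nat_to_rat_surj x_def i_def j_def by (simp add: max_def abs_le_iff)
    moreover have "\<bar>x - real (g k) / 2 ^ k\<bar> \<le> 1 / 2 ^ k"
    proof (cases "(0 \<le> i) = (0 \<le> j) \<and> j \<noteq> 0")
      case True
      let ?i = "(pfst (f k) + 1) div 2" and ?j = "(psnd (f k) + 1) div 2"
      have "even (pfst (f k)) = even (psnd (f k))"
        using True unfolding i_def j_def int_decode_nonneg by blast
      then have c: "pfst (f k) mod 2 = psnd (f k) mod 2" unfolding even_eq_iff_mod .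
      have g: "g k = ?i * 2 ^ k div ?j"
        unfolding g_def if_P[OF c] ..
      have j: "0 < ?j" using True abs_int_decode[of "psnd (f k)"] unfolding j_def by linarith
      have "x = \<bar>of_int i\<bar> / \<bar>of_int j\<bar>"
        using True unfolding x_def by (auto simp: max_def zero_le_divide_iff abs_if)
      also have "\<dots> = real ?i / real ?j"
        using abs_int_decode[of "pfst (f k)"] abs_int_decode[of "psnd (f k)"]
        unfolding i_def j_def by (metis of_int_abs of_int_of_nat_eq)
      finally have x: "x - real (g k) / 2 ^ k = (real (?i * 2 ^ k) / real ?j - real (g k)) / 2 ^ k"
        by (simp add: diff_divide_distrib)
      define t where "t = real (?i * 2 ^ k) / real ?j - real (g k)"
      have "\<bar>t\<bar> \<le> 1" unfolding t_def g by (rule real_div_error[OF j])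
      then have "\<bar>t\<bar> / 2 ^ k \<le> 1 / 2 ^ k" by (rule divide_right_mono) simp
      then show ?thesis unfolding x t_def[symmetric] by (simp add: abs_divide)
    next
      case False
      have "x = 0" using False unfolding x_def by (auto simp: max_def zero_le_divide_iff)
      moreover have "g k = 0"
      proof (cases "j = 0")
        case True
        then have "(psnd (f k) + 1) div 2 = 0" using abs_int_decode[of "psnd (f k)"] unfolding j_def by linarith
        then show ?thesis unfolding g_def by (simp only: div_by_0 if_cancel)
      next
        case j: False
        then have "even (pfst (f k)) \<noteq> even (psnd (f k))"
          using False unfolding i_def j_def int_decode_nonneg by blast
        then have c: "pfst (f k) mod 2 \<noteq> psnd (f k) mod 2" unfolding even_eq_iff_mod .
        show ?thesis unfolding g_def if_not_P[OF c] ..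
      qed
      ultimately show ?thesis by simp
    qed
    ultimately show "\<bar>a - real (g k) / 2 ^ k\<bar> \<le> 2 / 2 ^ k" by linarith
  qed (rule assms(2))
qed

text \<open>Shifting down by the error constant, rounded up, turns two-sided approximations into
  lower ones. With lower approximations, strict lower bounds on weights and measures become
  enumerable.\<close>

lemma cr_lower:
  assumes "cr w"
  obtains f where "cf f" "\<And>k. real (f k) / 2 ^ k \<le> w" "(\<lambda>k. real (f k) / 2 ^ k) \<longlonglongrightarrow> w"
proof -
  obtain f C where f: "cf f" "\<And>k. \<bar>w - real (f k) / 2 ^ k\<bar> \<le> C / 2 ^ k" "0 \<le> C"
    using crD[OF assms] by blast
  define c where "c = nat \<lceil>C\<rceil>"
  have c: "C \<le> real c" unfolding c_def by (simp add: real_nat_ceiling_ge)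
  define g where "g k = f k - c" for k
  have up: "real (g k) / 2 ^ k \<le> w" for k
  proof (cases "c \<le> f k")
    case True
    then have "real (g k) / 2 ^ k = real (f k) / 2 ^ k - real c / 2 ^ k"
      by (simp add: g_def of_nat_diff diff_divide_distrib)
    also have "\<dots> \<le> real (f k) / 2 ^ k - C / 2 ^ k"
      using c by (simp add: divide_right_mono)
    finally show ?thesis using f(2)[of k] by linarith
  qed (simp add: g_def cr_nonneg[OF assms])
  have low: "w - (C + c) / 2 ^ k \<le> real (g k) / 2 ^ k" for k
  proof -
    have "real (f k) / 2 ^ k - real c / 2 ^ k \<le> real (g k) / 2 ^ k"
      unfolding g_def diff_divide_distrib[symmetric] by (intro divide_right_mono) auto
    then show ?thesis using f(2)[of k] by (simp add: add_divide_distrib abs_le_iff)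
  qed
  have "(\<lambda>k. w - (C + c) * (1 / 2) ^ k) \<longlonglongrightarrow> w - (C + c) * 0"
    by (intro tendsto_intros LIMSEQ_realpow_zero) auto
  then have lim: "(\<lambda>k. w - (C + c) / 2 ^ k) \<longlonglongrightarrow> w" by (simp add: power_divide)
  have "(\<lambda>k. real (g k) / 2 ^ k) \<longlonglongrightarrow> w"
    by (rule tendsto_sandwich[OF _ _ lim tendsto_const]) (use low up in \<open>auto intro: always_eventually\<close>)
  moreover have "cf g" unfolding g_def by (intro cf_intros f)
  ultimately show ?thesis using that up by blast
qed


section \<open>Trees of labelled nodes\<close>

text \<open>
  A node of the full binary tree is represented by its heap code: the root is \<open>1\<close> and the
  children of \<open>c\<close> are \<open>2 * c\<close> and \<open>2 * c + 1\<close>. The numerical order of heap codes is the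
  length-lexicographic order. A field \<open>A\<close> labels every node, and \<open>tree A\<close> is the tree cut
  out by the labels.
\<close>

definition allows :: "trit \<Rightarrow> bool \<Rightarrow> bool" where
  "allows a b \<longleftrightarrow> (if b then a \<noteq> T0 else a \<noteq> T1)"

definition tree :: "(nat \<Rightarrow> trit) \<Rightarrow> nat \<Rightarrow> bool" where
  "tree A c \<longleftrightarrow> 0 < c \<and>
     (\<forall>j. 0 < c div 2 ^ Suc j \<longrightarrow> allows (A (c div 2 ^ Suc j)) (odd (c div 2 ^ j)))"

text \<open>For a node \<open>c\<close> of the tree this is its position in the length-lexicographic
  enumeration, hence the place in the code where its label stands.\<close>

definition idx :: "(nat \<Rightarrow> trit) \<Rightarrow> nat \<Rightarrow> nat" where
  "idx A c = card {j. j < c \<and> tree A j}"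

lemma ex_allows: "\<exists>b. allows a b"
  by (cases a) (auto simp: allows_def intro: exI[of _ True] exI[of _ False])

lemma allows_eq:
  assumes "\<And>b. allows a b = allows a' b"
  shows "a = a'"
  using assms[of True] assms[of False] by (cases a; cases a') (simp_all add: allows_def)

lemma tree_0 [simp]: "\<not> tree A 0"
  by (simp add: tree_def)

lemma tree_1 [simp]: "tree A (Suc 0)"
proof -
  have "Suc 0 div 2 ^ Suc j = 0" for j
    by (rule div_less) (metis Suc_lessI less_exp not_less_zero zero_less_Suc less_trans)
  then show ?thesis unfolding tree_def by (simp del: power_Suc)
qed

lemma tree_parent:
  assumes "2 \<le> c"
  shows "tree A c \<longleftrightarrow> tree A (c div 2) \<and> allows (A (c div 2)) (odd c)"
proof -
  have div: "c div 2 div 2 ^ j = c div 2 ^ Suc j" for j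
    by (simp add: div_mult2_eq)
  have pos: "0 < c div 2" using assms by simp
  have "(\<forall>j. Q j) \<longleftrightarrow> Q 0 \<and> (\<forall>j. Q (Suc j))" for Q :: "nat \<Rightarrow> bool"
    by (metis not0_implies_Suc)
  from this[of "\<lambda>j. 0 < c div 2 ^ Suc j \<longrightarrow> allows (A (c div 2 ^ Suc j)) (odd (c div 2 ^ j))"]
  show ?thesis
    using pos assms unfolding tree_def div by auto
qed

lemma tree_child:
  assumes "0 < c"
  shows "tree A (2 * c + of_bool b) \<longleftrightarrow> tree A c \<and> allows (A c) b"
  using assms by (subst tree_parent) auto

lemma tree_pos: "tree A c \<Longrightarrow> 0 < c"
  by (simp add: tree_def)

lemma tree_cong:
  assumes "\<And>i. i \<le> c div 2 \<Longrightarrow> A i = B i"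
  shows "tree A c = tree B c"
proof -
  have "c div 2 ^ Suc j \<le> c div 2" for j
    by (rule div_le_mono2) auto
  then show ?thesis using assms unfolding tree_def by simp
qed

lemma tree_cong_less: "(\<And>i. i < N \<Longrightarrow> A i = B i) \<Longrightarrow> c < 2 * N \<Longrightarrow> tree A c = tree B c"
  by (rule tree_cong) auto

lemma idx_Suc: "idx A (Suc c) = idx A c + of_bool (tree A c)"
proof (cases "tree A c")
  case True
  then have "{j. j < Suc c \<and> tree A j} = insert c {j. j < c \<and> tree A j}" by auto
  then show ?thesis using True by (simp add: idx_def)
next
  case False
  then have "{j. j < Suc c \<and> tree A j} = {j. j < c \<and> tree A j}" by (auto simp: less_Suc_eq)
  then show ?thesis using False by (simp add: idx_def)
qed

lemma idx_0 [simp]: "idx A 0 = 0"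
  by (simp add: idx_def)

lemma idx_le: "idx A c \<le> c"
  by (induction c) (auto simp: idx_Suc)

lemma idx_mono: "c \<le> d \<Longrightarrow> idx A c \<le> idx A d"
  unfolding idx_def by (intro card_mono) auto

lemma idx_cong: "(\<And>i. i < N \<Longrightarrow> A i = B i) \<Longrightarrow> c \<le> 2 * N \<Longrightarrow> idx A c = idx B c"
  unfolding idx_def using tree_cong_less[of N A B] by (intro arg_cong[where f = card]) auto

lemma idx_cong_less: "(\<And>i. i < c \<Longrightarrow> A i = B i) \<Longrightarrow> idx A c = idx B c"
  by (rule idx_cong[of c]) auto

lemma decidable_tree [cf_intros]:
  assumes "cf f" "cf g"
  shows "decidable (\<lambda>e. tree (fld (f e)) (g e))"
proof -
  \<comment> \<open>Since \<open>j < 2 ^ Suc j\<close>, the ancestors of \<open>c\<close> are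
    reached with \<open>j < c\<close>; the bounded quantifier makes the tree decidable.\<close>
  have *: "tree (fld u) c \<longleftrightarrow> 0 < c \<and> (\<forall>j<c. 0 < c div 2 ^ Suc j \<longrightarrow>
      (if c div 2 ^ j mod 2 = 1 then dig u (c div 2 ^ Suc j) \<noteq> 0 else dig u (c div 2 ^ Suc j) \<noteq> 1))" for u c
  proof -
    have "j < c" if "0 < c div 2 ^ Suc j" for j
    proof -
      have "j < 2 ^ Suc j" using less_exp[of "Suc j"] by simp
      then show ?thesis using that by (metis div_less gr_implies_not0 linorder_not_less order_less_le_trans)
    qed
    moreover have "fld u i \<noteq> T0 \<longleftrightarrow> dig u i \<noteq> 0" "fld u i \<noteq> T1 \<longleftrightarrow> dig u i \<noteq> 1" for i
      by (auto simp: fld_def nat_trit_def)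
    ultimately show ?thesis
      unfolding tree_def allows_def odd_iff_mod_2_eq_one by auto
  qed
  have "decidable (\<lambda>n. tree (fld (pfst n)) (psnd n))"
  proof -
    have if_eq: "(if P then Q else R) \<longleftrightarrow> (P \<and> Q) \<or> (\<not> P \<and> R)" for P Q R :: bool by simp
    show ?thesis unfolding * if_eq by (intro cf_intros)
  qed
  then have "cf (\<lambda>n. of_bool (tree (fld (pfst n)) (psnd n)))" by (intro cf_intros)
  from cf_app1[OF this assms] show ?thesis unfolding decidable_def .
qed

lemma cf_idx [cf_intros]:
  assumes "cf f" "cf g"
  shows "cf (\<lambda>e. idx (fld (f e)) (g e))"
  unfolding idx_def by (intro assms cf_intros cf_comp[OF assms(1)])


section \<open>Codes of labelled trees\<close>

definition hc :: "bool list \<Rightarrow> nat" where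
  "hc \<sigma> = foldl (\<lambda>n b. 2 * n + of_bool b) 1 \<sigma>"

lemma hc_Nil [simp]: "hc [] = 1"
  by (simp add: hc_def)

lemma hc_snoc [simp]: "hc (\<sigma> @ [b]) = 2 * hc \<sigma> + of_bool b"
  by (simp add: hc_def)

lemma hc_pos: "0 < hc \<sigma>"
  by (induction \<sigma> rule: rev_induct) auto

lemma hc_surj: "0 < c \<Longrightarrow> \<exists>\<sigma>. hc \<sigma> = c"
proof (induction c rule: less_induct)
  case (less c)
  show ?case
  proof (cases "c = 1")
    case True
    then show ?thesis by (intro exI[of _ "[]"]) simp
  next
    case False
    then have "0 < c div 2" "c div 2 < c" using less.prems by auto
    then obtain \<sigma> where "hc \<sigma> = c div 2" using less.IH by blast
    then have "hc (\<sigma> @ [odd c]) = c" by (cases "odd c") auto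
    then show ?thesis ..
  qed
qed

text \<open>Only labels at nodes of the tree are consulted, so many fields share one code.\<close>

definition codes :: "(nat \<Rightarrow> trit) \<Rightarrow> (nat \<Rightarrow> trit) \<Rightarrow> bool" where
  "codes A x \<longleftrightarrow> (\<forall>i. x i = A (hc (placed x i ! i)))"

lemma mem_code_tree:
  assumes "codes A x"
  shows "\<sigma> \<in> code_tree x \<longleftrightarrow> tree A (hc \<sigma>)"
proof (induction \<sigma> rule: rev_induct)
  case (snoc b \<sigma>)
  show ?case
  proof (cases "\<sigma> \<in> code_tree x")
    case True
    then obtain i where i: "\<sigma> = placed x i ! i" using placed_diag_surj by blast
    then have "x i = A (hc \<sigma>)" using assms unfolding codes_def by simp
    then have "\<sigma> @ [b] \<in> code_tree x \<longleftrightarrow> allows (A (hc \<sigma>)) b"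
      using child_mem_iff'[of x i] i by (cases b) (auto simp: allows_def)
    then show ?thesis using snoc True by (simp add: tree_child hc_pos)
  next
    case False
    then show ?thesis using snoc code_tree_butlast by (auto simp: tree_child hc_pos)
  qed
qed (simp add: mem_code_tree_iff)

text \<open>With \<open>c\<close> the heap code of the node being processed, the appended children
  have codes at least \<open>2 * c\<close>. Every node already listed is the root or a child of an
  earlier node, so its code is below \<open>2 * c\<close>.\<close>

lemma sorted_placed: "sorted_wrt (<) (map hc (placed x i))"
proof (induction i)
  case (Suc i)
  let ?l = "placed x i" and ?c = "hc (placed x i ! i)"
  have "hc \<tau> < 2 * ?c" if \<tau>: "\<tau> \<in> set ?l" for \<tau>
  proof (cases "\<tau> = []")
    case True
    then show ?thesis using hc_pos[of "?l ! i"] by simp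
  next
    case False
    then obtain j where j: "j < i" "\<tau> \<in> set (children (x j) (placed x j ! j))"
      using \<tau> by (auto simp: mem_placed_iff)
    have "placed x j ! j = ?l ! j"
      using j length_placed[of j x] length_placed[of i x] by (intro placed_nth) auto
    moreover have "hc (?l ! j) < ?c"
      using sorted_wrt_nth_less[OF Suc \<open>j < i\<close>] length_placed[of i x] j by simp
    moreover obtain b where "\<tau> = placed x j ! j @ [b]" using mem_children[OF j(2)] ..
    ultimately show ?thesis by (cases b) auto
  qed
  moreover have "hc \<tau> = 2 * ?c \<or> hc \<tau> = 2 * ?c + 1" if "\<tau> \<in> set (children (x i) (?l ! i))" for \<tau>
    using mem_children[OF that] by auto
  moreover have "sorted_wrt (<) (map hc (children (x i) (?l ! i)))"
    by (cases "x i") auto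
  ultimately show ?case using Suc by (fastforce simp: sorted_wrt_append)
qed simp

lemma strict_mono_diag: "strict_mono (\<lambda>i. hc (placed x i ! i))"
proof (rule strict_monoI)
  fix i j :: nat assume "i < j"
  have "placed x i ! i = placed x j ! i"
    using \<open>i < j\<close> length_placed[of i x] length_placed[of j x] by (intro placed_nth) auto
  then show "hc (placed x i ! i) < hc (placed x j ! j)"
    using sorted_wrt_nth_less[OF sorted_placed \<open>i < j\<close>, of x j] length_placed[of j x] \<open>i < j\<close> by simp
qed

text \<open>The enumeration of the nodes is strictly increasing in heap codes and exhausts the tree,
  so exactly the first \<open>k\<close> nodes lie below the node at position
  \<open>k\<close>.\<close>

lemma idx_diag:
  assumes "codes A x"
  shows "idx A (hc (placed x k ! k)) = k"
proof -
  have "{j. j < hc (placed x k ! k) \<and> tree A j} = (\<lambda>i. hc (placed x i ! i)) ` {..<k}"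
  proof (intro set_eqI iffI)
    fix c assume "c \<in> {j. j < hc (placed x k ! k) \<and> tree A j}"
    then have c: "c < hc (placed x k ! k)" "tree A c" by auto
    obtain \<sigma> where \<sigma>: "hc \<sigma> = c" using hc_surj tree_pos c(2) by blast
    then obtain i where i: "\<sigma> = placed x i ! i" using c(2) mem_code_tree[OF assms] placed_diag_surj by blast
    then have "i < k" using c(1) \<sigma> strict_mono_less[OF strict_mono_diag] by auto
    then show "c \<in> (\<lambda>i. hc (placed x i ! i)) ` {..<k}" using i \<sigma> by auto
  next
    fix c assume "c \<in> (\<lambda>i. hc (placed x i ! i)) ` {..<k}"
    then show "c \<in> {j. j < hc (placed x k ! k) \<and> tree A j}"
      using strict_mono_less[OF strict_mono_diag] mem_code_tree[OF assms] placed_diag_mem by force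
  qed
  moreover have "inj_on (\<lambda>i. hc (placed x i ! i)) {..<k}"
    by (rule strict_mono_on_imp_inj_on) (use strict_mono_diag in \<open>auto simp: strict_mono_def strict_mono_on_def\<close>)
  ultimately show ?thesis by (simp add: idx_def card_image)
qed

lemma codes_idx:
  assumes "codes A x" "tree A c"
  shows "x (idx A c) = A c"
proof -
  obtain \<sigma> where \<sigma>: "hc \<sigma> = c" using hc_surj tree_pos assms(2) by blast
  then obtain i where i: "\<sigma> = placed x i ! i"
    using assms mem_code_tree[OF assms(1)] placed_diag_surj by blast
  then have "idx A c = i" using idx_diag[OF assms(1), of i] \<sigma> by simp
  then show ?thesis using assms(1) i \<sigma> unfolding codes_def by simp
qed

lemma ex_codes: "\<exists>x. codes A x"
proof -
  define L where "L = rec_nat [[]] (\<lambda>i ps. ps @ children (A (hc (ps ! i))) (ps ! i))"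
  define x where "x i = A (hc (L i ! i))" for i
  have "placed x i = L i" for i
    by (induction i) (simp_all add: L_def x_def)
  then have "codes A x" by (simp add: codes_def x_def)
  then show ?thesis by (intro exI[of _ x])
qed

definition Phi :: "(nat \<Rightarrow> trit) \<Rightarrow> (nat \<Rightarrow> trit)" where
  "Phi A = (SOME x. codes A x)"

lemma codes_Phi: "codes A (Phi A)"
  unfolding Phi_def using ex_codes by (rule someI_ex)

lemma idx_unbounded: "\<exists>N. \<forall>n\<ge>N. k \<le> idx A n"
  using idx_diag[OF codes_Phi, of A k] idx_mono by metis

text \<open>The finite form of \<open>Phi\<close>: each tree node below \<open>N\<close> puts its
  digit at position \<open>idx\<close>, so \<open>N\<close> labels determine as many entries of the
  code as the tree has nodes below \<open>N\<close>.\<close>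

definition phi :: "nat \<Rightarrow> nat \<Rightarrow> nat" where
  "phi N u = (\<Sum>i<N. of_bool (tree (fld u) i) * dig u i * 3 ^ idx (fld u) i)"

lemma phi_pre: "phi N (pre N A) = pre (idx A N) (Phi A)"
proof -
  have "(\<Sum>i<M. of_bool (tree A i) * trit_nat (A i) * 3 ^ idx A i) = pre (idx A M) (Phi A)" for M
    by (induction M) (auto simp: idx_Suc pre_Suc codes_idx[OF codes_Phi])
  moreover have "phi N (pre N A) = (\<Sum>i<N. of_bool (tree A i) * trit_nat (A i) * 3 ^ idx A i)"
    unfolding phi_def
  proof (intro sum.cong refl)
    fix i assume "i \<in> {..<N}"
    then have "tree (fld (pre N A)) i = tree A i" "idx (fld (pre N A)) i = idx A i"
      using tree_cong_less[of N "fld (pre N A)" A i] idx_cong[of N "fld (pre N A)" A i] by (auto simp: fld_pre)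
    with \<open>i \<in> {..<N}\<close> show "of_bool (tree (fld (pre N A)) i) * dig (pre N A) i * 3 ^ idx (fld (pre N A)) i =
        of_bool (tree A i) * trit_nat (A i) * 3 ^ idx A i"
      by (simp add: dig_pre)
  qed
  ultimately show ?thesis by simp
qed

lemma cf_phi [cf_intros]:
  assumes "cf f" "cf g"
  shows "cf (\<lambda>e. phi (f e) (g e))"
  unfolding phi_def by (intro assms cf_intros cf_comp[OF assms(2)])

text \<open>\<open>rl x\<close> labels the nodes of the tree with code \<open>x\<close> accordingly; its labels off the tree are irrelevant.\<close>

definition rl :: "(nat \<Rightarrow> trit) \<Rightarrow> (nat \<Rightarrow> trit)" where
  "rl x = wfrec less_than (\<lambda>A c. x (idx A c))"

lemma wfrec_nat:
  fixes F :: "(nat \<Rightarrow> 'a) \<Rightarrow> nat \<Rightarrow> 'a"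
  assumes "\<And>f g c. (\<And>i. i < c \<Longrightarrow> f i = g i) \<Longrightarrow> F f c = F g c"
  shows "wfrec less_than F c = F (wfrec less_than F) c"
proof -
  have "adm_wf less_than F" unfolding adm_wf_def less_than_iff
    by (intro allI impI assms) blast
  from wfrec_fixpoint[OF wf_less_than this] show ?thesis by (rule fun_cong)
qed

lemma rl: "rl x c = x (idx (rl x) c)"
  unfolding rl_def by (rule wfrec_nat, rule arg_cong[where f = x], rule idx_cong_less) auto

text \<open>The recursion for \<open>rl x\<close> consults the tree that it is building. It is
  compared with a field \<open>A\<close> that has the prescribed labels on the tree and
  \<open>T0\<close> elsewhere: by induction both cut out the same tree and agree on it.\<close>

lemma codes_rl: "codes (rl x) x"
proof -
  define A where "A c = (if \<exists>i. c = hc (placed x i ! i) then x (THE i. c = hc (placed x i ! i)) else T0)" for c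
  have "A (hc (placed x i ! i)) = x i" for i
  proof -
    have "(THE j. hc (placed x i ! i) = hc (placed x j ! j)) = i"
      using strict_mono_eq[OF strict_mono_diag] by (intro the_equality) auto
    then show ?thesis unfolding A_def by auto
  qed
  then have A: "codes A x" unfolding codes_def by simp
  have "tree A c = tree (rl x) c \<and> (tree A c \<longrightarrow> A c = rl x c)" for c
  proof (induction c rule: less_induct)
    case (less c)
    have 1: "tree A c = tree (rl x) c"
    proof (cases "2 \<le> c")
      case True
      then have "c div 2 < c" by simp
      then show ?thesis using less[of "c div 2"] True by (auto simp: tree_parent)
    next
      case False
      then have "c = 0 \<or> c = Suc 0" by auto
      then show ?thesis by auto
    qed
    have "idx A c = idx (rl x) c"
      unfolding idx_def using less by (metis (no_types, lifting))
    then show ?case using 1 codes_idx[OF A, of c] rl[of x c] by auto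
  qed
  then show ?thesis
    using A mem_code_tree[OF A] placed_diag_mem unfolding codes_def by metis
qed

text \<open>The finite form of \<open>rl\<close>; \<open>N\<close> entries of the code suffice for
  \<open>N\<close> labels because \<open>idx A c \<le> c\<close>.\<close>

definition rlnum :: "nat \<Rightarrow> nat \<Rightarrow> nat" where
  "rlnum N \<rho> = rec_nat 0 (\<lambda>c w. w + dig \<rho> (idx (fld w) c) * 3 ^ c) N"

lemma rlnum_pre: "rlnum N (pre N x) = pre N (rl x)"
proof -
  have "rec_nat 0 (\<lambda>c w. w + dig (pre N x) (idx (fld w) c) * 3 ^ c) M = pre M (rl x)" if "M \<le> N" for M
    using that
  proof (induction M)
    case (Suc M)
    have "idx (fld (pre M (rl x))) M = idx (rl x) M"
      by (rule idx_cong[of M]) (auto simp: fld_pre)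
    moreover have "dig (pre N x) (idx (rl x) M) = trit_nat (x (idx (rl x) M))"
      using idx_le[of "rl x" M] Suc.prems by (intro dig_pre) simp
    ultimately show ?case using Suc rl[of x M] by (simp add: pre_Suc)
  qed simp
  then show ?thesis unfolding rlnum_def by blast
qed

lemma cf_rlnum [cf_intros]:
  assumes "cf f" "cf g"
  shows "cf (\<lambda>e. rlnum (f e) (g e))"
  unfolding rlnum_def by (intro assms cf_intros cf_comp[OF assms(2)])


section \<open>Finite-level description of Bernoulli measures\<close>

definition valid :: "real \<Rightarrow> real \<Rightarrow> bool" where
  "valid p q \<longleftrightarrow> 0 \<le> p \<and> 0 \<le> q \<and> p + q \<le> 1"

definition wt :: "real \<Rightarrow> real \<Rightarrow> nat \<Rightarrow> nat \<Rightarrow> real" where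
  "wt p q N u = (\<Prod>i<N. trit_weight p q (fld u i))"

lemma trit_weight_nonneg: "valid p q \<Longrightarrow> 0 \<le> trit_weight p q t"
  unfolding valid_def by (cases t) auto

lemma sum_trit: "sum f (UNIV :: trit set) = f T0 + f T1 + f T2"
  by (simp add: UNIV_trit add.assoc)

lemma wt_nonneg: "valid p q \<Longrightarrow> 0 \<le> wt p q N u"
  unfolding wt_def by (intro prod_nonneg ballI trit_weight_nonneg)

lemma prob_space_bernoulli: "prob_space (bernoulli p q)"
  unfolding bernoulli_def by (intro prob_space_PiM prob_space_measure_pmf)

lemma space_bernoulli [simp]: "space (bernoulli p q) = UNIV"
  by (simp add: bernoulli_def space_PiM)

lemma bernoulli_coordinates:
  assumes "valid p q" "finite J"
  shows "{A. \<forall>i\<in>J. A i = a i} \<in> sets (bernoulli p q)"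
    and "measure (bernoulli p q) {A. \<forall>i\<in>J. A i = a i} = (\<Prod>i\<in>J. trit_weight p q (a i))"
proof -
  interpret product_prob_space "\<lambda>i::nat. measure_pmf (embed_pmf (trit_weight p q))" UNIV
    by unfold_locales
  have eq: "{A. \<forall>i\<in>J. A i = a i} = {A \<in> space (bernoulli p q). \<forall>i\<in>J. A i \<in> {a i}}"
    by auto
  have em: "emeasure (bernoulli p q) {A. \<forall>i\<in>J. A i = a i} = (\<Prod>i\<in>J. ennreal (trit_weight p q (a i)))"
    unfolding eq using emeasure_PiM_Collect[of J "\<lambda>i. {a i}"] assms
    by (simp add: bernoulli_def emeasure_pmf_single pmf_trit valid_def)
  show "{A. \<forall>i\<in>J. A i = a i} \<in> sets (bernoulli p q)"
    unfolding eq bernoulli_def using assms(2) by (intro sets.sets_Collect_finite_All sets_Collect_single') auto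
  have "(\<Prod>i\<in>J. ennreal (trit_weight p q (a i))) = ennreal (\<Prod>i\<in>J. trit_weight p q (a i))"
    by (intro prod_ennreal trit_weight_nonneg assms)
  then show "measure (bernoulli p q) {A. \<forall>i\<in>J. A i = a i} = (\<Prod>i\<in>J. trit_weight p q (a i))"
    using em by (simp add: measure_def prod_nonneg trit_weight_nonneg assms)
qed

lemma sets_bernoulli_pre_eq: "valid p q \<Longrightarrow> {x. pre N x = u} \<in> sets (bernoulli p q)"
proof (cases "u < 3 ^ N")
  case True
  then have "{x. pre N x = u} = {x. \<forall>i\<in>{..<N}. x i = fld u i}"
    by (auto simp: pre_eq_iff')
  then show "valid p q \<Longrightarrow> ?thesis" using bernoulli_coordinates(1)[of p q "{..<N}" "fld u"] by simp
next
  case False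
  then have "{x. pre N x = u} = {}" using pre_less by auto
  then show ?thesis by simp
qed

lemma measure_bernoulli_pre_eq:
  assumes "valid p q" "u < 3 ^ N"
  shows "measure (bernoulli p q) {x. pre N x = u} = wt p q N u"
proof -
  have "{x. pre N x = u} = {x. \<forall>i\<in>{..<N}. x i = fld u i}"
    using assms(2) by (auto simp: pre_eq_iff')
  then show ?thesis using bernoulli_coordinates(2)[of p q "{..<N}" "fld u"] assms by (simp add: wt_def)
qed

lemma bernoulli_pre:
  assumes "valid p q"
  shows "{x. P (pre N x)} \<in> sets (bernoulli p q)"
    and "measure (bernoulli p q) {x. P (pre N x)} = (\<Sum>u<3 ^ N. of_bool (P u) * wt p q N u)"
proof -
  interpret prob_space "bernoulli p q" by (rule prob_space_bernoulli)
  let ?I = "{u. u < 3 ^ N \<and> P u}"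
  have fin: "finite ?I" by simp
  have eq: "{x. P (pre N x)} = (\<Union>u\<in>?I. {x. pre N x = u})"
    using pre_less by auto
  show "{x. P (pre N x)} \<in> sets (bernoulli p q)"
    unfolding eq using sets_bernoulli_pre_eq[OF assms] by auto
  have "measure (bernoulli p q) {x. P (pre N x)} = (\<Sum>u\<in>?I. measure (bernoulli p q) {x. pre N x = u})"
    unfolding eq using sets_bernoulli_pre_eq[OF assms]
    by (intro finite_measure_finite_Union fin) (auto simp: disjoint_family_on_def)
  also have "\<dots> = (\<Sum>u\<in>?I. wt p q N u)"
    by (intro sum.cong refl measure_bernoulli_pre_eq assms) auto
  also have "\<dots> = (\<Sum>u<3 ^ N. of_bool (P u) * wt p q N u)"
    by (intro sum.mono_neutral_cong_left) auto
  finally show "measure (bernoulli p q) {x. P (pre N x)} = (\<Sum>u<3 ^ N. of_bool (P u) * wt p q N u)" .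
qed

lemma sum_wt: "valid p q \<Longrightarrow> (\<Sum>u<3 ^ N. wt p q N u) = 1"
  using bernoulli_pre(2)[of p q "\<lambda>_. True" N] prob_space.prob_space[OF prob_space_bernoulli, of p q]
  by simp

text \<open>The code of a tree with independent labels is again a Bernoulli sequence.\<close>

lemma measure_Phi_le:
  assumes "valid p q" "\<And>A. Q (pre N A) \<Longrightarrow> P (pre k (Phi A))"
  shows "(\<Sum>u<3 ^ N. of_bool (Q u) * wt p q N u) \<le> (\<Sum>s<3 ^ k. of_bool (P s) * wt p q k s)"
proof -
  interpret prob_space "bernoulli p q" by (rule prob_space_bernoulli)
  let ?I = "{s. s < 3 ^ k \<and> P s}"
  \<comment> \<open>\<open>d s i\<close> is the heap code of the node at position \<open>i\<close>
    of the tree coded by \<open>s\<close>. These nodes are distinct, so the event \<open>C s\<close>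
    that the first \<open>k\<close> of them carry the labels from \<open>s\<close> has measure
    \<open>wt p q k s\<close>.\<close>
  define d where "d s i = hc (placed (fld s) i ! i)" for s i
  have inj: "inj (d s)" for s
    unfolding d_def using strict_mono_imp_inj_on[OF strict_mono_diag] .
  define a where "a s c = fld s (inv (d s) c)" for s c
  have a: "a s (d s i) = fld s i" for s i
    by (simp add: a_def inj)
  define C where "C s = {A. \<forall>c\<in>d s ` {..<k}. A c = a s c}" for s
  have C: "C s \<in> sets (bernoulli p q)" "measure (bernoulli p q) (C s) = wt p q k s" for s
  proof -
    show "C s \<in> sets (bernoulli p q)"
      unfolding C_def by (intro bernoulli_coordinates assms) simp
    have "measure (bernoulli p q) (C s) = (\<Prod>c\<in>d s ` {..<k}. trit_weight p q (a s c))"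
      unfolding C_def by (intro bernoulli_coordinates assms) simp
    also have "\<dots> = wt p q k s"
      using inj[of s] by (simp add: prod.reindex inj_on_subset wt_def a)
    finally show "measure (bernoulli p q) (C s) = wt p q k s" .
  qed
  have sub: "{A. Q (pre N A)} \<subseteq> (\<Union>s\<in>?I. C s)"
  proof
    fix A assume "A \<in> {A. Q (pre N A)}"
    then have P: "P (pre k (Phi A))" using assms(2) by simp
    define s where "s = pre k (Phi A)"
    have pl: "placed (fld s) i = placed (Phi A) i" if "i \<le> k" for i
      using that by (induction i) (auto simp: s_def fld_pre)
    have "A (d s i) = a s (d s i)" if "i < k" for i
    proof -
      have "A (d s i) = Phi A i"
        using codes_Phi[of A] pl[of i] that unfolding codes_def d_def by simp
      also have "\<dots> = a s (d s i)" unfolding a using that by (simp add: s_def fld_pre)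
      finally show ?thesis .
    qed
    then have "A \<in> C s" unfolding C_def by auto
    moreover have "s \<in> ?I" using P pre_less s_def by auto
    ultimately show "A \<in> (\<Union>s\<in>?I. C s)" by blast
  qed
  have "(\<Sum>u<3 ^ N. of_bool (Q u) * wt p q N u) = measure (bernoulli p q) {A. Q (pre N A)}"
    using bernoulli_pre(2)[OF assms(1)] by simp
  also have "\<dots> \<le> measure (bernoulli p q) (\<Union>s\<in>?I. C s)"
    using sub C(1) by (intro finite_measure_mono) auto
  also have "\<dots> \<le> (\<Sum>s\<in>?I. measure (bernoulli p q) (C s))"
    using C(1) by (intro finite_measure_subadditive_finite) auto
  also have "\<dots> = (\<Sum>s<3 ^ k. of_bool (P s) * wt p q k s)"
    unfolding C(2) by (intro sum.mono_neutral_cong_left) auto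
  finally show ?thesis .
qed


section \<open>Trimmed tests\<close>

text \<open>
  \<open>hit E n k t s\<close>: some initial segment of the string coded by \<open>s\<close> is enumerated into the
  \<open>n\<close>-th component within \<open>k\<close> steps with the oracle prefix coded by \<open>t\<close>. \<open>ok\<close> certifies, by a
  lower bound on the measure of the complement, that the strings hit so far have measure less
  than \<open>2 / 2 ^ n\<close>; this makes sense of a test also for oracles to which it does not belong.
\<close>

definition hit :: "(nat \<Rightarrow> nat) \<Rightarrow> nat \<Rightarrow> nat \<Rightarrow> nat \<Rightarrow> nat \<Rightarrow> bool" where
  "hit E n k t s \<longleftrightarrow> (\<exists>k'<Suc k. \<exists>l<Suc k.
     E (enc (enc (t mod 3 ^ k') k') (enc n (conv l (s mod 3 ^ l)))) \<noteq> 0)"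

definition ok :: "(nat \<Rightarrow> nat) \<Rightarrow> (nat \<Rightarrow> nat) \<Rightarrow> nat \<Rightarrow> nat \<Rightarrow> nat \<Rightarrow> nat \<Rightarrow> bool" where
  "ok lo E n N k t \<longleftrightarrow> (\<exists>K<N. (2 ^ K) ^ k * 2 ^ n <
     (\<Sum>s<3 ^ k. of_bool (\<not> hit E n k t s) * (\<Prod>i<k. lo (enc K (dig s i)))) * 2 ^ n + 2 * (2 ^ K) ^ k)"

text \<open>\<open>u\<close> holds the labels of the tested tree, \<open>v\<close> those of the tree
  serving as oracle. With \<open>k\<close> at most both values of \<open>idx\<close>, the remainders
  are genuine prefixes of the two codes; together with the precision bound \<open>K < N\<close> in
  \<open>ok\<close> this makes the event grow with \<open>N\<close>.\<close>

definition ev :: "(nat \<Rightarrow> nat) \<Rightarrow> (nat \<Rightarrow> nat) \<Rightarrow> nat \<Rightarrow> nat \<Rightarrow> nat \<Rightarrow> nat \<Rightarrow> bool" where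
  "ev lo E n N u v \<longleftrightarrow> (\<exists>k<Suc N. k \<le> idx (fld u) N \<and> k \<le> idx (fld v) N \<and>
     hit E n k (phi N v mod 3 ^ k) (phi N u mod 3 ^ k) \<and> ok lo E n N k (phi N v mod 3 ^ k))"

definition lower_weights :: "real \<Rightarrow> real \<Rightarrow> (nat \<Rightarrow> nat) \<Rightarrow> bool" where
  "lower_weights p q lo \<longleftrightarrow> cf lo \<and>
     (\<forall>K t. real (lo (enc K (trit_nat t))) / 2 ^ K \<le> trit_weight p q t) \<and>
     (\<forall>t. (\<lambda>K. real (lo (enc K (trit_nat t))) / 2 ^ K) \<longlonglongrightarrow> trit_weight p q t)"

lemma ex_lower_weights:
  assumes "\<And>t. cr (trit_weight p q t)"
  shows "\<exists>lo. lower_weights p q lo"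
proof -
  have "\<forall>t. \<exists>f. cf f \<and> (\<forall>k. real (f k) / 2 ^ k \<le> trit_weight p q t) \<and>
      (\<lambda>k. real (f k) / 2 ^ k) \<longlonglongrightarrow> trit_weight p q t"
    using cr_lower[OF assms] by metis
  then obtain f where f: "cf (f t)" "real (f t k) / 2 ^ k \<le> trit_weight p q t"
    "(\<lambda>k. real (f t k) / 2 ^ k) \<longlonglongrightarrow> trit_weight p q t" for t k
    by metis
  define lo where "lo e = (if psnd e < 3 then f (nat_trit (psnd e)) (pfst e) else 0)" for e
  have "cf lo" unfolding lo_def
    by (rule cf_choose[of 3 "\<lambda>i. f (nat_trit i)" psnd pfst]) (intro f cf_intros)+
  moreover have "lo (enc K (trit_nat t)) = f t K" for K t
    by (simp add: lo_def)
  ultimately show ?thesis unfolding lower_weights_def using f by (intro exI[of _ lo]) auto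
qed

lemma decidable_hit:
  assumes "cf E"
  shows "decidable (\<lambda>e. hit E (pfst e) (pfst (psnd e)) (pfst (psnd (psnd e))) (psnd (psnd (psnd e))))"
  unfolding hit_def by (intro cf_intros cf_comp[OF assms])

lemma decidable_hit' [cf_intros]:
  assumes "cf E" "cf a" "cf b" "cf c" "cf d"
  shows "decidable (\<lambda>e. hit E (a e) (b e) (c e) (d e))"
  using cf_comp[OF decidable_hit[OF assms(1), unfolded decidable_def]
      cf_enc[OF assms(2) cf_enc[OF assms(3) cf_enc[OF assms(4,5)]]]]
  unfolding decidable_def by simp

lemma decidable_ok:
  assumes "cf lo" "cf E"
  shows "decidable (\<lambda>e. ok lo E (pfst e) (pfst (psnd e)) (pfst (psnd (psnd e))) (psnd (psnd (psnd e))))"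
  unfolding ok_def by (intro cf_intros cf_comp[OF assms(1)] assms)

lemma decidable_ok' [cf_intros]:
  assumes "cf lo" "cf E" "cf a" "cf b" "cf c" "cf d"
  shows "decidable (\<lambda>e. ok lo E (a e) (b e) (c e) (d e))"
  using cf_comp[OF decidable_ok[OF assms(1,2), unfolded decidable_def]
      cf_enc[OF assms(3) cf_enc[OF assms(4) cf_enc[OF assms(5,6)]]]]
  unfolding decidable_def by simp

lemma decidable_ev:
  assumes "cf lo" "cf E"
  shows "decidable (\<lambda>e. ev lo E (pfst e) (pfst (psnd e)) (pfst (psnd (psnd e))) (psnd (psnd (psnd e))))"
  unfolding ev_def by (intro cf_intros assms)

lemma decidable_ev' [cf_intros]:
  assumes "cf lo" "cf E" "cf a" "cf b" "cf c" "cf d"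
  shows "decidable (\<lambda>e. ev lo E (a e) (b e) (c e) (d e))"
  using cf_comp[OF decidable_ev[OF assms(1,2), unfolded decidable_def]
      cf_enc[OF assms(3) cf_enc[OF assms(4) cf_enc[OF assms(5,6)]]]]
  unfolding decidable_def by simp

lemma hit_pre:
  "hit E n k (pre k y) (pre k x) \<longleftrightarrow>
     (\<exists>k'\<le>k. \<exists>l\<le>k. run E y k' (enc n (conv l (pre l x))) \<noteq> 0)"
  unfolding hit_def run_def by (simp add: less_Suc_eq_le pre_mod cong: conj_cong)

lemma hit_mono:
  "k \<le> m \<Longrightarrow> hit E n k (pre k y) (pre k x) \<Longrightarrow> hit E n m (pre m y) (pre m x)"
  unfolding hit_pre by (meson order_trans)

lemma ok_mono: "N \<le> M \<Longrightarrow> ok lo E n N k t \<Longrightarrow> ok lo E n M k t"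
  unfolding ok_def by (meson less_le_trans)

lemma ev_pre:
  "ev lo E n N (pre N A) (pre N B) \<longleftrightarrow> (\<exists>k\<le>N. k \<le> idx A N \<and> k \<le> idx B N \<and>
     hit E n k (pre k (Phi B)) (pre k (Phi A)) \<and> ok lo E n N k (pre k (Phi B)))"
proof -
  have idx: "idx (fld (pre N A)) N = idx A N" for A
    by (rule idx_cong[of N]) (auto simp: fld_pre)
  have "phi N (pre N A) mod 3 ^ k = pre k (Phi A)" if "k \<le> idx A N" for A k
    using that by (simp add: phi_pre pre_mod)
  then show ?thesis unfolding ev_def idx by (auto simp: less_Suc_eq_le)
qed

lemma ev_mono:
  assumes "N \<le> M" "ev lo E n N (pre N A) (pre N B)"
  shows "ev lo E n M (pre M A) (pre M B)"
  using assms(2) idx_mono[OF assms(1), of A] idx_mono[OF assms(1), of B] ok_mono[OF assms(1)] assms(1)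
  unfolding ev_pre by (meson order_trans)

lemma real_weighted_sum:
  "real (\<Sum>s<M. of_bool (P s) * (\<Prod>i<k. f s i)) / c ^ k =
     (\<Sum>s<M. of_bool (P s) * (\<Prod>i<k. real (f s i) / c))"
  unfolding of_nat_sum sum_divide_distrib
  by (intro sum.cong refl) (simp add: prod_dividef)

text \<open>Freed of integers, the inequality in \<open>ok\<close> reads
  \<open>1 < X / (2 ^ K) ^ k + 2 / 2 ^ n\<close>, and \<open>X / (2 ^ K) ^ k\<close> is at most the
  measure of the strings not hit.\<close>

lemma ok_bound:
  assumes "valid p q" "lower_weights p q lo" "ok lo E n N k t"
  shows "(\<Sum>s<3 ^ k. of_bool (hit E n k t s) * wt p q k s) \<le> 2 / 2 ^ n"
proof -
  obtain K where K: "(2 ^ K) ^ k * 2 ^ n <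
     (\<Sum>s<3 ^ k. of_bool (\<not> hit E n k t s) * (\<Prod>i<k. lo (enc K (dig s i)))) * 2 ^ n + 2 * (2 ^ K) ^ k"
    using assms(3) unfolding ok_def by blast
  define X where "X = (\<Sum>s<3 ^ k. of_bool (\<not> hit E n k t s) * (\<Prod>i<k. lo (enc K (dig s i))))"
  have "real ((2 ^ K) ^ k * 2 ^ n) < real (X * 2 ^ n + 2 * (2 ^ K) ^ k)"
    using K unfolding X_def of_nat_less_iff .
  then have X: "1 < real X / (2 ^ K) ^ k + 2 / 2 ^ n"
    by (simp add: field_simps)
  have "real X / (2 ^ K) ^ k =
      (\<Sum>s<3 ^ k. of_bool (\<not> hit E n k t s) * (\<Prod>i<k. real (lo (enc K (dig s i))) / 2 ^ K))"
    unfolding X_def by (rule real_weighted_sum)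
  also have "\<dots> \<le> (\<Sum>s<3 ^ k. of_bool (\<not> hit E n k t s) * wt p q k s)"
    unfolding wt_def
  proof (intro sum_mono mult_left_mono prod_mono conjI)
    fix s i
    show "real (lo (enc K (dig s i))) / 2 ^ K \<le> trit_weight p q (fld s i)"
      using assms(2) unfolding lower_weights_def by (metis trit_nat_fld)
  qed auto
  also have "\<dots> = 1 - (\<Sum>s<3 ^ k. of_bool (hit E n k t s) * wt p q k s)"
  proof -
    have "(\<Sum>s<3 ^ k. of_bool (\<not> hit E n k t s) * wt p q k s) +
        (\<Sum>s<3 ^ k. of_bool (hit E n k t s) * wt p q k s) = (\<Sum>s<3 ^ k. wt p q k s)"
      unfolding sum.distrib[symmetric] by (intro sum.cong) auto
    then show ?thesis using sum_wt[OF assms(1), of k] by linarith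
  qed
  finally show ?thesis using X by linarith
qed

text \<open>For a fixed oracle field let \<open>m\<close> be the largest certified stage up to
  \<open>N\<close>. Hits persist, so every string counted at any certified stage is still hit at
  stage \<open>m\<close>, and the certificate for \<open>m\<close> alone bounds them all.\<close>

lemma ev_bound:
  assumes "valid p q" "lower_weights p q lo" "v < 3 ^ N"
  shows "(\<Sum>u<3 ^ N. of_bool (ev lo E n N u v) * wt p q N u) \<le> 2 / 2 ^ n"
proof -
  define B where "B = fld v"
  have v: "v = pre N B" using assms(3) by (simp add: B_def pre_fld)
  let ?S = "{k. k \<le> N \<and> ok lo E n N k (pre k (Phi B))}"
  show ?thesis
  proof (cases "?S = {}")
    case True
    have "(\<Sum>u<3 ^ N. of_bool (ev lo E n N u v) * wt p q N u) = (\<Sum>u<3 ^ N. 0 * wt p q N u)"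
    proof (intro sum.cong refl)
      fix u :: nat assume "u \<in> {..<3 ^ N}"
      then have u: "pre N (fld u) = u" by (simp add: pre_fld)
      have "\<not> ev lo E n N (pre N (fld u)) (pre N B)" using True unfolding ev_pre by blast
      then have "\<not> ev lo E n N u v" unfolding u v .
      then show "of_bool (ev lo E n N u v) * wt p q N u = 0 * wt p q N u" by simp
    qed
    then show ?thesis by simp
  next
    case False
    define m where "m = Max ?S"
    have fin: "finite ?S" by simp
    have m: "m \<in> ?S" unfolding m_def using fin False by (rule Max_in)
    have "(\<Sum>u<3 ^ N. of_bool (ev lo E n N u v) * wt p q N u) \<le>
        (\<Sum>s<3 ^ m. of_bool (hit E n m (pre m (Phi B)) s) * wt p q m s)"
    proof (rule measure_Phi_le[OF assms(1)])
      fix A assume "ev lo E n N (pre N A) v"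
      then obtain k where k: "k \<in> ?S" "hit E n k (pre k (Phi B)) (pre k (Phi A))"
        unfolding v ev_pre by auto
      then have "k \<le> m" unfolding m_def using fin by simp
      then show "hit E n m (pre m (Phi B)) (pre m (Phi A))" using k(2) by (rule hit_mono)
    qed
    also have "\<dots> \<le> 2 / 2 ^ n" using ok_bound[OF assms(1,2)] m by blast
    finally show ?thesis .
  qed
qed

lemma ev_bound2:
  assumes "valid p q" "lower_weights p q lo" "valid r s"
  shows "(\<Sum>u<3 ^ N. \<Sum>v<3 ^ N. of_bool (ev lo E n N u v) * (wt p q N u * wt r s N v)) \<le> 2 / 2 ^ n"
proof -
  have "(\<Sum>u<3 ^ N. \<Sum>v<3 ^ N. of_bool (ev lo E n N u v) * (wt p q N u * wt r s N v)) =
      (\<Sum>v<3 ^ N. wt r s N v * (\<Sum>u<3 ^ N. of_bool (ev lo E n N u v) * wt p q N u))"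
    unfolding sum_distrib_left by (subst sum.swap) (intro sum.cong refl, simp)
  also have "\<dots> \<le> (\<Sum>v<3 ^ N. wt r s N v * (2 / 2 ^ n))"
    by (intro sum_mono mult_left_mono ev_bound assms wt_nonneg) auto
  also have "\<dots> = 2 / 2 ^ n"
    unfolding sum_distrib_right[symmetric] sum_wt[OF assms(3)] by simp
  finally show ?thesis .
qed

text \<open>For its own oracle the test has measure at most \<open>1 / 2 ^ n\<close>. The gap to the
  tolerance \<open>2 / 2 ^ n\<close> lets lower approximations of the weights of some finite
  precision certify every stage, so trimming loses no hit.\<close>

lemma not_random_imp_ev:
  assumes valid: "valid p q" and lo: "lower_weights p q lo"
    and nr: "\<not> ml_random (bernoulli p q) {seq_oracle (Phi B)} (Phi A)"
  shows "\<exists>E. cf E \<and> (\<forall>n. \<exists>N. ev lo E n N (pre N A) (pre N B))"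
proof -
  define x y where "x = Phi A" and "y = Phi B"
  obtain W where W: "ml_test (bernoulli p q) {seq_oracle y} W" "\<And>n. x \<in> (\<Union>\<sigma>\<in>W n. cylinder \<sigma>)"
    using nr unfolding ml_random_def x_def y_def by blast
  define S where "S = {enc n (str_code \<sigma>) | n \<sigma>. \<sigma> \<in> W n}"
  obtain f where f: "partial_recursive {seq_oracle y} f" "S = dom f"
    using W(1) unfolding ml_test_def comp_enumerable_def S_def by blast
  obtain E where E: "cf E" "simulates y E f" using ex_simulation[OF f(1)] by blast
  have mS: "enc n (str_code \<sigma>) \<in> S \<longleftrightarrow> \<sigma> \<in> W n" for n \<sigma>
    unfolding S_def using str_code_inj by auto
  interpret prob_space "bernoulli p q" by (rule prob_space_bernoulli)
  have "\<exists>N. ev lo E n N (pre N A) (pre N B)" for n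
  proof -
    obtain \<sigma> where \<sigma>: "\<sigma> \<in> W n" "x \<in> cylinder \<sigma>" using W(2) by blast
    define l where "l = length \<sigma>"
    have "\<sigma> = strg l (pre l x)" using \<sigma>(2) by (simp add: strg_pre cylinder_def l_def)
    then have "enc n (conv l (pre l x)) \<in> S" using \<sigma>(1) mS by (simp add: conv_eq)
    then obtain w where "f (enc n (conv l (pre l x))) = Some w" using f(2) by blast
    from eventually_happens'[OF sequentially_bot simulatesD(2)[OF E(2) this]]
    obtain k' where "run E y k' (enc n (conv l (pre l x))) = Suc w" by blast
    then have k': "run E y k' (enc n (conv l (pre l x))) \<noteq> 0" by simp
    define k where "k = max k' l"
    have hit: "hit E n k (pre k y) (pre k x)"
      unfolding hit_pre using k' by (intro exI[of _ k'] exI[of _ l] conjI) (auto simp: k_def)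
    let ?U = "\<Union>\<sigma>\<in>W n. cylinder \<sigma>"
    have U: "?U \<in> sets (bernoulli p q)"
    proof -
      have "cylinder \<sigma> \<in> sets (bernoulli p q)" for \<sigma>
      proof -
        have "cylinder \<sigma> = {x. \<forall>i\<in>{..<length \<sigma>}. x i = \<sigma> ! i}" by (auto simp: cylinder_iff)
        then show ?thesis using bernoulli_coordinates(1)[OF valid, of "{..<length \<sigma>}" "(!) \<sigma>"] by simp
      qed
      moreover have "countable (W n)" by (rule countableI, rule inj_onI, rule str_code_inj)
      ultimately show ?thesis by (intro sets.countable_UN') auto
    qed
    have sub: "{z. hit E n k (pre k y) (pre k z)} \<subseteq> ?U"
    proof
      fix z assume "z \<in> {z. hit E n k (pre k y) (pre k z)}"
      then obtain k' l where kl: "run E y k' (enc n (conv l (pre l z))) \<noteq> 0"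
        unfolding mem_Collect_eq hit_pre by blast
      then have "enc n (conv l (pre l z)) \<in> S"
        using simulatesD(1)[OF E(2)] f(2) by blast
      then have "strg l (pre l z) \<in> W n" using mS by (simp add: conv_eq)
      moreover have "z \<in> cylinder (strg l (pre l z))"
        by (simp add: mem_cylinder_strg pre_less)
      ultimately show "z \<in> ?U" by blast
    qed
    have "(\<Sum>s<3 ^ k. of_bool (hit E n k (pre k y) s) * wt p q k s) =
        measure (bernoulli p q) {z. hit E n k (pre k y) (pre k z)}"
      using bernoulli_pre(2)[OF valid] by simp
    also have "\<dots> \<le> measure (bernoulli p q) ?U" using sub U by (rule finite_measure_mono)
    also have "\<dots> \<le> 1 / 2 ^ n" using W(1) unfolding ml_test_def by blast
    finally have small: "(\<Sum>s<3 ^ k. of_bool (hit E n k (pre k y) s) * wt p q k s) \<le> 1 / 2 ^ n" .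
    define X where "X K = (\<Sum>s<3 ^ k. of_bool (\<not> hit E n k (pre k y) s) * (\<Prod>i<k. lo (enc K (dig s i))))" for K
    have Xr: "real (X K) / (2 ^ K) ^ k =
        (\<Sum>s<3 ^ k. of_bool (\<not> hit E n k (pre k y) s) * (\<Prod>i<k. real (lo (enc K (dig s i))) / 2 ^ K))" for K
      unfolding X_def by (rule real_weighted_sum)
    have "(\<lambda>K. real (lo (enc K (dig s i))) / 2 ^ K) \<longlonglongrightarrow> trit_weight p q (fld s i)" for s i
      using lo unfolding lower_weights_def by (metis trit_nat_fld)
    then have "(\<lambda>K. real (X K) / (2 ^ K) ^ k) \<longlonglongrightarrow>
        (\<Sum>s<3 ^ k. of_bool (\<not> hit E n k (pre k y) s) * wt p q k s)"
      unfolding Xr wt_def by (intro tendsto_intros)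
    moreover have "1 - 2 / 2 ^ n < (\<Sum>s<3 ^ k. of_bool (\<not> hit E n k (pre k y) s) * wt p q k s)"
    proof -
      have "(\<Sum>s<3 ^ k. of_bool (\<not> hit E n k (pre k y) s) * wt p q k s) +
          (\<Sum>s<3 ^ k. of_bool (hit E n k (pre k y) s) * wt p q k s) = (\<Sum>s<3 ^ k. wt p q k s)"
        unfolding sum.distrib[symmetric] by (intro sum.cong) auto
      moreover have "(1::real) / 2 ^ n < 2 / 2 ^ n" by (simp add: divide_strict_right_mono)
      ultimately show ?thesis using sum_wt[OF valid, of k] small by linarith
    qed
    ultimately have "\<forall>\<^sub>F K in sequentially. 1 - 2 / 2 ^ n < real (X K) / (2 ^ K) ^ k"
      by (rule order_tendstoD)
    from eventually_happens'[OF sequentially_bot this]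
    obtain K where "1 - 2 / 2 ^ n < real (X K) / (2 ^ K) ^ k" by blast
    then have "real ((2 ^ K) ^ k * 2 ^ n) < real (X K * 2 ^ n + 2 * (2 ^ K) ^ k)"
      by (simp add: field_simps)
    then have K: "(2 ^ K) ^ k * 2 ^ n < X K * 2 ^ n + 2 * (2 ^ K) ^ k"
      unfolding of_nat_less_iff .
    obtain N1 N2 where N: "\<And>m. N1 \<le> m \<Longrightarrow> k \<le> idx A m" "\<And>m. N2 \<le> m \<Longrightarrow> k \<le> idx B m"
      using idx_unbounded by meson
    \<comment> \<open>\<open>N\<close> labels must determine \<open>k\<close> entries of both codes,
      and the search in \<open>ok\<close> must reach the precision \<open>K\<close>.\<close>
    define N where "N = max (max N1 N2) (max k (Suc K))"
    have "ok lo E n N k (pre k y)"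
      unfolding ok_def using K unfolding X_def by (intro exI[of _ K]) (simp add: N_def)
    then have "ev lo E n N (pre N A) (pre N B)"
      unfolding ev_pre using hit N unfolding x_def y_def
      by (intro exI[of _ k] conjI) (auto simp: N_def)
    then show ?thesis ..
  qed
  then show ?thesis using E(1) by blast
qed


section \<open>Transfer of randomness through a random extension\<close>

text \<open>
  Given \<open>x\<close>, the pair of fields \<open>(labA x \<omega>, labB x \<omega>)\<close> is chosen at random. If \<open>x\<close> itself is
  chosen at random, then the joint law of the pair is at most \<open>C\<close> times a product measure, so the
  conditional probability given \<open>x\<close> of being caught by a test is small except on a small
  enumerable open set of sequences \<open>x\<close>.
\<close>

lemma null_test:
  fixes \<Lambda> :: "'w measure" and labA labB :: "(nat \<Rightarrow> trit) \<Rightarrow> 'w \<Rightarrow> nat \<Rightarrow> trit"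
    and kap :: "nat \<Rightarrow> nat \<Rightarrow> nat \<Rightarrow> nat \<Rightarrow> real"
  assumes valid: "valid p q" "valid r s" "valid a b"
    and lo: "lower_weights p q lo" and E: "cf E" and prob: "prob_space \<Lambda>"
    and meas: "\<And>x N u v. {\<omega>\<in>space \<Lambda>. pre N (labA x \<omega>) = u \<and> pre N (labB x \<omega>) = v} \<in> sets \<Lambda>"
    and kap: "\<And>x N u v. u < 3 ^ N \<Longrightarrow> v < 3 ^ N \<Longrightarrow>
      measure \<Lambda> {\<omega>\<in>space \<Lambda>. pre N (labA x \<omega>) = u \<and> pre N (labB x \<omega>) = v} = kap N (pre N (rl x)) u v"
    and LW: "cf LW"
      "\<And>K N l u v. real (LW (enc K (enc N (enc l (enc u v))))) / (2 ^ K) ^ N \<le> kap N l u v"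
      "\<And>N l u v. (\<lambda>K. real (LW (enc K (enc N (enc l (enc u v))))) / (2 ^ K) ^ N) \<longlonglongrightarrow> kap N l u v"
    and bound: "\<And>N u v. u < 3 ^ N \<Longrightarrow> v < 3 ^ N \<Longrightarrow>
      (\<Sum>\<rho><3 ^ N. wt a b N \<rho> * kap N (rlnum N \<rho>) u v) \<le> C * (wt p q N u * wt r s N v)"
    and C: "0 \<le> C"
    and rand: "ml_random (bernoulli a b) {} x"
  shows "AE \<omega> in \<Lambda>. \<not> (\<forall>n. \<exists>N. ev lo E n N (pre N (labA x \<omega>)) (pre N (labB x \<omega>)))"
proof -
  interpret \<Lambda>: prob_space \<Lambda> by (rule prob)
  interpret B: prob_space "bernoulli a b" by (rule prob_space_bernoulli)
  \<comment> \<open>The conditional probability, given the labels \<open>l\<close> of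
    \<open>R\<close>, that the pair is caught by stage \<open>N\<close>.\<close>
  define pr where "pr n N l = (\<Sum>u<3 ^ N. \<Sum>v<3 ^ N. of_bool (ev lo E n N u v) * kap N l u v)" for n N l
  define EV where "EV n N y = {\<omega>\<in>space \<Lambda>. ev lo E n N (pre N (labA y \<omega>)) (pre N (labB y \<omega>))}" for n N y
  have EV: "EV n N y \<in> sets \<Lambda>" "measure \<Lambda> (EV n N y) = pr n N (pre N (rl y))" for n N y
  proof -
    let ?I = "{w \<in> {..<3 ^ N} \<times> {..<3 ^ N}. ev lo E n N (fst w) (snd w)}"
    let ?A = "\<lambda>w. {\<omega>\<in>space \<Lambda>. pre N (labA y \<omega>) = fst w \<and> pre N (labB y \<omega>) = snd w}"
    have fin: "finite ?I" by simp
    have eq: "EV n N y = (\<Union>w\<in>?I. ?A w)"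
      unfolding EV_def using pre_less by auto
    show "EV n N y \<in> sets \<Lambda>" unfolding eq using fin meas by (intro sets.finite_UN) auto
    have "measure \<Lambda> (EV n N y) = (\<Sum>w\<in>?I. measure \<Lambda> (?A w))"
      unfolding eq using meas
      by (intro \<Lambda>.finite_measure_finite_Union fin) (auto simp: disjoint_family_on_def prod_eq_iff)
    also have "\<dots> = (\<Sum>w\<in>?I. kap N (pre N (rl y)) (fst w) (snd w))"
      by (intro sum.cong refl kap) auto
    also have "\<dots> = (\<Sum>w\<in>{..<3 ^ N} \<times> {..<3 ^ N}. of_bool (ev lo E n N (fst w) (snd w)) * kap N (pre N (rl y)) (fst w) (snd w))"
      by (intro sum.mono_neutral_cong_left) auto
    also have "\<dots> = pr n N (pre N (rl y))"
      unfolding pr_def sum.cartesian_product by (simp add: case_prod_beta)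
    finally show "measure \<Lambda> (EV n N y) = pr n N (pre N (rl y))" .
  qed
  have EV_mono: "EV n N y \<subseteq> EV n M y" if "N \<le> M" for n N M y
    unfolding EV_def using ev_mono[OF that] by blast
  have small: "\<exists>n. \<forall>N. measure \<Lambda> (EV n N x) \<le> 1 / 2 ^ j" for j
  proof -
    \<comment> \<open>Shifting the test index by \<open>c\<close> absorbs the Markov factor
      \<open>2 ^ j\<close>, the density bound \<open>C\<close> and the tolerance factor 2.\<close>
    obtain c where c: "2 ^ j * C * 2 < 2 ^ c" using real_arch_pow[of 2] by auto
    define big where "big n N \<rho> \<longleftrightarrow> 1 / 2 ^ j < pr (n + c) N (rlnum N \<rho>)" for n N \<rho>
    define W where "W n = {strg N \<rho> | N \<rho>. \<rho> < 3 ^ N \<and> big n N \<rho>}" for n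
    have UW: "(\<Union>\<sigma>\<in>W n. cylinder \<sigma>) = (\<Union>N. {y. big n N (pre N y)})" for n
    proof (intro set_eqI iffI)
      fix y assume "y \<in> (\<Union>\<sigma>\<in>W n. cylinder \<sigma>)"
      then obtain N \<rho> where "\<rho> < 3 ^ N" "big n N \<rho>" "y \<in> cylinder (strg N \<rho>)"
        unfolding W_def by blast
      then show "y \<in> (\<Union>N. {y. big n N (pre N y)})" by (auto simp: mem_cylinder_strg)
    next
      fix y assume "y \<in> (\<Union>N. {y. big n N (pre N y)})"
      then obtain N where "big n N (pre N y)" by blast
      then have "strg N (pre N y) \<in> W n" unfolding W_def using pre_less by blast
      moreover have "y \<in> cylinder (strg N (pre N y))" by (simp add: mem_cylinder_strg pre_less)
      ultimately show "y \<in> (\<Union>\<sigma>\<in>W n. cylinder \<sigma>)" by blast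
    qed
    have big_pre: "big n N (pre N y) \<longleftrightarrow> 1 / 2 ^ j < measure \<Lambda> (EV (n + c) N y)" for n N y
      unfolding big_def EV(2) rlnum_pre ..
    have "ml_test (bernoulli a b) {} W"
      unfolding ml_test_def
    proof (intro conjI allI)
      fix n
      have inc: "incseq (\<lambda>N. {y. big n N (pre N y)})"
      proof (intro monoI subsetI CollectI)
        fix N M :: nat and y assume "N \<le> M" "y \<in> {y. big n N (pre N y)}"
        then have "1 / 2 ^ j < measure \<Lambda> (EV (n + c) N y)" by (simp add: big_pre)
        also have "\<dots> \<le> measure \<Lambda> (EV (n + c) M y)"
          using EV_mono[OF \<open>N \<le> M\<close>] EV(1) by (rule \<Lambda>.finite_measure_mono)
        finally show "big n M (pre M y)" unfolding big_pre .
      qed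
      have sets: "{y. big n N (pre N y)} \<in> sets (bernoulli a b)" for N
        by (rule bernoulli_pre(1)[OF valid(3)])
      have le: "measure (bernoulli a b) {y. big n N (pre N y)} \<le> 1 / 2 ^ n" for N
      proof -
        have kap_nn: "0 \<le> kap N l u v" for l u v
          using LW(2)[of 0 N l u v] by (rule order_trans[rotated]) simp
        have pr_nn: "0 \<le> pr m N l" for m l
          unfolding pr_def by (intro sum_nonneg mult_nonneg_nonneg kap_nn) auto
        have "measure (bernoulli a b) {y. big n N (pre N y)} = (\<Sum>\<rho><3 ^ N. of_bool (big n N \<rho>) * wt a b N \<rho>)"
          by (rule bernoulli_pre(2)[OF valid(3)])
        \<comment> \<open>Markov's inequality: the indicator of \<open>big\<close> is at most
          \<open>2 ^ j\<close> times the conditional probability, whose average the density bound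
          controls.\<close>
        also have "\<dots> \<le> (\<Sum>\<rho><3 ^ N. (2 ^ j * pr (n + c) N (rlnum N \<rho>)) * wt a b N \<rho>)"
        proof (intro sum_mono mult_right_mono wt_nonneg valid)
          fix \<rho>
          show "of_bool (big n N \<rho>) \<le> 2 ^ j * pr (n + c) N (rlnum N \<rho>)"
            unfolding big_def using pr_nn[of "n + c" "rlnum N \<rho>"] by (auto simp: field_simps)
        qed
        also have "\<dots> = (\<Sum>\<rho><3 ^ N. \<Sum>u<3 ^ N. \<Sum>v<3 ^ N. 2 ^ j * (of_bool (ev lo E (n + c) N u v) *
            (wt a b N \<rho> * kap N (rlnum N \<rho>) u v)))"
          unfolding pr_def sum_distrib_left sum_distrib_right by (intro sum.cong refl) simp
        also have "\<dots> = (\<Sum>u<3 ^ N. \<Sum>v<3 ^ N. \<Sum>\<rho><3 ^ N. 2 ^ j * (of_bool (ev lo E (n + c) N u v) *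
            (wt a b N \<rho> * kap N (rlnum N \<rho>) u v)))"
          by (rule trans[OF sum.swap], rule sum.cong[OF refl], rule sum.swap)
        also have "\<dots> = 2 ^ j * (\<Sum>u<3 ^ N. \<Sum>v<3 ^ N. of_bool (ev lo E (n + c) N u v) *
            (\<Sum>\<rho><3 ^ N. wt a b N \<rho> * kap N (rlnum N \<rho>) u v))"
          unfolding sum_distrib_left ..
        also have "\<dots> \<le> 2 ^ j * (\<Sum>u<3 ^ N. \<Sum>v<3 ^ N. of_bool (ev lo E (n + c) N u v) *
            (C * (wt p q N u * wt r s N v)))"
          by (intro mult_left_mono sum_mono bound) auto
        also have "\<dots> = 2 ^ j * (C * (\<Sum>u<3 ^ N. \<Sum>v<3 ^ N. of_bool (ev lo E (n + c) N u v) *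
            (wt p q N u * wt r s N v)))"
          unfolding sum_distrib_left by (intro sum.cong refl) simp
        also have "\<dots> \<le> 2 ^ j * (C * (2 / 2 ^ (n + c)))"
          by (intro mult_left_mono ev_bound2 valid lo C) auto
        also have "\<dots> = 2 ^ j * C * 2 / 2 ^ c / 2 ^ n" by (simp add: power_add field_simps)
        also have "\<dots> \<le> 1 / 2 ^ n" using c by (intro divide_right_mono) (auto simp: field_simps)
        finally show ?thesis .
      qed
      have "(\<lambda>N. measure (bernoulli a b) {y. big n N (pre N y)}) \<longlonglongrightarrow>
          measure (bernoulli a b) (\<Union>N. {y. big n N (pre N y)})"
        by (rule B.finite_Lim_measure_incseq[OF _ inc]) (use sets in blast)
      then show "measure (bernoulli a b) (\<Union>\<sigma>\<in>W n. cylinder \<sigma>) \<le> 1 / 2 ^ n"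
        unfolding UW by (rule LIMSEQ_le_const2) (use le in blast)
    next
      define X where "X n N l K = (\<Sum>u<3 ^ N. \<Sum>v<3 ^ N. of_bool (ev lo E n N u v) * LW (enc K (enc N (enc l (enc u v)))))" for n N l K
      have X: "real (X n N l K) / (2 ^ K) ^ N = (\<Sum>u<3 ^ N. \<Sum>v<3 ^ N. of_bool (ev lo E n N u v) *
          (real (LW (enc K (enc N (enc l (enc u v))))) / (2 ^ K) ^ N))" for n N l K
        unfolding X_def of_nat_sum sum_divide_distrib by (intro sum.cong refl) simp
      \<comment> \<open>Exceeding the threshold is witnessed by a lower approximation of some
        precision \<open>K\<close>, which makes the new test enumerable.\<close>
      have big_iff: "big n N \<rho> \<longleftrightarrow> (\<exists>K. (2 ^ K) ^ N < 2 ^ j * X (n + c) N (rlnum N \<rho>) K)" for n N \<rho>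
      proof -
        let ?X = "\<lambda>K. real (X (n + c) N (rlnum N \<rho>) K) / (2 ^ K) ^ N"
        have up: "?X K \<le> pr (n + c) N (rlnum N \<rho>)" for K
          unfolding X pr_def by (intro sum_mono mult_left_mono LW(2)) auto
        have lim: "?X \<longlonglongrightarrow> pr (n + c) N (rlnum N \<rho>)"
          unfolding X pr_def by (intro tendsto_intros LW(3))
        have "big n N \<rho> \<longleftrightarrow> (\<exists>K. 1 / 2 ^ j < ?X K)"
        proof
          assume "big n N \<rho>"
          then have "\<forall>\<^sub>F K in sequentially. 1 / 2 ^ j < ?X K"
            unfolding big_def by (intro order_tendstoD[OF lim])
          from eventually_happens'[OF sequentially_bot this] show "\<exists>K. 1 / 2 ^ j < ?X K" .
        next
          assume "\<exists>K. 1 / 2 ^ j < ?X K"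
          then show "big n N \<rho>" unfolding big_def using up less_le_trans by blast
        qed
        moreover have "1 / 2 ^ j < ?X K \<longleftrightarrow> (2 ^ K) ^ N < 2 ^ j * X (n + c) N (rlnum N \<rho>) K" for K
        proof -
          have "1 / 2 ^ j < ?X K \<longleftrightarrow> real ((2 ^ K) ^ N) < real (2 ^ j * X (n + c) N (rlnum N \<rho>) K)"
            by (simp add: field_simps)
          then show ?thesis unfolding of_nat_less_iff .
        qed
        ultimately show ?thesis by blast
      qed
      let ?P = "\<lambda>m w. psnd m = conv (pfst w) (pfst (psnd w)) \<and> pfst (psnd w) < 3 ^ pfst w \<and>
          (2 ^ psnd (psnd w)) ^ pfst w <
            2 ^ j * X (pfst m + c) (pfst w) (rlnum (pfst w) (pfst (psnd w))) (psnd (psnd w))"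
      have "{enc n (str_code \<sigma>) | n \<sigma>. \<sigma> \<in> W n} = {m. \<exists>w. ?P m w}"
      proof (intro set_eqI iffI)
        fix m assume "m \<in> {enc n (str_code \<sigma>) | n \<sigma>. \<sigma> \<in> W n}"
        then obtain n N \<rho> K where m: "m = enc n (conv N \<rho>)" "\<rho> < 3 ^ N"
          "(2 ^ K) ^ N < 2 ^ j * X (n + c) N (rlnum N \<rho>) K"
          unfolding W_def big_iff conv_eq by blast
        have "?P m (enc N (enc \<rho> K))" using m by simp
        then show "m \<in> {m. \<exists>w. ?P m w}" by blast
      next
        fix m assume "m \<in> {m. \<exists>w. ?P m w}"
        then obtain w where w: "?P m w" by blast
        then have "strg (pfst w) (pfst (psnd w)) \<in> W (pfst m)"
          unfolding W_def big_iff by blast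
        moreover have "m = enc (pfst m) (str_code (strg (pfst w) (pfst (psnd w))))"
          using w by (simp flip: conv_eq) (metis prod.collapse prod_decode_inverse)
        ultimately show "m \<in> {enc n (str_code \<sigma>) | n \<sigma>. \<sigma> \<in> W n}" by blast
      qed
      moreover have "comp_enumerable {} {m. \<exists>w. ?P m w}"
      proof (rule comp_enumerable_Ex)
        have Xc: "cf (\<lambda>e. X (f1 e) (f2 e) (f3 e) (f4 e))" if "cf f1" "cf f2" "cf f3" "cf f4" for f1 f2 f3 f4
        proof -
          have "cf (\<lambda>e. X (pfst e) (pfst (psnd e)) (pfst (psnd (psnd e))) (psnd (psnd (psnd e))))"
            using lo unfolding X_def lower_weights_def
            by (intro cf_intros cf_comp[OF LW(1)] E) auto
          from cf_comp[OF this cf_enc[OF that(1) cf_enc[OF that(2) cf_enc[OF that(3,4)]]]]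
          show ?thesis by simp
        qed
        show "decidable (\<lambda>n. ?P (pfst n) (psnd n))"
          by (intro cf_intros Xc)
      qed
      ultimately show "comp_enumerable {} {enc n (str_code \<sigma>) | n \<sigma>. \<sigma> \<in> W n}" by simp
    qed
    then obtain n where "x \<notin> (\<Union>\<sigma>\<in>W n. cylinder \<sigma>)"
      using rand unfolding ml_random_def by blast
    then have "\<forall>N. measure \<Lambda> (EV (n + c) N x) \<le> 1 / 2 ^ j"
      unfolding UW by (auto simp: big_pre not_less)
    then show ?thesis ..
  qed
  define Bad where "Bad = (\<Inter>n. \<Union>N. EV n N x)"
  have Bad: "Bad \<in> sets \<Lambda>" unfolding Bad_def using EV(1) by blast
  have "measure \<Lambda> Bad \<le> 1 / 2 ^ j" for j
  proof -
    obtain n where n: "\<And>N. measure \<Lambda> (EV n N x) \<le> 1 / 2 ^ j" using small by blast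
    have "incseq (\<lambda>N. EV n N x)" using EV_mono by (intro monoI)
    then have "(\<lambda>N. measure \<Lambda> (EV n N x)) \<longlonglongrightarrow> measure \<Lambda> (\<Union>N. EV n N x)"
      using EV(1) by (intro \<Lambda>.finite_Lim_measure_incseq) auto
    then have "measure \<Lambda> (\<Union>N. EV n N x) \<le> 1 / 2 ^ j"
      by (rule LIMSEQ_le_const2) (use n in blast)
    moreover have "measure \<Lambda> Bad \<le> measure \<Lambda> (\<Union>N. EV n N x)"
      unfolding Bad_def using EV(1) by (intro \<Lambda>.finite_measure_mono) auto
    ultimately show ?thesis by linarith
  qed
  moreover have "(\<lambda>j. 1 / 2 ^ j :: real) \<longlonglongrightarrow> 0"
    using LIMSEQ_realpow_zero[of "1 / 2 :: real"] by (simp add: power_divide)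
  ultimately have "measure \<Lambda> Bad \<le> 0" by (intro LIMSEQ_le_const) auto
  then have "measure \<Lambda> Bad = 0" by (simp add: order_antisym)
  then have "Bad \<in> null_sets \<Lambda>" using Bad by (simp add: null_sets_def \<Lambda>.emeasure_eq_measure)
  then have "AE \<omega> in \<Lambda>. \<omega> \<notin> Bad" by (rule AE_not_in)
  moreover have "AE \<omega> in \<Lambda>. \<omega> \<in> space \<Lambda>" by simp
  ultimately show ?thesis
    by eventually_elim (auto simp: Bad_def EV_def)
qed


section \<open>The coupling\<close>

text \<open>
  A node of the tree of \<open>R\<close> with label \<open>l\<close> is in mode \<open>MR l\<close>; a node that belongs to the trees of
  both \<open>P\<close> and \<open>Q\<close> but not to that of \<open>R\<close> is in mode \<open>ME\<close>, and its common subtree has to become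
  extinct; all other nodes are in mode \<open>MN\<close>.
\<close>

datatype mode = MR trit | ME | MN

definition mode :: "(nat \<Rightarrow> trit) \<Rightarrow> (nat \<Rightarrow> trit) \<Rightarrow> (nat \<Rightarrow> trit) \<Rightarrow> nat \<Rightarrow> mode" where
  "mode L A B c = (if tree L c then MR (L c) else if tree A c \<and> tree B c then ME else MN)"

definition sh :: "trit \<times> trit \<Rightarrow> bool \<Rightarrow> bool" where
  "sh ab b \<longleftrightarrow> allows (fst ab) b \<and> allows (snd ab) b"

lemma mode_cong:
  assumes "tree L c = tree L' c" "tree L c \<Longrightarrow> L c = L' c" "\<And>i. i < c \<Longrightarrow> A i = A' i" "\<And>i. i < c \<Longrightarrow> B i = B' i"
  shows "mode L A B c = mode L' A' B' c"
proof (cases "c = 0")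
  case False
  then show ?thesis
    using assms tree_cong_less[of c A A' c] tree_cong_less[of c B B' c] by (simp add: mode_def)
qed (simp add: mode_def)

lemma sum_trit_pair:
  "(\<Sum>ab\<in>UNIV. f ab) = (\<Sum>a\<in>UNIV. \<Sum>b\<in>UNIV. f (a, b :: trit) :: real)" for f :: "trit \<times> trit \<Rightarrow> real"
  unfolding UNIV_Times_UNIV[symmetric] by (subst sum.cartesian_product) simp

lemma finite_trit [simp]: "finite (UNIV :: trit set)"
  by (simp add: UNIV_trit)

lemma finite_trit_pair [simp]: "finite (UNIV :: (trit \<times> trit) set)"
  unfolding UNIV_Times_UNIV[symmetric] by (intro finite_cartesian_product finite_trit)

locale coupling =
  fixes p q r s :: real
  assumes cr_params: "cr p" "cr q" "cr r" "cr s"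
    and valid: "valid p q" "valid r s"
    and supercritical: "p + q + r + s < 1 + p * r + q * s"
begin

text \<open>The probabilities that both, respectively none, of the children of a common node are common.\<close>

definition a2 :: real where "a2 = (1 - p - q) * (1 - r - s)"
definition none :: real where "none = p * s + q * r"

text \<open>The probability that the intersection of two independent random closed sets is empty.\<close>

definition e :: real where "e = none / a2"

definition pR :: real where "pR = p + r - p * r"
definition qR :: real where "qR = q + s - q * s"

lemma params: "0 \<le> p" "0 \<le> q" "p + q \<le> 1" "0 \<le> r" "0 \<le> s" "r + s \<le> 1"
  using valid by (auto simp: valid_def)

lemma none_less: "none < a2"
  using supercritical by (simp add: none_def a2_def algebra_simps)

lemma none_nonneg: "0 \<le> none"
  using params by (simp add: none_def)

lemma a2_pos: "0 < a2"
  using none_less none_nonneg by linarith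

lemma e_bounds: "0 \<le> e" "e < 1"
  using none_less none_nonneg a2_pos by (auto simp: e_def)

lemma a2_e: "a2 * e = none"
  using a2_pos by (simp add: e_def)

lemma validR: "valid pR qR"
proof -
  have "0 \<le> p * (1 - r)" "0 \<le> q * (1 - s)"
    using params by (auto intro!: mult_nonneg_nonneg)
  then show ?thesis
    using params supercritical by (auto simp: valid_def pR_def qR_def algebra_simps)
qed

definition ww :: "trit \<times> trit \<Rightarrow> real" where
  "ww ab = trit_weight p q (fst ab) * trit_weight r s (snd ab)"

lemma ww_nonneg: "0 \<le> ww ab"
  unfolding ww_def by (intro mult_nonneg_nonneg trit_weight_nonneg valid)

text \<open>\<open>hB\<close> and \<open>hE\<close> are the probabilities that the common subtree at
  a node is infinite, respectively finite; at a node that is not common these are 0 and 1.\<close>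

definition hB :: "bool \<Rightarrow> real" where "hB shared = (if shared then 1 - e else 0)"
definition hE :: "bool \<Rightarrow> real" where "hE shared = (if shared then e else 1)"

lemma h_nonneg: "0 \<le> hB b" "0 \<le> hE b"
  using e_bounds by (auto simp: hB_def hE_def)

lemma h_sum: "hB b + hE b = 1"
  by (simp add: hB_def hE_def)

text \<open>
  The conditional distributions of the pair of labels, given survival of the root: the weight of
  the pair times the probability of the required fate of the children, normalized.
\<close>

primrec num :: "mode \<Rightarrow> trit \<times> trit \<Rightarrow> real" where
  "num (MR l) ab = ww ab * (if allows l False then hB (sh ab False) else hE (sh ab False)) *
     (if allows l True then hB (sh ab True) else hE (sh ab True))"
| "num ME ab = ww ab * hE (sh ab False) * hE (sh ab True)"
| "num MN ab = ww ab"

primrec nrm :: "mode \<Rightarrow> real" where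
  "nrm (MR l) = (1 - e) * trit_weight pR qR l"
| "nrm ME = e"
| "nrm MN = 1"

text \<open>Labels for modes of normalizing weight 0. The pair \<open>(l, l)\<close> keeps the
  children in \<open>R\<close> common, and \<open>(T0, T1)\<close> leaves no common child, so the
  inclusion and extinction arguments cover these cases too.\<close>

primrec dflt :: "mode \<Rightarrow> trit \<times> trit" where
  "dflt (MR l) = (l, l)"
| "dflt ME = (T0, T1)"
| "dflt MN = (T0, T1)"

definition md :: "mode \<Rightarrow> trit \<times> trit \<Rightarrow> real" where
  "md m ab = (if nrm m = 0 then of_bool (ab = dflt m) else num m ab / nrm m)"

lemma num_nonneg: "0 \<le> num m ab"
  using ww_nonneg h_nonneg by (cases m) auto

lemma nrm_nonneg: "0 \<le> nrm m"
  using e_bounds trit_weight_nonneg[OF validR] by (cases m) auto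

lemma md_nonneg: "0 \<le> md m ab"
  unfolding md_def using num_nonneg nrm_nonneg by auto

lemma nrm_md_le: "nrm m * md m ab \<le> num m ab"
  unfolding md_def using num_nonneg by auto

lemmas expand_pairs = sum_trit_pair sum_trit ww_def sh_def allows_def hB_def hE_def

text \<open>Here the parameters of \<open>R\<close> arise. For label \<open>T0\<close>, either only
  the left child is common, or both are and the right subtree dies out; the latter contributes
  \<open>a2 * e = none\<close>, and the total is \<open>pR\<close> times the survival factor
  \<open>1 - e\<close>. \<open>T1\<close> is symmetric, and \<open>T2\<close> leaves
  \<open>a2 - none\<close>. For \<open>ME\<close> this is the fixed-point equation of
  \<open>e\<close>.\<close>

lemma sum_num: "(\<Sum>ab\<in>UNIV. num m ab) = nrm m"
proof (cases m)
  case (MR l)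
  have a: "(1 - p - q) * (1 - r - s) * e = p * s + q * r"
    using a2_e unfolding a2_def none_def .
  show ?thesis
  proof (cases l)
    case T0
    have "(\<Sum>ab\<in>UNIV. num m ab) = (1 - e) * (p * r + p * (1 - r - s) + (1 - p - q) * r +
        (1 - p - q) * (1 - r - s) * e)"
      unfolding MR T0 by (simp add: expand_pairs) (simp add: algebra_simps)
    then show ?thesis unfolding a MR T0 by (simp add: pR_def algebra_simps)
  next
    case T1
    have "(\<Sum>ab\<in>UNIV. num m ab) = (1 - e) * (q * s + q * (1 - r - s) + (1 - p - q) * s +
        (1 - p - q) * (1 - r - s) * e)"
      unfolding MR T1 by (simp add: expand_pairs) (simp add: algebra_simps)
    then show ?thesis unfolding a MR T1 by (simp add: qR_def algebra_simps)
  next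
    case T2
    have "(\<Sum>ab\<in>UNIV. num m ab) = (1 - e) * ((1 - p - q) * (1 - r - s) - (1 - p - q) * (1 - r - s) * e)"
      unfolding MR T2 by (simp add: expand_pairs) (simp add: algebra_simps)
    then show ?thesis unfolding a MR T2 by (simp add: pR_def qR_def algebra_simps)
  qed
next
  case ME
  have "(\<Sum>ab\<in>UNIV. num m ab) = none + (1 - none - a2) * e + a2 * e * e"
    unfolding ME none_def a2_def by (simp add: expand_pairs) (simp add: algebra_simps)
  also have "\<dots> = none + e - a2 * e" unfolding a2_e by (simp add: algebra_simps a2_e)
  finally show ?thesis using ME by (simp add: a2_e)
next
  case MN
  then show ?thesis by (simp add: expand_pairs algebra_simps)
qed

lemma sum_md: "(\<Sum>ab\<in>UNIV. md m ab) = 1"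
  unfolding md_def using sum_num[of m]
  by (cases "nrm m = 0") (simp_all flip: sum_divide_distrib add: of_bool_def)

definition M :: "mode \<Rightarrow> (trit \<times> trit) pmf" where
  "M m = embed_pmf (md m)"

lemma pmf_M: "pmf (M m) ab = md m ab"
  unfolding M_def
proof (rule pmf_embed_pmf)
  have "(\<integral>\<^sup>+x. ennreal (md m x) \<partial>count_space UNIV) = (\<Sum>x\<in>UNIV. ennreal (md m x))"
    by (rule nn_integral_count_space_finite) simp
  also have "\<dots> = ennreal (\<Sum>x\<in>UNIV. md m x)" by (simp add: md_nonneg sum_ennreal)
  finally show "(\<integral>\<^sup>+x. ennreal (md m x) \<partial>count_space UNIV) = 1" by (simp add: sum_md)
qed (rule md_nonneg)

definition kapF :: "(nat \<Rightarrow> trit) \<Rightarrow> (nat \<Rightarrow> trit) \<Rightarrow> (nat \<Rightarrow> trit) \<Rightarrow> nat \<Rightarrow> real" where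
  "kapF L A B N = (\<Prod>i<N. md (mode L A B i) (A i, B i))"

definition kap :: "nat \<Rightarrow> nat \<Rightarrow> nat \<Rightarrow> nat \<Rightarrow> real" where
  "kap N l u v = kapF (fld l) (fld u) (fld v) N"

lemma kap_rl: "kap N (pre N (rl x)) u v = kapF (rl x) (fld u) (fld v) N"
  unfolding kap_def kapF_def
proof (intro prod.cong refl arg_cong2[where f = md] mode_cong)
  fix i assume "i \<in> {..<N}"
  then show "tree (fld (pre N (rl x))) i = tree (rl x) i" "fld (pre N (rl x)) i = rl x i"
    using tree_cong_less[of N "fld (pre N (rl x))" "rl x" i] by (auto simp: fld_pre)
qed

subsection \<open>The density bound\<close>

definition hT :: "(nat \<Rightarrow> trit) \<Rightarrow> (nat \<Rightarrow> trit) \<Rightarrow> (nat \<Rightarrow> trit) \<Rightarrow> nat \<Rightarrow> real" where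
  "hT L A B i = (if tree L i then hB (tree A i \<and> tree B i) else hE (tree A i \<and> tree B i))"

lemma hT_nonneg: "0 \<le> hT L A B i"
  unfolding hT_def using h_nonneg by auto

text \<open>In modes \<open>MR\<close>, \<open>ME\<close> and \<open>MN\<close> the left side is
  \<open>nrm\<close> times \<open>md\<close> and the right side is \<open>num\<close>. A node of
  \<open>R\<close> that is not common has \<open>hT\<close> equal to 0.\<close>

lemma hT_step:
  assumes "0 < N"
  shows "hT L A B N * ((if tree L N then trit_weight pR qR (L N) else 1) * md (mode L A B N) (A N, B N))
    \<le> ww (A N, B N) * (hT L A B (2 * N) * hT L A B (2 * N + 1))"
proof -
  have ch: "tree L (2 * N) = (tree L N \<and> allows (L N) False)"
    "tree L (2 * N + 1) = (tree L N \<and> allows (L N) True)" for L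
    using tree_child[OF assms, of L False] tree_child[OF assms, of L True] by auto
  define S where "S \<longleftrightarrow> tree A N \<and> tree B N"
  have sh: "tree A (2 * N) \<and> tree B (2 * N) \<longleftrightarrow> S \<and> sh (A N, B N) False"
    "tree A (2 * N + 1) \<and> tree B (2 * N + 1) \<longleftrightarrow> S \<and> sh (A N, B N) True"
    unfolding ch S_def sh_def fst_conv snd_conv by blast+
  have hT: "hT L A B (2 * N) = (if tree L N \<and> allows (L N) False then hB (S \<and> sh (A N, B N) False) else hE (S \<and> sh (A N, B N) False))"
    "hT L A B (2 * N + 1) = (if tree L N \<and> allows (L N) True then hB (S \<and> sh (A N, B N) True) else hE (S \<and> sh (A N, B N) True))"
    unfolding hT_def sh ch[of L] by (rule refl)+
  consider "tree L N" "S" | "tree L N" "\<not> S" | "\<not> tree L N" "S" | "\<not> tree L N" "\<not> S" by blast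
  then show ?thesis
  proof cases
    case 1
    then have m: "mode L A B N = MR (L N)" "hT L A B N = 1 - e"
      by (auto simp: mode_def hT_def S_def hB_def)
    have n: "ww (A N, B N) * (hT L A B (2 * N) * hT L A B (2 * N + 1)) = num (MR (L N)) (A N, B N)"
      unfolding hT using 1 by simp
    show ?thesis unfolding n m using nrm_md_le[of "MR (L N)" "(A N, B N)"] 1 by (simp add: mult.assoc)
  next
    case 2
    then have "hT L A B N = 0" unfolding hT_def S_def hB_def by auto
    then show ?thesis using ww_nonneg hT_nonneg by simp
  next
    case 3
    then have m: "mode L A B N = ME" "hT L A B N = e"
      by (auto simp: mode_def hT_def S_def hE_def)
    have n: "ww (A N, B N) * (hT L A B (2 * N) * hT L A B (2 * N + 1)) = num ME (A N, B N)"
      unfolding hT using 3 by simp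
    show ?thesis unfolding n m using nrm_md_le[of ME "(A N, B N)"] 3 by (simp add: mult.assoc)
  next
    case 4
    then have m: "mode L A B N = MN" "hT L A B N = 1"
      by (auto simp: mode_def hT_def S_def hE_def)
    have n: "ww (A N, B N) * (hT L A B (2 * N) * hT L A B (2 * N + 1)) = num MN (A N, B N)"
      unfolding hT using 4 by (simp add: hE_def)
    show ?thesis unfolding n m using nrm_md_le[of MN "(A N, B N)"] 4 by (simp add: mult.assoc)
  qed
qed

lemma kapF_nonneg: "0 \<le> kapF L A B N"
  unfolding kapF_def by (intro prod_nonneg ballI md_nonneg)

text \<open>
  Telescoping: the factor \<open>h\<close> of a processed node cancels against that of the same node as a child,
  so that only the factors of the unprocessed nodes \<open>N, \<dots>, 2 * N - 1\<close> remain.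
\<close>

lemma kapF_bound:
  fixes x :: "nat \<Rightarrow> trit"
  assumes "1 \<le> N"
  defines "L \<equiv> rl x"
  shows "(\<Prod>k<idx L N. trit_weight pR qR (x k)) * kapF L A B N
    \<le> 1 / (1 - e) * (\<Prod>i<N. ww (A i, B i)) * (\<Prod>i\<in>{N..<2 * N}. hT L A B i)"
  using assms(1)
proof (induction N rule: nat_induct_at_least)
  case base
  \<comment> \<open>Heap codes start at 1, so position 0 carries unconditioned labels in mode
    \<open>MN\<close>. The only unprocessed node is the root, whose factor \<open>1 - e\<close>
    cancels the constant.\<close>
  have "nrm MN * md MN (A 0, B 0) \<le> num MN (A 0, B 0)" by (rule nrm_md_le)
  moreover have "hT L A B (Suc 0) = 1 - e" by (simp add: hT_def hB_def)
  moreover have "{1..<2 * 1} = {Suc 0}" by auto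
  ultimately show ?case using e_bounds by (simp add: kapF_def mode_def idx_Suc)
next
  case (Suc N)
  define g where "g = (if tree L N then trit_weight pR qR (L N) else 1) * md (mode L A B N) (A N, B N)"
  define W where "W N = (\<Prod>k<idx L N. trit_weight pR qR (x k))" for N
  define H where "H = (\<Prod>i\<in>{Suc N..<2 * N}. hT L A B i)"
  define V where "V = 1 / (1 - e) * (\<Prod>i<N. ww (A i, B i))"
  have V: "0 \<le> V" unfolding V_def using e_bounds ww_nonneg
    by (intro mult_nonneg_nonneg prod_nonneg) auto
  have H: "0 \<le> H" unfolding H_def by (intro prod_nonneg ballI hT_nonneg)
  have g: "0 \<le> g" unfolding g_def
    by (intro mult_nonneg_nonneg md_nonneg) (use trit_weight_nonneg[OF validR] in auto)
  have x: "x (idx L N) = L N" unfolding L_def using rl[of x N] by simp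
  have "W (Suc N) * kapF L A B (Suc N) = (W N * kapF L A B N) * g"
    unfolding W_def kapF_def g_def by (simp add: idx_Suc x)
  also have "\<dots> \<le> (V * (hT L A B N * H)) * g"
  proof (rule mult_right_mono[OF _ g])
    have "(\<Prod>i\<in>{N..<2 * N}. hT L A B i) = hT L A B N * H"
      unfolding H_def using Suc.hyps by (simp add: prod.atLeast_Suc_lessThan)
    then show "W N * kapF L A B N \<le> V * (hT L A B N * H)"
      using Suc.IH unfolding W_def V_def by simp
  qed
  also have "\<dots> = V * H * (hT L A B N * g)" by simp
  also have "\<dots> \<le> V * H * (ww (A N, B N) * (hT L A B (2 * N) * hT L A B (2 * N + 1)))"
    unfolding g_def using V H Suc.hyps by (intro mult_left_mono hT_step mult_nonneg_nonneg) auto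
  also have "\<dots> = 1 / (1 - e) * (\<Prod>i<Suc N. ww (A i, B i)) * (\<Prod>i\<in>{Suc N..<2 * Suc N}. hT L A B i)"
  proof -
    have "{Suc N..<2 * Suc N} = insert (2 * N) (insert (2 * N + 1) {Suc N..<2 * N})"
      using Suc.hyps by auto
    then have prod: "(\<Prod>i\<in>{Suc N..<2 * Suc N}. hT L A B i) = hT L A B (2 * N) * (hT L A B (2 * N + 1) * H)"
      unfolding H_def by simp
    show ?thesis unfolding V_def prod by simp
  qed
  finally show ?case unfolding W_def .
qed

text \<open>The shape of the tree on the nodes below \<open>N\<close> and all their
  children.\<close>

definition TT :: "nat \<Rightarrow> nat \<Rightarrow> nat set" where
  "TT N \<rho> = {i. i < 2 * N \<and> tree (rl (fld \<rho>)) i}"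

lemma tree_branching: "0 < i \<Longrightarrow> tree L i \<longleftrightarrow> tree L (2 * i) \<or> tree L (2 * i + 1)"
  using tree_child[of i L False] tree_child[of i L True] ex_allows[of "L i"]
  by (auto simp: all_bool_eq ex_bool_eq)

text \<open>The tree has no dead ends: a node belongs to it iff one of its children does. The shape
  is therefore recovered from the boundary by induction towards the root.\<close>

lemma TT_inj:
  assumes "TT N \<rho> \<inter> {N..<2 * N} = TT N \<sigma> \<inter> {N..<2 * N}"
  shows "TT N \<rho> = TT N \<sigma>"
proof -
  have "tree (rl (fld \<rho>)) i = tree (rl (fld \<sigma>)) i" if "i < 2 * N" for i
    using that
  proof (induction "2 * N - i" arbitrary: i rule: less_induct)
    case less
    show ?case
    proof (cases "N \<le> i")
      case True
      moreover have "i \<in> TT N \<rho> \<inter> {N..<2 * N} \<longleftrightarrow> i \<in> TT N \<sigma> \<inter> {N..<2 * N}"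
        unfolding assms ..
      ultimately show ?thesis using less.prems unfolding TT_def by simp
    next
      case False
      show ?thesis
      proof (cases "i = 0")
        case i: False
        have "tree (rl (fld \<rho>)) (2 * i) = tree (rl (fld \<sigma>)) (2 * i)"
          using False i by (intro less.hyps) auto
        moreover have "tree (rl (fld \<rho>)) (2 * i + 1) = tree (rl (fld \<sigma>)) (2 * i + 1)"
          using False i by (intro less.hyps) auto
        ultimately show ?thesis
          using i tree_branching[of i "rl (fld \<rho>)"] tree_branching[of i "rl (fld \<sigma>)"] by blast
      qed simp
    qed
  qed
  then show ?thesis unfolding TT_def by auto
qed

lemma idx_surj: "k < idx L N \<Longrightarrow> \<exists>i<N. tree L i \<and> idx L i = k"
proof (induction N)
  case (Suc N)
  show ?case
  proof (cases "k < idx L N")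
    case True
    then show ?thesis using Suc.IH less_SucI by blast
  next
    case False
    then have "tree L N" "idx L N = k" using Suc.prems by (cases "tree L N"; simp add: idx_Suc)+
    then show ?thesis by blast
  qed
qed simp

text \<open>The label of a tree node below \<open>N\<close> can be read off from which children are
  present, so the shape determines the corresponding entries of the code.\<close>

lemma TT_prefix:
  assumes "TT N \<rho> = TT N \<sigma>"
  shows "pre (idx (rl (fld \<sigma>)) N) (fld \<rho>) = pre (idx (rl (fld \<sigma>)) N) (fld \<sigma>)"
proof (rule pre_cong)
  let ?L = "rl (fld \<rho>)" and ?L' = "rl (fld \<sigma>)"
  have tr: "tree ?L i = tree ?L' i" if "i < 2 * N" for i
    using assms that unfolding TT_def by auto
  fix k assume "k < idx ?L' N"
  then obtain i where i: "i < N" "tree ?L' i" "idx ?L' i = k" using idx_surj by blast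
  have "?L i = ?L' i"
  proof (rule allows_eq)
    fix b
    have "0 < i" using i(2) tree_pos by blast
    then show "allows (?L i) b = allows (?L' i) b"
      using tr[of i] tr[of "2 * i + of_bool b"] tree_child[of i ?L b] tree_child[of i ?L' b] i by auto
  qed
  moreover have "idx ?L i = idx ?L' i"
    unfolding idx_def using tr i(1) by (intro arg_cong[where f = card]) auto
  ultimately show "fld \<rho> k = fld \<sigma> k" using rl[of "fld \<rho>" i] rl[of "fld \<sigma>" i] i(3) by simp
qed

lemma sum_wt_prefix:
  assumes "m \<le> N"
  shows "(\<Sum>\<rho><3 ^ N. of_bool (pre m (fld \<rho>) = pre m x) * wt pR qR N \<rho>) =
    (\<Prod>k<m. trit_weight pR qR (x k))"
proof -
  have "(\<Sum>\<rho><3 ^ N. of_bool (pre m (fld \<rho>) = pre m x) * wt pR qR N \<rho>) =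
      measure (bernoulli pR qR) {y. pre m (fld (pre N y)) = pre m x}"
    by (rule bernoulli_pre(2)[OF validR, symmetric])
  also have "{y. pre m (fld (pre N y)) = pre m x} = {y. pre m y = pre m x}"
    unfolding pre_eq_iff using assms by (auto simp: fld_pre)
  also have "measure (bernoulli pR qR) \<dots> = wt pR qR m (pre m x)"
    by (intro measure_bernoulli_pre_eq validR pre_less)
  also have "\<dots> = (\<Prod>k<m. trit_weight pR qR (x k))"
    unfolding wt_def by (intro prod.cong) (auto simp: fld_pre)
  finally show ?thesis .
qed

text \<open>The codes \<open>\<rho>\<close> are grouped by the shape of their tree. A fibre
  contributes at most \<open>V\<close> times the product of the factors of its boundary nodes.
  Distinct shapes have distinct boundary sets, and over all subsets of the boundary these products
  add up to the expansion of a product of factors \<open>hB + hE = 1\<close>.\<close>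

lemma density_bound:
  assumes "u < 3 ^ N" "v < 3 ^ N"
  shows "(\<Sum>\<rho><3 ^ N. wt pR qR N \<rho> * kap N (rlnum N \<rho>) u v) \<le> 1 / (1 - e) * (wt p q N u * wt r s N v)"
proof (cases "N = 0")
  case True
  then show ?thesis using e_bounds by (simp add: wt_def kap_def kapF_def)
next
  case False
  then have N: "1 \<le> N" by simp
  define A B where "A = fld u" and "B = fld v"
  define K where "K \<rho> = kapF (rl (fld \<rho>)) A B N" for \<rho>
  define V where "V = 1 / (1 - e) * (\<Prod>i<N. ww (A i, B i))"
  have V: "V = 1 / (1 - e) * (wt p q N u * wt r s N v)"
    unfolding V_def wt_def A_def B_def ww_def by (simp add: prod.distrib)
  have V_nn: "0 \<le> V" unfolding V using e_bounds wt_nonneg valid by auto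
  define f where "f X i = (if i \<in> X then hB (tree A i \<and> tree B i) else hE (tree A i \<and> tree B i))" for X :: "nat set" and i
  have f_nn: "0 \<le> f X i" for X i unfolding f_def using h_nonneg by auto
  let ?bd = "{N..<2 * N}"
  have fiber: "(\<Sum>\<rho>\<in>{\<rho>\<in>{..<3 ^ N}. TT N \<rho> = T}. wt pR qR N \<rho> * K \<rho>) \<le> V * (\<Prod>i\<in>?bd. f (T \<inter> ?bd) i)"
    if T: "T \<in> TT N ` {..<3 ^ N}" for T
  proof -
    let ?F = "{\<rho>\<in>{..<3 ^ N}. TT N \<rho> = T}"
    have fin: "finite ?F" and ne: "?F \<noteq> {}" using T by auto
    have "Max (K ` ?F) \<in> K ` ?F" using fin ne by (intro Max_in) auto
    \<comment> \<open>Bounding the fibre by its largest conditional weight leaves a single tree for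
      \<open>kapF_bound\<close>. All members share the code prefix of \<open>\<sigma>\<close>, so
      their total weight is at most that of this prefix.\<close>
    then obtain \<sigma> where \<sigma>': "\<sigma> \<in> ?F" "Max (K ` ?F) = K \<sigma>" by blast
    have \<sigma>: "\<sigma> \<in> ?F" "\<And>\<rho>. \<rho> \<in> ?F \<Longrightarrow> K \<rho> \<le> K \<sigma>"
      using \<sigma>'(1) Max_ge[of "K ` ?F", unfolded \<sigma>'(2)] fin by blast+
    let ?L = "rl (fld \<sigma>)"
    let ?m = "idx ?L N"
    have "(\<Sum>\<rho>\<in>?F. wt pR qR N \<rho> * K \<rho>) \<le> (\<Sum>\<rho>\<in>?F. wt pR qR N \<rho> * K \<sigma>)"
      by (intro sum_mono mult_left_mono \<sigma>(2) wt_nonneg validR) auto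
    also have "\<dots> = (\<Sum>\<rho>\<in>?F. wt pR qR N \<rho>) * K \<sigma>" by (simp add: sum_distrib_right)
    also have "\<dots> \<le> (\<Sum>\<rho><3 ^ N. of_bool (pre ?m (fld \<rho>) = pre ?m (fld \<sigma>)) * wt pR qR N \<rho>) * K \<sigma>"
    proof (rule mult_right_mono)
      have "(\<Sum>\<rho>\<in>?F. wt pR qR N \<rho>) = (\<Sum>\<rho>\<in>?F. of_bool (pre ?m (fld \<rho>) = pre ?m (fld \<sigma>)) * wt pR qR N \<rho>)"
      proof (rule sum.cong[OF refl])
        fix \<rho> assume "\<rho> \<in> ?F"
        then have "TT N \<rho> = TT N \<sigma>" using \<sigma>(1) by simp
        from TT_prefix[OF this]
        show "wt pR qR N \<rho> = of_bool (pre ?m (fld \<rho>) = pre ?m (fld \<sigma>)) * wt pR qR N \<rho>" by simp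
      qed
      also have "\<dots> \<le> (\<Sum>\<rho><3 ^ N. of_bool (pre ?m (fld \<rho>) = pre ?m (fld \<sigma>)) * wt pR qR N \<rho>)"
        by (intro sum_mono2 mult_nonneg_nonneg wt_nonneg validR) auto
      finally show "(\<Sum>\<rho>\<in>?F. wt pR qR N \<rho>) \<le> \<dots>" .
      show "0 \<le> K \<sigma>" unfolding K_def by (rule kapF_nonneg)
    qed
    also have "\<dots> = (\<Prod>k<?m. trit_weight pR qR (fld \<sigma> k)) * kapF ?L A B N"
      unfolding K_def by (subst sum_wt_prefix) (auto intro: idx_le)
    also have "\<dots> \<le> V * (\<Prod>i\<in>?bd. hT ?L A B i)"
      unfolding V_def by (rule kapF_bound[OF N])
    also have "(\<Prod>i\<in>?bd. hT ?L A B i) = (\<Prod>i\<in>?bd. f (T \<inter> ?bd) i)"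
    proof (rule prod.cong[OF refl])
      fix i assume "i \<in> ?bd"
      then have "i \<in> T \<inter> ?bd \<longleftrightarrow> tree ?L i" using \<sigma>(1) unfolding TT_def by auto
      then show "hT ?L A B i = f (T \<inter> ?bd) i" unfolding f_def hT_def by simp
    qed
    finally show ?thesis .
  qed
  have "(\<Sum>\<rho><3 ^ N. wt pR qR N \<rho> * kap N (rlnum N \<rho>) u v) = (\<Sum>\<rho><3 ^ N. wt pR qR N \<rho> * K \<rho>)"
  proof (intro sum.cong refl arg_cong2[where f = "(*)"])
    fix \<rho> :: nat assume "\<rho> \<in> {..<3 ^ N}"
    then have "rlnum N \<rho> = pre N (rl (fld \<rho>))" using rlnum_pre[of N "fld \<rho>"] by (simp add: pre_fld)
    then show "kap N (rlnum N \<rho>) u v = K \<rho>" by (simp add: kap_rl K_def A_def B_def)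
  qed
  also have "\<dots> = (\<Sum>T\<in>TT N ` {..<3 ^ N}. \<Sum>\<rho>\<in>{\<rho>\<in>{..<3 ^ N}. TT N \<rho> = T}. wt pR qR N \<rho> * K \<rho>)"
    by (rule sum.image_gen) simp
  also have "\<dots> \<le> (\<Sum>T\<in>TT N ` {..<3 ^ N}. V * (\<Prod>i\<in>?bd. f (T \<inter> ?bd) i))"
    by (rule sum_mono) (rule fiber)
  also have "\<dots> = V * (\<Sum>X\<in>(\<lambda>T. T \<inter> ?bd) ` TT N ` {..<3 ^ N}. \<Prod>i\<in>?bd. f X i)"
  proof -
    have "inj_on (\<lambda>T. T \<inter> ?bd) (TT N ` {..<3 ^ N})"
      using TT_inj by (auto simp: inj_on_def)
    then show ?thesis by (simp add: sum.reindex sum_distrib_left)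
  qed
  also have "\<dots> \<le> V * (\<Sum>X\<in>Pow ?bd. \<Prod>i\<in>?bd. f X i)"
    by (intro mult_left_mono sum_mono2 prod_nonneg V_nn ballI f_nn) auto
  also have "(\<Sum>X\<in>Pow ?bd. \<Prod>i\<in>?bd. f X i) = 1"
  proof -
    have "(\<Prod>i\<in>?bd. f X i) = (\<Prod>i\<in>X. hB (tree A i \<and> tree B i)) * (\<Prod>i\<in>?bd - X. hE (tree A i \<and> tree B i))"
      if "X \<in> Pow ?bd" for X
    proof -
      have "(\<Prod>i\<in>?bd. f X i) = (\<Prod>i\<in>?bd - X. f X i) * (\<Prod>i\<in>X. f X i)"
        using that by (intro prod.subset_diff) auto
      then show ?thesis by (simp add: f_def mult.commute cong: prod.cong_simp)
    qed
    then have "(\<Sum>X\<in>Pow ?bd. \<Prod>i\<in>?bd. f X i) =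
        (\<Prod>i\<in>?bd. hB (tree A i \<and> tree B i) + hE (tree A i \<and> tree B i))"
      by (subst prod_add) auto
    then show ?thesis by (simp add: h_sum)
  qed
  finally show ?thesis by (simp add: V)
qed

end


section \<open>Computable weights, descending paths and numerical codes of modes\<close>

lemma cr_trit_weight:
  assumes "cr p" "cr q" "valid p q"
  shows "cr (trit_weight p q t)"
proof (cases t)
  case T2
  have "cr (1 - p - q)"
    by (intro cr_diff cr_1 assms) (use assms(3) in \<open>auto simp: valid_def\<close>)
  then show ?thesis using T2 by simp
qed (use assms in auto)

text \<open>The heap code of the node reached from \<open>c\<close> along the first \<open>n\<close>
  bits of \<open>X\<close>.\<close>

primrec nd :: "nat \<Rightarrow> (nat \<Rightarrow> bool) \<Rightarrow> nat \<Rightarrow> nat" where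
  "nd c X 0 = c"
| "nd c X (Suc n) = 2 * nd c X n + of_bool (X n)"

lemma nd_cong: "(\<And>i. i < n \<Longrightarrow> X i = Y i) \<Longrightarrow> nd c X n = nd c Y n"
  by (induction n) auto

lemma nd_pos: "0 < c \<Longrightarrow> 0 < nd c X n"
  by (induction n) auto

lemma strict_mono_nd: "0 < c \<Longrightarrow> strict_mono (nd c X)"
  using nd_pos[of c X] by (intro strict_mono_Suc_iff[THEN iffD2] allI) (simp add: trans_less_add1)

lemma nd_hc: "nd (hc (map X [0..<n])) (\<lambda>i. X (n + i)) m = hc (map X [0..<n + m])"
  by (induction m) auto

lemma sum_lists_prod:
  "(\<Sum>bs | length bs = n. \<Prod>i<n. v (bs ! i)) = (v False + v True :: real) ^ n"
proof (induction n)
  case (Suc n)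
  have fin: "finite {bs :: bool list. length bs = n}"
    using finite_lists_length_eq[of "UNIV :: bool set" n] by simp
  have eq: "{bs :: bool list. length bs = Suc n} = (\<Union>b\<in>UNIV. (#) b ` {bs. length bs = n})"
    by (auto simp: length_Suc_conv)
  have "(\<Sum>bs | length bs = Suc n. \<Prod>i<Suc n. v (bs ! i)) =
      (\<Sum>b\<in>UNIV. \<Sum>bs\<in>(#) b ` {bs. length bs = n}. \<Prod>i<Suc n. v (bs ! i))"
    unfolding eq using fin by (intro sum.UNION_disjoint) auto
  also have "\<dots> = (\<Sum>b\<in>UNIV. \<Sum>bs | length bs = n. v b * (\<Prod>i<n. v (bs ! i)))"
    by (simp add: sum.reindex prod.lessThan_Suc_shift del: prod.lessThan_Suc)
  also have "\<dots> = (v False + v True) * (v False + v True) ^ n"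
    unfolding sum_distrib_left[symmetric] Suc.IH by (simp add: UNIV_bool distrib_right)
  finally show ?case by simp
qed simp

definition mode_of :: "nat \<Rightarrow> mode" where
  "mode_of n = (if n < 3 then MR (nat_trit n) else if n = 3 then ME else MN)"

definition mode_code :: "nat \<Rightarrow> nat \<Rightarrow> nat \<Rightarrow> nat \<Rightarrow> nat" where
  "mode_code l u v i = (if tree (fld l) i then dig l i else
     if tree (fld u) i \<and> tree (fld v) i then 3 else 4)"

lemma mode_of_code: "mode_of (mode_code l u v i) = mode (fld l) (fld u) (fld v) i"
  by (simp add: mode_of_def mode_code_def mode_def fld_def)

lemma mode_code_less: "mode_code l u v i < 5"
  using dig_less[of l i] unfolding mode_code_def by (auto intro: less_trans)

context coupling
begin

subsection \<open>Computability of the conditional distributions\<close>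

lemma cr_e: "cr e" "cr (1 - e)"
proof -
  have "cr none" unfolding none_def by (intro cr_add cr_mult cr_params)
  moreover have "cr a2"
    using cr_mult[OF cr_trit_weight[of p q T2] cr_trit_weight[of r s T2]] cr_params valid
    unfolding a2_def by simp
  ultimately show "cr e" unfolding e_def by (rule cr_divide)
  then show "cr (1 - e)" using e_bounds by (intro cr_diff cr_1) auto
qed

lemma cr_R: "cr pR" "cr qR"
proof -
  have "p * r \<le> p * 1" "q * s \<le> q * 1"
    using params by (intro mult_left_mono; simp)+
  then show "cr pR" "cr qR"
    unfolding pR_def qR_def using params by (intro cr_diff cr_add cr_mult cr_params; simp)+
qed

lemma cr_md: "cr (md m ab)"
proof -
  have h: "cr (hB b)" "cr (hE b)" for b
    unfolding hB_def hE_def using cr_e cr_0 cr_1 by auto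
  have ww: "cr (ww ab)"
    unfolding ww_def using cr_params valid by (intro cr_mult cr_trit_weight)
  have "cr (num m ab)" using ww h by (cases m) (auto intro!: cr_mult)
  moreover have "cr (nrm m)"
    using cr_e cr_1 cr_trit_weight[OF cr_R validR] by (cases m) (auto intro!: cr_mult)
  ultimately show ?thesis unfolding md_def using cr_divide cr_0 cr_1 by (simp add: of_bool_def)
qed

definition LW_spec :: "(nat \<Rightarrow> nat) \<Rightarrow> bool" where
  "LW_spec LW \<longleftrightarrow> cf LW \<and>
     (\<forall>K N l u v. real (LW (enc K (enc N (enc l (enc u v))))) / (2 ^ K) ^ N \<le> kap N l u v) \<and>
     (\<forall>N l u v. (\<lambda>K. real (LW (enc K (enc N (enc l (enc u v))))) / (2 ^ K) ^ N) \<longlonglongrightarrow> kap N l u v)"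

lemma ex_LW: "\<exists>LW. LW_spec LW"
proof -
  \<comment> \<open>An index below 45 codes one of 5 modes and one of 9 pairs of labels; finitely
    many computable weights thus merge into one computable table.\<close>
  define w where "w i = md (mode_of (i div 9)) (nat_trit (i div 3 mod 3), nat_trit (i mod 3))" for i
  have cr_w: "cr (w i)" for i unfolding w_def by (rule cr_md)
  have "\<forall>i. \<exists>f. cf f \<and> (\<forall>k. real (f k) / 2 ^ k \<le> w i) \<and> (\<lambda>k. real (f k) / 2 ^ k) \<longlonglongrightarrow> w i"
    using cr_lower[OF cr_w] by metis
  then obtain f where f: "cf (f i)" "real (f i k) / 2 ^ k \<le> w i"
    "(\<lambda>k. real (f i k) / 2 ^ k) \<longlonglongrightarrow> w i" for i k
    by metis
  define lw where "lw c = (if psnd c < 45 then f (psnd c) (pfst c) else 0)" for c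
  have lw: "cf lw" unfolding lw_def
    by (rule cf_choose[of 45 f psnd pfst]) (intro f cf_intros)+
  define ix where "ix l u v i = 9 * mode_code l u v i + (3 * dig u i + dig v i)" for l u v i
  have d: "3 * dig u i + dig v i < 9" for u v i
    using dig_less[of u i] dig_less[of v i] by linarith
  have ix: "ix l u v i < 45" for l u v i
    using d[of u i v] mode_code_less[of l u v i] unfolding ix_def by linarith
  have w_ix: "w (ix l u v i) = md (mode (fld l) (fld u) (fld v) i) (fld u i, fld v i)" for l u v i
  proof -
    have 1: "ix l u v i div 9 = mode_code l u v i"
      using d[of u i v] by (simp add: ix_def)
    define k where "k = 3 * mode_code l u v i + dig u i"
    have "ix l u v i = dig v i + 3 * k" by (simp add: ix_def k_def)
    then have 2: "ix l u v i mod 3 = dig v i" "ix l u v i div 3 = 3 * mode_code l u v i + dig u i"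
      by (simp_all flip: k_def)
    then have 3: "ix l u v i div 3 mod 3 = dig u i" by simp
    show ?thesis unfolding w_def 1 2(1) 3 mode_of_code fld_def ..
  qed
  define LW where "LW c = (\<Prod>i<pfst (psnd c). lw (enc (pfst c)
    (ix (pfst (psnd (psnd c))) (pfst (psnd (psnd (psnd c)))) (psnd (psnd (psnd (psnd c)))) i)))" for c
  have "cf LW" unfolding LW_def ix_def mode_code_def by (intro cf_intros cf_comp[OF lw])
  moreover have LW: "real (LW (enc K (enc N (enc l (enc u v))))) / (2 ^ K) ^ N =
      (\<Prod>i<N. real (f (ix l u v i) K) / 2 ^ K)" for K N l u v
    unfolding LW_def lw_def using ix by (simp add: prod_dividef)
  moreover have "(\<Prod>i<N. real (f (ix l u v i) K) / 2 ^ K) \<le> kap N l u v" for K N l u v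
    unfolding kap_def kapF_def w_ix[symmetric] by (intro prod_mono conjI f) auto
  moreover have "(\<lambda>K. \<Prod>i<N. real (f (ix l u v i) K) / 2 ^ K) \<longlonglongrightarrow> kap N l u v" for N l u v
    unfolding kap_def kapF_def w_ix[symmetric] by (intro tendsto_prod f)
  ultimately show ?thesis unfolding LW_spec_def by (intro exI[of _ LW]) simp
qed

subsection \<open>The random labels\<close>

text \<open>One independent sample for every node in every possible mode; the labelling then reads
  the sample for the mode that actually occurs. The sample space is a product that does not depend
  on \<open>R\<close>.\<close>

definition Lam :: "(nat \<times> mode \<Rightarrow> trit \<times> trit) measure" where
  "Lam = (\<Pi>\<^sub>M k\<in>UNIV. measure_pmf (M (snd k)))"

lemma space_Lam [simp]: "space Lam = UNIV"
  by (simp add: Lam_def space_PiM)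

lemma prob_space_Lam: "prob_space Lam"
  unfolding Lam_def by (intro prob_space_PiM prob_space_measure_pmf)

lemma Lam_coordinates:
  assumes "finite J"
  shows "{\<omega>. \<forall>k\<in>J. \<omega> k \<in> S k} \<in> sets Lam"
    and "measure Lam {\<omega>. \<forall>k\<in>J. \<omega> k \<in> S k} = (\<Prod>k\<in>J. measure (M (snd k)) (S k))"
proof -
  interpret product_prob_space "\<lambda>k::nat \<times> mode. measure_pmf (M (snd k))" UNIV
    by unfold_locales
  have eq: "{\<omega>. \<forall>k\<in>J. \<omega> k \<in> S k} = {\<omega>\<in>space Lam. \<forall>k\<in>J. \<omega> k \<in> S k}"
    by auto
  show "{\<omega>. \<forall>k\<in>J. \<omega> k \<in> S k} \<in> sets Lam"
    unfolding eq Lam_def using assms by (intro sets.sets_Collect_finite_All sets_Collect_single') auto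
  have "emeasure Lam {\<omega>. \<forall>k\<in>J. \<omega> k \<in> S k} = (\<Prod>k\<in>J. emeasure (M (snd k)) (S k))"
    unfolding eq using emeasure_PiM_Collect[of J S] assms by (simp add: Lam_def)
  also have "\<dots> = ennreal (\<Prod>k\<in>J. measure (M (snd k)) (S k))"
    by (simp add: measure_pmf.emeasure_eq_measure prod_ennreal)
  finally show "measure Lam {\<omega>. \<forall>k\<in>J. \<omega> k \<in> S k} = (\<Prod>k\<in>J. measure (M (snd k)) (S k))"
    by (simp add: measure_def prod_nonneg)
qed

definition lab :: "(nat \<Rightarrow> trit) \<Rightarrow> (nat \<times> mode \<Rightarrow> trit \<times> trit) \<Rightarrow> nat \<Rightarrow> trit \<times> trit" where
  "lab x \<omega> = wfrec less_than (\<lambda>f c. \<omega> (c, mode (rl x) (fst \<circ> f) (snd \<circ> f) c))"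

abbreviation labP where "labP x \<omega> \<equiv> fst \<circ> lab x \<omega>"
abbreviation labQ where "labQ x \<omega> \<equiv> snd \<circ> lab x \<omega>"

lemma lab: "lab x \<omega> c = \<omega> (c, mode (rl x) (labP x \<omega>) (labQ x \<omega>) c)"
proof -
  define F where "F f c = \<omega> (c, mode (rl x) (fst \<circ> f) (snd \<circ> f) c)" for f c
  have lab: "lab x \<omega> = wfrec less_than F" unfolding lab_def F_def ..
  have "wfrec less_than F c = F (wfrec less_than F) c"
  proof (rule wfrec_nat)
    fix f g :: "nat \<Rightarrow> trit \<times> trit" and c
    assume "\<And>i. i < c \<Longrightarrow> f i = g i"
    then have "mode (rl x) (fst \<circ> f) (snd \<circ> f) c = mode (rl x) (fst \<circ> g) (snd \<circ> g) c"
      by (intro mode_cong) auto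
    then show "F f c = F g c" unfolding F_def by simp
  qed
  then show ?thesis unfolding lab[symmetric] F_def .
qed

text \<open>The mode of a node depends on earlier labels only. Once these are prescribed by
  \<open>u\<close> and \<open>v\<close>, the event fixes samples at \<open>N\<close> distinct
  coordinates.\<close>

lemma lab_event:
  assumes "u < 3 ^ N" "v < 3 ^ N"
  shows "{\<omega>\<in>space Lam. pre N (labP x \<omega>) = u \<and> pre N (labQ x \<omega>) = v} =
    {\<omega>. \<forall>k\<in>(\<lambda>i. (i, mode (rl x) (fld u) (fld v) i)) ` {..<N}. \<omega> k \<in> {(fld u (fst k), fld v (fst k))}}"
proof -
  have "(\<forall>i<N. lab x \<omega> i = (fld u i, fld v i)) \<longleftrightarrow>
      (\<forall>i<N. \<omega> (i, mode (rl x) (fld u) (fld v) i) = (fld u i, fld v i))" for \<omega>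
  proof -
    have m: "mode (rl x) (labP x \<omega>) (labQ x \<omega>) i = mode (rl x) (fld u) (fld v) i"
      if "\<And>j. j < i \<Longrightarrow> lab x \<omega> j = (fld u j, fld v j)" for i
      using that by (intro mode_cong) auto
    show ?thesis
    proof
      assume a: "\<forall>i<N. lab x \<omega> i = (fld u i, fld v i)"
      show "\<forall>i<N. \<omega> (i, mode (rl x) (fld u) (fld v) i) = (fld u i, fld v i)"
      proof (intro allI impI)
        fix i assume "i < N"
        then show "\<omega> (i, mode (rl x) (fld u) (fld v) i) = (fld u i, fld v i)"
          using a lab[of x \<omega> i] m[of i] by simp
      qed
    next
      assume a: "\<forall>i<N. \<omega> (i, mode (rl x) (fld u) (fld v) i) = (fld u i, fld v i)"
      have "i < N \<Longrightarrow> lab x \<omega> i = (fld u i, fld v i)" for i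
      proof (induction i rule: less_induct)
        case (less i)
        then show ?case using a lab[of x \<omega> i] m[of i] by simp
      qed
      then show "\<forall>i<N. lab x \<omega> i = (fld u i, fld v i)" by blast
    qed
  qed
  moreover have "pre N (labP x \<omega>) = u \<and> pre N (labQ x \<omega>) = v \<longleftrightarrow>
      (\<forall>i<N. lab x \<omega> i = (fld u i, fld v i))" for \<omega>
    unfolding pre_eq_iff'[OF assms(1)] pre_eq_iff'[OF assms(2)] by (auto simp: prod_eq_iff)
  ultimately show ?thesis by (simp add: lessThan_def)
qed

lemma sets_lab: "{\<omega>\<in>space Lam. pre N (labP x \<omega>) = u \<and> pre N (labQ x \<omega>) = v} \<in> sets Lam"
proof (cases "u < 3 ^ N \<and> v < 3 ^ N")
  case True
  then have u: "u < 3 ^ N" and v: "v < 3 ^ N" by auto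
  show ?thesis unfolding lab_event[OF u v] by (rule Lam_coordinates) simp
next
  case False
  then have empty: "{\<omega>\<in>space Lam. pre N (labP x \<omega>) = u \<and> pre N (labQ x \<omega>) = v} = {}"
    using pre_less by auto
  show ?thesis unfolding empty by simp
qed

lemma measure_lab:
  assumes "u < 3 ^ N" "v < 3 ^ N"
  shows "measure Lam {\<omega>\<in>space Lam. pre N (labP x \<omega>) = u \<and> pre N (labQ x \<omega>) = v} = kap N (pre N (rl x)) u v"
proof -
  have inj: "inj_on (\<lambda>i. (i, mode (rl x) (fld u) (fld v) i)) {..<N}" by (simp add: inj_on_def)
  have "measure Lam {\<omega>\<in>space Lam. pre N (labP x \<omega>) = u \<and> pre N (labQ x \<omega>) = v} =
      (\<Prod>i<N. measure (M (mode (rl x) (fld u) (fld v) i)) {(fld u i, fld v i)})"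
    unfolding lab_event[OF assms] by (subst Lam_coordinates(2)) (simp_all add: prod.reindex[OF inj])
  then show ?thesis unfolding kap_rl kapF_def by (simp add: measure_pmf_single pmf_M)
qed

section \<open>Almost sure properties of the random labels\<close>

lemma AE_support: "AE \<omega> in Lam. \<forall>k. md (snd k) (\<omega> k) \<noteq> 0"
proof -
  have ctb: "countable (UNIV :: (nat \<times> mode) set)"
  proof -
    have "(UNIV :: mode set) = insert ME (insert MN (MR ` UNIV))"
      using mode.exhaust by auto
    then have "finite (UNIV :: mode set)" by (metis finite_imageI finite_insert finite_trit)
    then have "countable ((UNIV :: nat set) \<times> (UNIV :: mode set))"
      by (intro countable_SIGMA) (auto intro: countable_finite)
    then show ?thesis by simp
  qed
  have "AE \<omega> in Lam. md (snd k) (\<omega> k) \<noteq> 0" for k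
    unfolding Lam_def
  proof (rule AE_PiM_component)
    show "AE ab in M (snd k). md (snd k) ab \<noteq> 0"
      using AE_measure_pmf[of "M (snd k)"] by eventually_elim (simp add: set_pmf_iff pmf_M)
  qed (auto intro: prob_space_measure_pmf)
  then have "AE \<omega> in Lam. \<forall>k\<in>UNIV. md (snd k) (\<omega> k) \<noteq> 0"
    using ctb by (subst AE_ball_countable) auto
  then show ?thesis by simp
qed

text \<open>The common subtree below a node in mode \<open>ME\<close> is a subcritical branching process.\<close>

definition v :: "bool \<Rightarrow> real" where
  "v b = measure (M ME) {ab. sh ab b}"

text \<open>The mean number of common children in mode \<open>ME\<close> is the derivative of the
  generating function at \<open>e\<close>, namely
  \<open>1 - none - a2 + 2 * a2 * e = 1 - a2 + none\<close>. For \<open>e = 0\<close> the default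
  labels give no common child.\<close>

lemma v_sum: "v False + v True < 1"
proof -
  have v: "v b = (\<Sum>ab\<in>UNIV. of_bool (sh ab b) * md ME ab)" for b
  proof -
    have "v b = (\<Sum>ab\<in>{ab. sh ab b}. pmf (M ME) ab)"
      unfolding v_def by (rule measure_measure_pmf_finite) (rule finite_subset[OF subset_UNIV finite_trit_pair])
    also have "\<dots> = (\<Sum>ab\<in>UNIV. of_bool (sh ab b) * md ME ab)"
      unfolding pmf_M by (intro sum.mono_neutral_cong_left) auto
    finally show ?thesis .
  qed
  show ?thesis
  proof (cases "e = 0")
    case True
    then have "v b = 0" for b
      unfolding v md_def by (cases b) (simp_all add: sum_trit_pair sum_trit sh_def allows_def)
    then show ?thesis by simp
  next
    case False
    have eq: "v b = (\<Sum>ab\<in>UNIV. of_bool (sh ab b) * (ww ab * hE (sh ab False) * hE (sh ab True))) / e" for b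
      unfolding v md_def sum_divide_distrib using False by (intro sum.cong refl) simp
    have "(v False + v True) * e = (1 - none - a2) * e + 2 * (a2 * e) * e"
      unfolding eq add_divide_distrib[symmetric] none_def a2_def using False
      by (simp add: expand_pairs) (simp add: algebra_simps)
    then have "(v False + v True) * e = (1 - none - a2 + 2 * none) * e"
      unfolding a2_e by (simp add: algebra_simps)
    then have "v False + v True = 1 - a2 + none" using False by simp
    then show ?thesis using none_less by linarith
  qed
qed

text \<open>First moment bound: the probability of a common path of length \<open>n\<close> is at
  most the sum over all bit strings of the products of \<open>v\<close>, which is
  \<open>(v False + v True) ^ n\<close>. All samples are read in mode \<open>ME\<close>, whatever
  the actual modes are.\<close>

lemma AE_extinction:
  assumes "0 < c"
  shows "AE \<omega> in Lam. \<not> (\<exists>X. \<forall>n. sh (\<omega> (nd c X n, ME)) (X n))"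
proof -
  interpret prob_space Lam by (rule prob_space_Lam)
  \<comment> \<open>The condition at a coordinate looks up which step of the path visits its node.
    Heap codes grow along a path, so the step is unique and the coordinates are independent.\<close>
  define Z where "Z bs = {\<omega>. \<forall>k\<in>(\<lambda>i. (nd c ((!) bs) i, ME)) ` {..<length bs}.
      \<omega> k \<in> {ab. \<forall>i<length bs. nd c ((!) bs) i = fst k \<longrightarrow> sh ab (bs ! i)}}" for bs
  have nd_eq: "nd c X i = nd c X j \<longleftrightarrow> i = j" for X i j
    using strict_mono_eq[OF strict_mono_nd[OF assms]] by blast
  have Z: "Z bs = {\<omega>. \<forall>i<length bs. sh (\<omega> (nd c ((!) bs) i, ME)) (bs ! i)}" for bs
    unfolding Z_def by (auto simp: nd_eq)
  have Zs: "Z bs \<in> sets Lam" for bs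
    unfolding Z_def by (rule Lam_coordinates) simp
  have Zm: "measure Lam (Z bs) = (\<Prod>i<length bs. v (bs ! i))" for bs
  proof -
    have inj: "inj_on (\<lambda>i. (nd c ((!) bs) i, ME)) {..<length bs}" by (simp add: inj_on_def nd_eq)
    have "measure Lam (Z bs) = (\<Prod>i<length bs. measure (M ME)
        {ab. \<forall>j<length bs. nd c ((!) bs) j = nd c ((!) bs) i \<longrightarrow> sh ab (bs ! j)})"
      unfolding Z_def by (subst Lam_coordinates(2)) (simp_all add: prod.reindex[OF inj])
    also have "\<dots> = (\<Prod>i<length bs. v (bs ! i))"
      unfolding v_def nd_eq by (intro prod.cong refl arg_cong2[where f = measure]) auto
    finally show ?thesis .
  qed
  define Y where "Y n = (\<Union>bs\<in>{bs. length bs = n}. Z bs)" for n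
  have fin: "finite {bs :: bool list. length bs = n}" for n
    using finite_lists_length_eq[of "UNIV :: bool set" n] by simp
  have Ys: "Y n \<in> sets Lam" for n unfolding Y_def using Zs fin by (intro sets.finite_UN) auto
  have Ym: "measure Lam (Y n) \<le> (v False + v True) ^ n" for n
  proof -
    have "measure Lam (Y n) \<le> (\<Sum>bs | length bs = n. measure Lam (Z bs))"
      unfolding Y_def using fin Zs by (intro finite_measure_subadditive_finite) auto
    also have "\<dots> = (\<Sum>bs | length bs = n. \<Prod>i<n. v (bs ! i))" by (intro sum.cong refl) (simp add: Zm)
    finally show ?thesis unfolding sum_lists_prod .
  qed
  have "0 \<le> v b" for b unfolding v_def by simp
  then have "(\<lambda>n. (v False + v True) ^ n) \<longlonglongrightarrow> 0"
    using v_sum by (intro LIMSEQ_realpow_zero) auto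
  moreover have "measure Lam (\<Inter>n. Y n) \<le> (v False + v True) ^ n" for n
  proof -
    have "measure Lam (\<Inter>n. Y n) \<le> measure Lam (Y n)"
      using Ys by (intro finite_measure_mono) auto
    then show ?thesis using Ym[of n] by linarith
  qed
  ultimately have "measure Lam (\<Inter>n. Y n) \<le> 0" by (intro LIMSEQ_le_const) auto
  then have "measure Lam (\<Inter>n. Y n) = 0" by (simp add: order_antisym)
  moreover have "(\<Inter>n. Y n) \<in> sets Lam" using Ys by blast
  ultimately have "(\<Inter>n. Y n) \<in> null_sets Lam" by (simp add: null_sets_def emeasure_eq_measure)
  then have "AE \<omega> in Lam. \<omega> \<notin> (\<Inter>n. Y n)" by (rule AE_not_in)
  then show ?thesis
  proof eventually_elim
    case (elim \<omega>)
    show ?case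
    proof
      assume "\<exists>X. \<forall>n. sh (\<omega> (nd c X n, ME)) (X n)"
      then obtain X where X: "\<And>n. sh (\<omega> (nd c X n, ME)) (X n)" by blast
      have "\<omega> \<in> Y n" for n
      proof -
        have "nd c ((!) (map X [0..<n])) i = nd c X i" if "i < n" for i
          using that by (intro nd_cong) auto
        then have "\<omega> \<in> Z (map X [0..<n])" unfolding Z using X by auto
        then show ?thesis unfolding Y_def by (intro UN_I[of "map X [0..<n]"]) auto
      qed
      then show False using elim by blast
    qed
  qed
qed

text \<open>Since \<open>hB False = 0\<close>, a pair of labels of nonzero weight makes every child
  in the tree of \<open>R\<close> common; the default pair \<open>(l, l)\<close> does so as
  well.\<close>

lemma tree_R_subset:
  assumes "\<And>k. md (snd k) (\<omega> k) \<noteq> 0"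
  shows "tree (rl x) c \<Longrightarrow> tree (labP x \<omega>) c \<and> tree (labQ x \<omega>) c"
proof (induction c rule: less_induct)
  case (less c)
  show ?case
  proof (cases "2 \<le> c")
    case False
    then have "c = Suc 0" using tree_pos[OF less.prems] by linarith
    then show ?thesis by simp
  next
    case True
    define d b where "d = c div 2" and "b = odd c"
    have R: "tree (rl x) d" "allows (rl x d) b"
      using less.prems tree_parent[OF True] unfolding d_def b_def by auto
    have "d < c" using True unfolding d_def by simp
    from less.IH[OF this R(1)] have PQ: "tree (labP x \<omega>) d" "tree (labQ x \<omega>) d" by blast+
    let ?m = "MR (rl x d)"
    have "lab x \<omega> d = \<omega> (d, ?m)" using lab[of x \<omega> d] R(1) by (simp add: mode_def)
    then have md: "md ?m (lab x \<omega> d) \<noteq> 0" using assms[of "(d, ?m)"] by simp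
    have "sh (lab x \<omega> d) b"
    proof (cases "nrm ?m = 0")
      case True
      then have "lab x \<omega> d = (rl x d, rl x d)" using md unfolding md_def by (simp split: if_splits)
      then show ?thesis using R(2) by (simp add: sh_def)
    next
      case False
      then have "num ?m (lab x \<omega> d) \<noteq> 0" using md unfolding md_def by simp
      then show ?thesis using R(2) by (cases b) (auto simp: hB_def split: if_splits)
    qed
    then show ?thesis
      using PQ unfolding tree_parent[OF True] d_def b_def sh_def comp_apply by blast
  qed
qed

text \<open>A common branch that leaves the tree of \<open>R\<close> at some node never returns. All
  its nodes from there on are in mode \<open>ME\<close>, which gives an infinite common path
  excluded by \<open>ext\<close>.\<close>

lemma intersection:
  assumes supp: "\<And>k. md (snd k) (\<omega> k) \<noteq> 0"
    and ext: "\<And>c. 0 < c \<Longrightarrow> \<not> (\<exists>X. \<forall>n. sh (\<omega> (nd c X n, ME)) (X n))"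
  shows "branches (code_tree x) =
    branches (code_tree (Phi (labP x \<omega>))) \<inter> branches (code_tree (Phi (labQ x \<omega>)))"
proof -
  have br: "X \<in> branches (code_tree y) \<longleftrightarrow> (\<forall>n. tree A (hc (map X [0..<n])))" if "codes A y" for X y A
    unfolding branches_def using mem_code_tree[OF that] by simp
  note br = br[OF codes_rl[of x]] br[OF codes_Phi]
  have "X \<in> branches (code_tree x)"
    if "X \<in> branches (code_tree (Phi (labP x \<omega>)))" "X \<in> branches (code_tree (Phi (labQ x \<omega>)))" for X
  proof (rule ccontr)
    define N where "N n = hc (map X [0..<n])" for n
    have NS: "N (Suc n) = 2 * N n + of_bool (X n)" for n by (simp add: N_def)
    have pos: "0 < N n" for n unfolding N_def by (rule hc_pos)
    have P: "tree (labP x \<omega>) (N n)" and Q: "tree (labQ x \<omega>) (N n)" for n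
      using that unfolding br N_def by auto
    assume "X \<notin> branches (code_tree x)"
    then obtain n0 where n0: "\<not> tree (rl x) (N n0)" unfolding br N_def by blast
    have nR: "\<not> tree (rl x) (N (n0 + m))" for m
      by (induction m) (auto simp: n0 NS tree_child[OF pos])
    have "sh (\<omega> (nd (N n0) (\<lambda>i. X (n0 + i)) m, ME)) (X (n0 + m))" for m
    proof -
      have nd: "nd (N n0) (\<lambda>i. X (n0 + i)) m = N (n0 + m)" unfolding N_def by (rule nd_hc)
      have "lab x \<omega> (N (n0 + m)) = \<omega> (N (n0 + m), ME)"
        using lab[of x \<omega> "N (n0 + m)"] nR P Q by (simp add: mode_def)
      moreover have "sh (lab x \<omega> (N (n0 + m))) (X (n0 + m))"
        using P[of "Suc (n0 + m)"] Q[of "Suc (n0 + m)"] unfolding NS tree_child[OF pos] by (simp add: sh_def)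
      ultimately show ?thesis unfolding nd by simp
    qed
    then show False using ext[OF pos, of n0] by blast
  qed
  then show ?thesis
    using tree_R_subset[OF supp, of x] unfolding set_eq_iff Int_iff br by blast
qed

section \<open>Escape from all tests and choice of the pair\<close>

lemma AE_not_ev:
  assumes lo: "lower_weights p q lo" "lower_weights r s lo'" and E: "cf E"
    and rand: "ml_random (bernoulli pR qR) {} x"
  shows "AE \<omega> in Lam. \<not> (\<forall>n. \<exists>N. ev lo E n N (pre N (labP x \<omega>)) (pre N (labQ x \<omega>)))"
    and "AE \<omega> in Lam. \<not> (\<forall>n. \<exists>N. ev lo' E n N (pre N (labQ x \<omega>)) (pre N (labP x \<omega>)))"
proof -
  obtain LW where LW: "cf LW"
    "\<And>K N l u v. real (LW (enc K (enc N (enc l (enc u v))))) / (2 ^ K) ^ N \<le> kap N l u v"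
    "\<And>N l u v. (\<lambda>K. real (LW (enc K (enc N (enc l (enc u v))))) / (2 ^ K) ^ N) \<longlonglongrightarrow> kap N l u v"
    using ex_LW unfolding LW_spec_def by blast
  have C: "0 \<le> 1 / (1 - e)" using e_bounds by simp
  show "AE \<omega> in Lam. \<not> (\<forall>n. \<exists>N. ev lo E n N (pre N (labP x \<omega>)) (pre N (labQ x \<omega>)))"
    by (rule null_test[OF valid validR lo(1) E prob_space_Lam sets_lab measure_lab LW density_bound C rand])
  \<comment> \<open>For the tests of \<open>Q\<close> relative to \<open>P\<close> the roles of the
    two labellings are exchanged, so the approximation takes \<open>u\<close> and \<open>v\<close>
    in the other order.\<close>
  define LW' where "LW' c = LW (enc (pfst c) (enc (pfst (psnd c)) (enc (pfst (psnd (psnd c)))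
    (enc (psnd (psnd (psnd (psnd c)))) (pfst (psnd (psnd (psnd c))))))))" for c
  have LW': "cf LW'" unfolding LW'_def by (intro cf_intros cf_comp[OF LW(1)])
  have swap: "{\<omega>\<in>space Lam. pre N (labQ x \<omega>) = u \<and> pre N (labP x \<omega>) = v} =
      {\<omega>\<in>space Lam. pre N (labP x \<omega>) = v \<and> pre N (labQ x \<omega>) = u}" for x N u v
    by auto
  show "AE \<omega> in Lam. \<not> (\<forall>n. \<exists>N. ev lo' E n N (pre N (labQ x \<omega>)) (pre N (labP x \<omega>)))"
  proof (rule null_test[where \<Lambda> = Lam and kap = "\<lambda>N l u v. kap N l v u" and LW = LW' and
      labA = labQ and labB = labP, OF valid(2,1) validR lo(2) E prob_space_Lam _ _ LW' _ _ _ C rand])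
    fix N u v :: nat assume uv: "u < 3 ^ N" "v < 3 ^ N"
    show "measure Lam {\<omega>\<in>space Lam. pre N (labQ x \<omega>) = u \<and> pre N (labP x \<omega>) = v} = kap N (pre N (rl x)) v u" for x
      unfolding swap by (rule measure_lab[OF uv(2,1)])
    show "(\<Sum>\<rho><3 ^ N. wt pR qR N \<rho> * kap N (rlnum N \<rho>) v u) \<le> 1 / (1 - e) * (wt r s N u * wt p q N v)"
      using density_bound[OF uv(2,1)] by (simp add: mult.commute)
  next
    show "{\<omega>\<in>space Lam. pre N (labQ x \<omega>) = u \<and> pre N (labP x \<omega>) = v} \<in> sets Lam" for x N u v
      unfolding swap by (rule sets_lab)
  qed (use LW(2,3) in \<open>auto simp: LW'_def\<close>)
qed

text \<open>Countably many simulators and countably many starting nodes give countably many almost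
  sure conditions, so one sample satisfies them all.\<close>

lemma ex_random_pair:
  assumes "ml_random (bernoulli pR qR) {} x"
  shows "\<exists>y z. ml_random (bernoulli p q) {seq_oracle z} y \<and> ml_random (bernoulli r s) {seq_oracle y} z \<and>
    branches (code_tree x) = branches (code_tree y) \<inter> branches (code_tree z)"
proof -
  obtain lo lo' where lo: "lower_weights p q lo" "lower_weights r s lo'"
    using ex_lower_weights cr_trit_weight cr_params valid by meson
  interpret prob_space Lam by (rule prob_space_Lam)
  have "AE \<omega> in Lam. \<forall>E\<in>{E. cf E}. \<not> (\<forall>n. \<exists>N. ev lo E n N (pre N (labP x \<omega>)) (pre N (labQ x \<omega>)))"
    using AE_not_ev(1)[OF lo _ assms] by (subst AE_ball_countable[OF countable_computable]) blast
  moreover have "AE \<omega> in Lam. \<forall>E\<in>{E. cf E}. \<not> (\<forall>n. \<exists>N. ev lo' E n N (pre N (labQ x \<omega>)) (pre N (labP x \<omega>)))"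
    using AE_not_ev(2)[OF lo _ assms] by (subst AE_ball_countable[OF countable_computable]) blast
  moreover note AE_support
  moreover have "AE \<omega> in Lam. \<forall>c\<in>{0<..}. \<not> (\<exists>X. \<forall>n. sh (\<omega> (nd c X n, ME)) (X n))"
    using AE_extinction by (subst AE_ball_countable) auto
  ultimately have "AE \<omega> in Lam.
      (\<forall>E\<in>{E. cf E}. \<not> (\<forall>n. \<exists>N. ev lo E n N (pre N (labP x \<omega>)) (pre N (labQ x \<omega>)))) \<and>
      (\<forall>E\<in>{E. cf E}. \<not> (\<forall>n. \<exists>N. ev lo' E n N (pre N (labQ x \<omega>)) (pre N (labP x \<omega>)))) \<and>
      (\<forall>k. md (snd k) (\<omega> k) \<noteq> 0) \<and>
      (\<forall>c\<in>{0<..}. \<not> (\<exists>X. \<forall>n. sh (\<omega> (nd c X n, ME)) (X n)))"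
    by eventually_elim blast
  from eventually_happens'[OF ae_filter_bot this] obtain \<omega> where
    1: "\<forall>E\<in>{E. cf E}. \<not> (\<forall>n. \<exists>N. ev lo E n N (pre N (labP x \<omega>)) (pre N (labQ x \<omega>)))" and
    2: "\<forall>E\<in>{E. cf E}. \<not> (\<forall>n. \<exists>N. ev lo' E n N (pre N (labQ x \<omega>)) (pre N (labP x \<omega>)))" and
    3: "\<forall>k. md (snd k) (\<omega> k) \<noteq> 0" and
    4: "\<forall>c\<in>{0<..}. \<not> (\<exists>X. \<forall>n. sh (\<omega> (nd c X n, ME)) (X n))"
    by blast
  have "ml_random (bernoulli p q) {seq_oracle (Phi (labQ x \<omega>))} (Phi (labP x \<omega>))"
    using not_random_imp_ev[OF valid(1) lo(1)] 1 by blast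
  moreover have "ml_random (bernoulli r s) {seq_oracle (Phi (labP x \<omega>))} (Phi (labQ x \<omega>))"
    using not_random_imp_ev[OF valid(2) lo(2)] 2 by blast
  moreover have "branches (code_tree x) =
      branches (code_tree (Phi (labP x \<omega>))) \<inter> branches (code_tree (Phi (labQ x \<omega>)))"
    using 3 4 by (intro intersection) auto
  ultimately show ?thesis by blast
qed

end

section \<open>Return from codes to closed sets\<close>

lemma set_code_branches: "set_code (branches (code_tree x)) = x"
  and branches_closed_sets: "branches (code_tree x) \<in> closed_sets"
proof -
  show *: "branches (code_tree x) \<in> closed_sets" for x
    using bij_betw_branches_code_tree by (auto simp: bij_betw_def)
  have inj: "inj (\<lambda>x. branches (code_tree x))"
    using bij_betw_branches_code_tree by (rule bij_betw_imp_inj_on)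
  show "set_code (branches (code_tree x)) = x"
    using branches_set_code[OF *] by (intro injD[OF inj])
qed

theorem theorem9:
  fixes p q r s :: real and R :: "(nat \<Rightarrow> bool) set"
  assumes "computable_real p" "computable_real q" "computable_real r" "computable_real s"
    and "0 \<le> p" "0 \<le> q" "0 \<le> r" "0 \<le> s"
    and "p + q \<le> 1" and "r + s \<le> 1"
    and "p + q + r + s < 1 + p * r + q * s"
    and "R \<in> closed_sets"
    and "closed_random (p + r - p * r) (q + s - q * s) {} R"
  shows "\<exists>P\<in>closed_sets. \<exists>Q\<in>closed_sets.
    closed_random p q {seq_oracle (set_code Q)} P \<and>
    closed_random r s {seq_oracle (set_code P)} Q \<and>
    R = P \<inter> Q"
proof -
  interpret coupling p q r s
    using assms by unfold_locales (auto intro: cr_computable_real simp: valid_def)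
  have "ml_random (bernoulli pR qR) {} (set_code R)"
    using assms(13) unfolding closed_random_def pR_def qR_def .
  then obtain y z where yz: "ml_random (bernoulli p q) {seq_oracle z} y"
    "ml_random (bernoulli r s) {seq_oracle y} z"
    "branches (code_tree (set_code R)) = branches (code_tree y) \<inter> branches (code_tree z)"
    using ex_random_pair by blast
  show ?thesis
  proof (intro bexI conjI)
    show "R = branches (code_tree y) \<inter> branches (code_tree z)"
      using yz(3) branches_set_code[OF assms(12)] by simp
  qed (use yz in \<open>simp_all add: closed_random_def set_code_branches branches_closed_sets\<close>)
qed

end
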